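(* Let $\mathcal A_{\mathbb C}$ be a unital C*-algebra with trivial center and satisfying Property B. Let $\mathfrak Z$ be a unital abelian C*-algebra and define $\mathcal A:=\mathcal A_{\mathbb C}\otimes\mathfrak Z$, so that $\mathcal Z:=\mathcal Z(\mathcal A)=\mathbf 1\otimes\mathfrak Z$. Let $\mathcal T_{\mathrm{DR}}$ be a DR-category realized as endomorphisms of $\mathcal A_{\mathbb C}$, let $\mathcal G$ be its associated compact group with chain group $\mathfrak C$, fix a group homomorphism $\mathfrak C\ni[D]\mapsto\alpha_{[D]}\in\mathrm{Aut}\,\mathcal Z$, and let $\mathcal T$ be the C*-category of endomorphisms $\widetilde\tau$ ($\tau\in\mathrm{Ob}\,\mathcal T_{\mathrm{DR}}$) of $\mathcal A$ constructed from these data (see context). Define the C*-category $\mathcal T_{\mathbb C}$ by $\mathrm{Ob}\,\mathcal T_{\mathbb C}:=\mathrm{Ob}\,\mathcal T$ and $$(\widetilde\sigma,\widetilde\tau)_{\mathbb C}:=(\sigma,\tau)\otimes\mathbf 1\subset\mathcal A,$$ where $\sigma,\tau$ are the objects of $\mathcal T_{\mathrm{DR}}$ corresponding to $\widetilde\sigma,\widetilde\tau\in\mathrm{Ob}\,\mathcal T$. Then $\mathcal T_{\mathbb C}$ is an admissible subcategory of $\mathcal T$, i.e. the arrows satisfy $$(\widetilde\sigma,\widetilde\tau)=(\widetilde\sigma,\widetilde\tau)_{\mathbb C}\;\widetilde\sigma(\mathcal Z).$$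
   Context: Property B: the algebra contains isometries $V,W$ with $VV^*+WW^*=\mathbf 1$. For endomorphisms $\sigma,\tau$ of a unital C*-algebra $\mathcal B$, $(\sigma,\tau)=\{X\in\mathcal B:X\sigma(B)=\tau(B)X\ \forall B\in\mathcal B\}$; these are the arrows of the category of unital endomorphisms of $\mathcal B$, with tensor product given by composition on objects, $X\times Y=X\sigma(Y)$ for $X\in(\sigma,\sigma')$, $Y\in(\tau,\tau')$ on arrows, and unit $\iota=\mathrm{id}$. A DR-category is a tensor C*-category with $(\iota,\iota)=\mathbb C\mathbf 1$, closed under direct sums (for objects $\sigma,\tau$ there are an object $\rho$ and isometries $V\in(\sigma,\rho)$, $W\in(\tau,\rho)$ with $VV^*+WW^*=\mathbf 1$) and subobjects (for each nonzero projection $E\in(\sigma,\sigma)$ there are an object $\tau$ and an isometry $V\in(\tau,\sigma)$ with $VV^*=E$), with a permutation structure (unitaries $\epsilon(\sigma,\tau)\in(\sigma\tau,\tau\sigma)$ with $\epsilon(\sigma,\tau)\epsilon(\tau,\sigma)=\mathbf 1$, $\epsilon(\iota,\sigma)=\epsilon(\sigma,\iota)=\mathbf 1$, $\epsilon(\sigma_1\sigma_2,\sigma_3)=\epsilon(\sigma_1,\sigma_3)\sigma_1(\epsilon(\sigma_2,\sigma_3))$, $\epsilon(\sigma',\tau')(A\times B)=(B\times A)\epsilon(\sigma,\tau)$ for arrows $A\in(\sigma,\sigma')$, $B\in(\tau,\tau')$) and a conjugation structure (to each $\sigma$ an object $\overline\sigma$ and $R_\sigma\in(\iota,\overline\sigma\sigma)$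 with, for $S_\sigma=\epsilon(\overline\sigma,\sigma)R_\sigma$, $S_\sigma^*\sigma(R_\sigma)=\mathbf 1=R_\sigma^*\overline\sigma(S_\sigma)$). Here $\mathcal T_{\mathrm{DR}}$ consists of unital endomorphisms of $\mathcal A_{\mathbb C}$ with arrows the full intertwiner spaces $(\rho,\sigma)\subset\mathcal A_{\mathbb C}$. Doplicher-Roberts duality associates with it an essentially unique compact group $\mathcal G$ such that $\mathcal T_{\mathrm{DR}}$ is equivalent, as a symmetric tensor C*-category with conjugates, to the finite-dimensional unitary representations of $\mathcal G$; thus each irreducible $\rho$ (i.e. $(\rho,\rho)=\mathbb C\mathbf 1$) has an associated class $D\in\widehat{\mathcal G}$. Chain group $\mathfrak C$ of $\mathcal G$: for $D_1,D_2\in\widehat{\mathcal G}$, $D_1\times D_2$ is the set of classes in the decomposition of $U_{D_1}\otimes U_{D_2}$ (extended to subsets by unions); $D\approx D'$ if there are $D_1,\dots,D_n$ with $D,D'\in D_1\times\dots\times D_n$; $\mathfrak C$ is the set of classes $[D]$, an abelian group under $[D_0]\boxtimes[D_1]=[D]$ for any $D\in D_0\times D_1$. Automorphisms of $\mathcal Z=\mathbf 1\otimes\mathfrak Z$ are identified with automorphisms of $\mathfrak Z$. Construction of $\mathcal T$: (a) if $\rho\in\mathrm{Ob}\,\mathcal T_{\mathrm{DR}}$ is irreducible with associated class $D$, put $\widetilde\rho:=\rho\otimes\alpha_{[D]}\in\mathrm{End}\,\mathcal A$. (b) For general $\tau\in\mathrm{Ob}\,\mathcal T_{\mathrm{DR}}$,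 write $\tau(\cdot)=\sum_{\rho,l}W_{\rho,l}\,\rho(\cdot)\,W_{\rho,l}^*$, with $\rho$ running over mutually inequivalent irreducible objects and $\{W_{\rho,l}\}_l$ an orthonormal basis of the algebraic Hilbert space $(\rho,\tau)$ (scalar product $\langle A,B\rangle\mathbf 1=A^*B$), and put $\widetilde\tau(\cdot):=\sum_{\rho,l}(W_{\rho,l}\otimes\mathbf 1)\,\widetilde\rho(\cdot)\,(W_{\rho,l}\otimes\mathbf 1)^*$. The objects of $\mathcal T$ are the $\widetilde\tau$, in bijection with $\mathrm{Ob}\,\mathcal T_{\mathrm{DR}}$. (c) The arrows of $\mathcal T$ are the full intertwiner spaces $(\widetilde\sigma,\widetilde\tau)\subset\mathcal A$. Admissible: $\mathcal T_{\mathbb C}$ is a DR-subcategory of $\mathcal T$ with the same objects and arrows $(\widetilde\sigma,\widetilde\tau)_{\mathbb C}\subseteq(\widetilde\sigma,\widetilde\tau)$ satisfying the displayed equation of the claim (the right-hand side being the linear span of products). *)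

theory Defs
  imports
    "HOL-Analysis.Analysis"
    "HOL-Algebra.Group"
    "Jordan_Normal_Form.Schur_Decomposition"
begin

section \<open>Unital C*-algebras\<close>

text \<open>
  Unital complex C*-algebras. The library class \<open>real_normed_algebra_1\<close> forces the norm of the unit
  to be 1, so the zero algebra is excluded.
\<close>

class cstar_algebra = real_normed_algebra_1 + banach +
  fixes scaleC :: "complex \<Rightarrow> 'a \<Rightarrow> 'a" (infixr "*\<^sub>C" 75)
    and star :: "'a \<Rightarrow> 'a" ("(_\<^sup>\<star>)" [1000] 999)
  assumes scaleC_add_right: "c *\<^sub>C (x + y) = c *\<^sub>C x + c *\<^sub>C y"
    and scaleC_add_left: "(c + d) *\<^sub>C x = c *\<^sub>C x + d *\<^sub>C x"
    and scaleC_scaleC: "c *\<^sub>C (d *\<^sub>C x) = (c * d) *\<^sub>C x"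
    and scaleC_of_real: "complex_of_real r *\<^sub>C x = r *\<^sub>R x"
    and mult_scaleC_left: "(c *\<^sub>C x) * y = c *\<^sub>C (x * y)"
    and mult_scaleC_right: "x * (c *\<^sub>C y) = c *\<^sub>C (x * y)"
    and norm_scaleC: "norm (c *\<^sub>C x) = cmod c * norm x"
    and star_star: "(x\<^sup>\<star>)\<^sup>\<star> = x"
    and star_add: "(x + y)\<^sup>\<star> = x\<^sup>\<star> + y\<^sup>\<star>"
    and star_scaleC: "(c *\<^sub>C x)\<^sup>\<star> = cnj c *\<^sub>C x\<^sup>\<star>"
    and star_mult: "(x * y)\<^sup>\<star> = y\<^sup>\<star> * x\<^sup>\<star>"
    and cstar_identity: "norm (x\<^sup>\<star> * x) = (norm x)\<^sup>2"

lemma vector_space_scaleC: "vector_space (scaleC :: complex \<Rightarrow> 'a \<Rightarrow> 'a::cstar_algebra)"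
proof
  fix x :: 'a
  show "1 *\<^sub>C x = x"
    using scaleC_of_real[of 1 x] by simp
qed (simp_all add: scaleC_add_right scaleC_add_left scaleC_scaleC)

lemma module_scaleC: "Modules.module (scaleC :: complex \<Rightarrow> 'a \<Rightarrow> 'a::cstar_algebra)"
  using vector_space_scaleC by (rule module_iff_vector_space[THEN iffD2])

instantiation complex :: cstar_algebra
begin

definition scaleC_complex :: "complex \<Rightarrow> complex \<Rightarrow> complex" where
  "scaleC_complex = (*)"

definition star_complex :: "complex \<Rightarrow> complex" where
  "star_complex = cnj"

instance
  by standard
    (simp_all add: scaleC_complex_def star_complex_def algebra_simps scaleR_conv_of_real
      norm_mult power2_eq_square)

end

abbreviation csubspace :: "'a::cstar_algebra set \<Rightarrow> bool" where
  "csubspace \<equiv> Modules.module.subspace scaleC"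

abbreviation cspan :: "'a::cstar_algebra set \<Rightarrow> 'a set" where
  "cspan \<equiv> Modules.module.span scaleC"

definition center :: "'a::cstar_algebra set" where
  "center = {z. \<forall>x. z * x = x * z}"

definition scalars :: "'a::cstar_algebra set" where
  "scalars = range (\<lambda>c. c *\<^sub>C 1)"

definition isometry :: "'a::cstar_algebra \<Rightarrow> bool" where
  "isometry V \<longleftrightarrow> V\<^sup>\<star> * V = 1"

definition unitary :: "'a::cstar_algebra \<Rightarrow> bool" where
  "unitary U \<longleftrightarrow> U\<^sup>\<star> * U = 1 \<and> U * U\<^sup>\<star> = 1"

definition projection :: "'a::cstar_algebra \<Rightarrow> bool" where
  "projection E \<longleftrightarrow> E * E = E \<and> E\<^sup>\<star> = E"

definition property_B :: "'a::cstar_algebra itself \<Rightarrow> bool" where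
  "property_B _ \<longleftrightarrow> (\<exists>V W :: 'a. isometry V \<and> isometry W \<and> V * V\<^sup>\<star> + W * W\<^sup>\<star> = 1)"

definition unital_star_hom :: "('a::cstar_algebra \<Rightarrow> 'b::cstar_algebra) \<Rightarrow> bool" where
  "unital_star_hom f \<longleftrightarrow>
     (\<forall>x y. f (x + y) = f x + f y) \<and> (\<forall>c x. f (c *\<^sub>C x) = c *\<^sub>C f x) \<and>
     (\<forall>x y. f (x * y) = f x * f y) \<and> f 1 = 1 \<and> (\<forall>x. f (x\<^sup>\<star>) = (f x)\<^sup>\<star>)"

definition aut_group :: "('z::cstar_algebra \<Rightarrow> 'z) monoid" where
  "aut_group = \<lparr>carrier = {f. unital_star_hom f \<and> bij f}, mult = (\<circ>), one = id\<rparr>"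

definition characters :: "('z::cstar_algebra \<Rightarrow> complex) set" where
  "characters = {\<omega>. unital_star_hom \<omega>}"

section \<open>Tensor product with an abelian C*-algebra\<close>

text \<open>
  \<open>'t\<close>, with the elementary tensors \<open>tens a z\<close>, is the C*-tensor product of \<open>'a\<close> and the abelian
  C*-algebra \<open>'z\<close>: the algebraic tensor product, completed in the minimal C*-norm, i.e. the supremum
  of the seminorms induced by pairs of irreducible representations of the factors. The irreducible
  representations of \<open>'z\<close> are its characters, which yields the formula \<open>norm_tens_sum\<close>. (Since \<open>'z\<close>
  is abelian, hence nuclear, this is the only C*-norm on the algebraic tensor product.) That a sum
  \<open>\<Sum>i<n. tens (x i) (z i)\<close> with linearly independent \<open>x i\<close> vanishes only if all \<open>z i\<close> vanish,
  so that the algebraic tensor product does embed, follows from the two norm axioms.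
\<close>

locale cstar_tensor_product =
  fixes tens :: "'a::cstar_algebra \<Rightarrow> 'z::{cstar_algebra,comm_ring_1} \<Rightarrow> 't::cstar_algebra"
  assumes tens_add_left: "tens (x + y) z = tens x z + tens y z"
    and tens_add_right: "tens x (z + w) = tens x z + tens x w"
    and tens_scaleC_left: "tens (c *\<^sub>C x) z = c *\<^sub>C tens x z"
    and tens_scaleC_right: "tens x (c *\<^sub>C z) = c *\<^sub>C tens x z"
    and tens_mult: "tens x z * tens y w = tens (x * y) (z * w)"
    and tens_star: "(tens x z)\<^sup>\<star> = tens (x\<^sup>\<star>) (z\<^sup>\<star>)"
    and tens_one: "tens 1 1 = 1"
    and tens_dense: "closure (cspan {tens x z | x z. True}) = UNIV"
    and norm_tens: "norm (tens x z) = norm x * norm z"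
    and norm_tens_sum:
      "norm (\<Sum>i<n. tens (X i) (Z i)) = (SUP \<omega>\<in>characters. norm (\<Sum>i<(n::nat). \<omega> (Z i) *\<^sub>C X i))"

definition tensor_hom ::
  "('a::cstar_algebra \<Rightarrow> 'z::{cstar_algebra,comm_ring_1} \<Rightarrow> 't::cstar_algebra) \<Rightarrow>
   ('a \<Rightarrow> 'a) \<Rightarrow> ('z \<Rightarrow> 'z) \<Rightarrow> 't \<Rightarrow> 't" where
  "tensor_hom tens \<rho> \<beta> =
     (THE \<Phi>. unital_star_hom \<Phi> \<and> (\<forall>a z. \<Phi> (tens a z) = tens (\<rho> a) (\<beta> z)))"

section \<open>Categories of endomorphisms\<close>

definition intertwiners :: "('a::cstar_algebra \<Rightarrow> 'a) \<Rightarrow> ('a \<Rightarrow> 'a) \<Rightarrow> 'a set" where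
  "intertwiners \<sigma> \<tau> = {X. \<forall>B. X * \<sigma> B = \<tau> B * X}"

text \<open>
  Tensor C*-categories of unital endomorphisms of a C*-algebra: \<open>arr \<sigma> \<tau>\<close> is the space of arrows
  from \<open>\<sigma>\<close> to \<open>\<tau>\<close>, which need not consist of all intertwiners; the tensor unit is \<open>id\<close>.
\<close>

locale tensor_cstar_category =
  fixes Obj :: "('a::cstar_algebra \<Rightarrow> 'a) set"
    and arr :: "('a \<Rightarrow> 'a) \<Rightarrow> ('a \<Rightarrow> 'a) \<Rightarrow> 'a set"
  assumes obj_hom: "\<sigma> \<in> Obj \<Longrightarrow> unital_star_hom \<sigma>"
    and obj_id: "id \<in> Obj"
    and obj_comp: "\<sigma> \<in> Obj \<Longrightarrow> \<tau> \<in> Obj \<Longrightarrow> \<sigma> \<circ> \<tau> \<in> Obj"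
    and arr_intertwiners: "\<sigma> \<in> Obj \<Longrightarrow> \<tau> \<in> Obj \<Longrightarrow> arr \<sigma> \<tau> \<subseteq> intertwiners \<sigma> \<tau>"
    and arr_subspace: "\<sigma> \<in> Obj \<Longrightarrow> \<tau> \<in> Obj \<Longrightarrow> csubspace (arr \<sigma> \<tau>)"
    and arr_closed: "\<sigma> \<in> Obj \<Longrightarrow> \<tau> \<in> Obj \<Longrightarrow> closed (arr \<sigma> \<tau>)"
    and arr_one: "\<sigma> \<in> Obj \<Longrightarrow> 1 \<in> arr \<sigma> \<sigma>"
    and arr_comp: "\<sigma> \<in> Obj \<Longrightarrow> \<tau> \<in> Obj \<Longrightarrow> \<upsilon> \<in> Obj \<Longrightarrow>
      X \<in> arr \<sigma> \<tau> \<Longrightarrow> Y \<in> arr \<tau> \<upsilon> \<Longrightarrow> Y * X \<in> arr \<sigma> \<upsilon>"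
    and arr_star: "\<sigma> \<in> Obj \<Longrightarrow> \<tau> \<in> Obj \<Longrightarrow> X \<in> arr \<sigma> \<tau> \<Longrightarrow> X\<^sup>\<star> \<in> arr \<tau> \<sigma>"
    and arr_tensor: "\<sigma> \<in> Obj \<Longrightarrow> \<sigma>' \<in> Obj \<Longrightarrow> \<tau> \<in> Obj \<Longrightarrow> \<tau>' \<in> Obj \<Longrightarrow>
      X \<in> arr \<sigma> \<sigma>' \<Longrightarrow> Y \<in> arr \<tau> \<tau>' \<Longrightarrow> X * \<sigma> Y \<in> arr (\<sigma> \<circ> \<tau>) (\<sigma>' \<circ> \<tau>')"

locale dr_category_with = tensor_cstar_category Obj arr
  for Obj :: "('a::cstar_algebra \<Rightarrow> 'a) set"
    and arr :: "('a \<Rightarrow> 'a) \<Rightarrow> ('a \<Rightarrow> 'a) \<Rightarrow> 'a set" +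
  fixes \<epsilon> :: "('a \<Rightarrow> 'a) \<Rightarrow> ('a \<Rightarrow> 'a) \<Rightarrow> 'a"
  assumes unit_irreducible: "arr id id = scalars"
    and direct_sums: "\<sigma> \<in> Obj \<Longrightarrow> \<tau> \<in> Obj \<Longrightarrow>
      \<exists>\<rho>\<in>Obj. \<exists>V\<in>arr \<sigma> \<rho>. \<exists>W\<in>arr \<tau> \<rho>.
        isometry V \<and> isometry W \<and> V * V\<^sup>\<star> + W * W\<^sup>\<star> = 1"
    and subobjects: "\<sigma> \<in> Obj \<Longrightarrow> E \<in> arr \<sigma> \<sigma> \<Longrightarrow> projection E \<Longrightarrow> E \<noteq> 0 \<Longrightarrow>
      \<exists>\<tau>\<in>Obj. \<exists>V\<in>arr \<tau> \<sigma>. isometry V \<and> V * V\<^sup>\<star> = E"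
    and perm_arr: "\<sigma> \<in> Obj \<Longrightarrow> \<tau> \<in> Obj \<Longrightarrow> \<epsilon> \<sigma> \<tau> \<in> arr (\<sigma> \<circ> \<tau>) (\<tau> \<circ> \<sigma>)"
    and perm_unitary: "\<sigma> \<in> Obj \<Longrightarrow> \<tau> \<in> Obj \<Longrightarrow> unitary (\<epsilon> \<sigma> \<tau>)"
    and perm_involutive: "\<sigma> \<in> Obj \<Longrightarrow> \<tau> \<in> Obj \<Longrightarrow> \<epsilon> \<sigma> \<tau> * \<epsilon> \<tau> \<sigma> = 1"
    and perm_unit: "\<sigma> \<in> Obj \<Longrightarrow> \<epsilon> id \<sigma> = 1" "\<sigma> \<in> Obj \<Longrightarrow> \<epsilon> \<sigma> id = 1"
    and perm_comp: "\<sigma>\<^sub>1 \<in> Obj \<Longrightarrow> \<sigma>\<^sub>2 \<in> Obj \<Longrightarrow> \<sigma>\<^sub>3 \<in> Obj \<Longrightarrow>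
      \<epsilon> (\<sigma>\<^sub>1 \<circ> \<sigma>\<^sub>2) \<sigma>\<^sub>3 = \<epsilon> \<sigma>\<^sub>1 \<sigma>\<^sub>3 * \<sigma>\<^sub>1 (\<epsilon> \<sigma>\<^sub>2 \<sigma>\<^sub>3)"
    and perm_natural: "\<sigma> \<in> Obj \<Longrightarrow> \<sigma>' \<in> Obj \<Longrightarrow> \<tau> \<in> Obj \<Longrightarrow> \<tau>' \<in> Obj \<Longrightarrow>
      A \<in> arr \<sigma> \<sigma>' \<Longrightarrow> B \<in> arr \<tau> \<tau>' \<Longrightarrow>
      \<epsilon> \<sigma>' \<tau>' * (A * \<sigma> B) = (B * \<tau> A) * \<epsilon> \<sigma> \<tau>"
    and conjugates: "\<sigma> \<in> Obj \<Longrightarrow>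
      \<exists>\<sigma>c\<in>Obj. \<exists>R\<in>arr id (\<sigma>c \<circ> \<sigma>). let S = \<epsilon> \<sigma>c \<sigma> * R in
        S\<^sup>\<star> * \<sigma> R = 1 \<and> R\<^sup>\<star> * \<sigma>c S = 1"

definition dr_category ::
  "('a::cstar_algebra \<Rightarrow> 'a) set \<Rightarrow> (('a \<Rightarrow> 'a) \<Rightarrow> ('a \<Rightarrow> 'a) \<Rightarrow> 'a set) \<Rightarrow> bool" where
  "dr_category Obj arr \<longleftrightarrow> (\<exists>\<epsilon>. dr_category_with Obj arr \<epsilon>)"

text \<open>\<open>arrC\<close> defines an admissible subcategory (with the same objects) of the category with arrows \<open>arr\<close>.\<close>

definition admissible_subcategory ::
  "('a::cstar_algebra \<Rightarrow> 'a) set \<Rightarrow> (('a \<Rightarrow> 'a) \<Rightarrow> ('a \<Rightarrow> 'a) \<Rightarrow> 'a set) \<Rightarrow>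
   (('a \<Rightarrow> 'a) \<Rightarrow> ('a \<Rightarrow> 'a) \<Rightarrow> 'a set) \<Rightarrow> bool" where
  "admissible_subcategory Obj arr arrC \<longleftrightarrow>
     tensor_cstar_category Obj arr \<and> dr_category Obj arrC \<and>
     (\<forall>\<sigma>\<in>Obj. \<forall>\<tau>\<in>Obj. arrC \<sigma> \<tau> \<subseteq> arr \<sigma> \<tau> \<and>
        arr \<sigma> \<tau> = cspan {X * \<sigma> Z | X Z. X \<in> arrC \<sigma> \<tau> \<and> Z \<in> center})"

definition irreducible_endo :: "('a::cstar_algebra \<Rightarrow> 'a) \<Rightarrow> bool" where
  "irreducible_endo \<rho> \<longleftrightarrow> intertwiners \<rho> \<rho> = scalars"

definition equivalent_endo :: "('a::cstar_algebra \<Rightarrow> 'a) \<Rightarrow> ('a \<Rightarrow> 'a) \<Rightarrow> bool" where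
  "equivalent_endo \<sigma> \<tau> \<longleftrightarrow> (\<exists>U\<in>intertwiners \<sigma> \<tau>. unitary U)"

text \<open>Orthonormal bases of \<open>(\<rho>, \<tau>)\<close>, \<open>\<rho>\<close> irreducible, for the scalar product \<open>\<langle>A, B\<rangle>1 = A\<^sup>\<star>B\<close>.\<close>

definition orthonormal_basis ::
  "('a::cstar_algebra \<Rightarrow> 'a) \<Rightarrow> ('a \<Rightarrow> 'a) \<Rightarrow> 'a set \<Rightarrow> bool" where
  "orthonormal_basis \<rho> \<tau> B \<longleftrightarrow> finite B \<and> cspan B = intertwiners \<rho> \<tau> \<and>
     (\<forall>V\<in>B. \<forall>W\<in>B. V\<^sup>\<star> * W = (if V = W then 1 else 0))"

definition irreducible_decomposition ::
  "('a::cstar_algebra \<Rightarrow> 'a) set \<Rightarrow> ('a \<Rightarrow> 'a) \<Rightarrow> ('a \<Rightarrow> 'a) set \<Rightarrow> (('a \<Rightarrow> 'a) \<Rightarrow> 'a set) \<Rightarrow> bool" where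
  "irreducible_decomposition Obj \<tau> S B \<longleftrightarrow>
     finite S \<and> S \<subseteq> Obj \<and> (\<forall>\<rho>\<in>S. irreducible_endo \<rho>) \<and>
     (\<forall>\<rho>\<in>S. \<forall>\<rho>'\<in>S. equivalent_endo \<rho> \<rho>' \<longrightarrow> \<rho> = \<rho>') \<and>
     (\<forall>\<rho>\<in>S. orthonormal_basis \<rho> \<tau> (B \<rho>)) \<and>
     (\<forall>x. \<tau> x = (\<Sum>\<rho>\<in>S. \<Sum>W\<in>B \<rho>. W * \<rho> x * W\<^sup>\<star>))"

section \<open>Compact groups and their finite-dimensional unitary representations\<close>

locale compact_group = group G for G :: "('g, 'm) monoid_scheme" (structure) +
  fixes T :: "'g topology"
  assumes topspace_eq: "topspace T = carrier G"
    and compact: "compact_space T"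
    and hausdorff: "Hausdorff_space T"
    and continuous_mult: "continuous_map (prod_topology T T) T (\<lambda>(x, y). x \<otimes> y)"
    and continuous_inv: "continuous_map T T (\<lambda>x. inv x)"

definition unitary_mat :: "complex mat \<Rightarrow> bool" where
  "unitary_mat M \<longleftrightarrow> square_mat M \<and>
     mat_adjoint M * M = 1\<^sub>m (dim_row M) \<and> M * mat_adjoint M = 1\<^sub>m (dim_row M)"

definition kronecker :: "complex mat \<Rightarrow> complex mat \<Rightarrow> complex mat" where
  "kronecker A B = mat (dim_row A * dim_row B) (dim_col A * dim_col B)
     (\<lambda>(i, j). A $$ (i div dim_row B, j div dim_col B) * B $$ (i mod dim_row B, j mod dim_col B))"

text \<open>
  The flip from \<open>\<complex>\<^sup>m \<otimes> \<complex>\<^sup>n\<close> to \<open>\<complex>\<^sup>n \<otimes> \<complex>\<^sup>m\<close>; the basis vector \<open>e\<^sub>i \<otimes> e\<^sub>j\<close> has index \<open>i * n + j\<close> in the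
  former space and \<open>e\<^sub>j \<otimes> e\<^sub>i\<close> has index \<open>j * m + i\<close> in the latter.
\<close>

definition flip_mat :: "nat \<Rightarrow> nat \<Rightarrow> complex mat" where
  "flip_mat m n = mat (n * m) (m * n)
     (\<lambda>(k, l). if k div m = l mod n \<and> k mod m = l div n then 1 else 0)"

text \<open>
  A unitary representation on \<open>\<complex>\<^sup>n\<close> is a function from the group to matrices, whose dimension can
  be read off at the unit. The zero representation is excluded: endomorphisms of an algebra with
  \<open>1 \<noteq> 0\<close> are nonzero objects.
\<close>

type_synonym 'g rep = "'g \<Rightarrow> complex mat"

definition rep_dim :: "('g, 'm) monoid_scheme \<Rightarrow> 'g rep \<Rightarrow> nat" where
  "rep_dim G U = dim_row (U \<one>\<^bsub>G\<^esub>)"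

definition unitary_rep :: "('g, 'm) monoid_scheme \<Rightarrow> 'g topology \<Rightarrow> 'g rep \<Rightarrow> bool" where
  "unitary_rep G T U \<longleftrightarrow> rep_dim G U > 0 \<and>
     (\<forall>g\<in>carrier G. U g \<in> carrier_mat (rep_dim G U) (rep_dim G U) \<and> unitary_mat (U g)) \<and>
     (\<forall>g\<in>carrier G. \<forall>h\<in>carrier G. U (g \<otimes>\<^bsub>G\<^esub> h) = U g * U h) \<and>
     (\<forall>i<rep_dim G U. \<forall>j<rep_dim G U. continuous_map T euclidean (\<lambda>g. U g $$ (i, j)))"

definition rep_intertwiners ::
  "('g, 'm) monoid_scheme \<Rightarrow> 'g rep \<Rightarrow> 'g rep \<Rightarrow> complex mat set" where
  "rep_intertwiners G U V =
     {M \<in> carrier_mat (rep_dim G V) (rep_dim G U). \<forall>g\<in>carrier G. M * U g = V g * M}"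

definition trivial_rep :: "'g rep" where
  "trivial_rep = (\<lambda>g. 1\<^sub>m 1)"

definition tensor_rep :: "'g rep \<Rightarrow> 'g rep \<Rightarrow> 'g rep" where
  "tensor_rep U V = (\<lambda>g. kronecker (U g) (V g))"

definition equivalent_rep :: "('g, 'm) monoid_scheme \<Rightarrow> 'g rep \<Rightarrow> 'g rep \<Rightarrow> bool" where
  "equivalent_rep G U V \<longleftrightarrow> (\<exists>M\<in>rep_intertwiners G U V. unitary_mat M)"

definition invariant_subspace ::
  "('g, 'm) monoid_scheme \<Rightarrow> 'g rep \<Rightarrow> complex vec set \<Rightarrow> bool" where
  "invariant_subspace G U W \<longleftrightarrow>
     W \<subseteq> carrier_vec (rep_dim G U) \<and> 0\<^sub>v (rep_dim G U) \<in> W \<and>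
     (\<forall>v\<in>W. \<forall>w\<in>W. v + w \<in> W) \<and> (\<forall>c. \<forall>v\<in>W. c \<cdot>\<^sub>v v \<in> W) \<and>
     (\<forall>g\<in>carrier G. \<forall>v\<in>W. U g *\<^sub>v v \<in> W)"

definition irreducible_rep :: "('g, 'm) monoid_scheme \<Rightarrow> 'g topology \<Rightarrow> 'g rep \<Rightarrow> bool" where
  "irreducible_rep G T U \<longleftrightarrow> unitary_rep G T U \<and>
     (\<forall>W. invariant_subspace G U W \<longrightarrow>
        W = {0\<^sub>v (rep_dim G U)} \<or> W = carrier_vec (rep_dim G U))"

text \<open>The equivalence class, among irreducible representations, of an irreducible representation.\<close>

definition rep_class :: "('g, 'm) monoid_scheme \<Rightarrow> 'g topology \<Rightarrow> 'g rep \<Rightarrow> 'g rep set" where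
  "rep_class G T U = {V. irreducible_rep G T V \<and> equivalent_rep G U V}"

definition dual :: "('g, 'm) monoid_scheme \<Rightarrow> 'g topology \<Rightarrow> 'g rep set set" where
  "dual G T = {rep_class G T U | U. irreducible_rep G T U}"

section \<open>The chain group\<close>

text \<open>
  \<open>D\<^sub>1 \<times> D\<^sub>2\<close>: the classes in the decomposition of the tensor product, i.e. those that embed
  isometrically into it.
\<close>

definition class_times ::
  "('g, 'm) monoid_scheme \<Rightarrow> 'g topology \<Rightarrow> 'g rep set \<Rightarrow> 'g rep set \<Rightarrow> 'g rep set set" where
  "class_times G T D\<^sub>1 D\<^sub>2 = {D \<in> dual G T. \<exists>U\<in>D. \<exists>U\<^sub>1\<in>D\<^sub>1. \<exists>U\<^sub>2\<in>D\<^sub>2.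
     \<exists>M\<in>rep_intertwiners G U (tensor_rep U\<^sub>1 U\<^sub>2). mat_adjoint M * M = 1\<^sub>m (rep_dim G U)}"

text \<open>\<open>D\<^sub>1 \<times> \<dots> \<times> D\<^sub>n\<close> for \<open>n \<ge> 1\<close>, bracketed to the right; the empty list is a dummy case.\<close>

fun class_times_list ::
  "('g, 'm) monoid_scheme \<Rightarrow> 'g topology \<Rightarrow> 'g rep set list \<Rightarrow> 'g rep set set" where
  "class_times_list G T [] = {}"
| "class_times_list G T [D] = {D}"
| "class_times_list G T (D # D' # Ds) = (\<Union>E\<in>class_times_list G T (D' # Ds). class_times G T D E)"

definition chain_equiv ::
  "('g, 'm) monoid_scheme \<Rightarrow> 'g topology \<Rightarrow> 'g rep set \<Rightarrow> 'g rep set \<Rightarrow> bool" where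
  "chain_equiv G T D D' \<longleftrightarrow> (\<exists>Ds. set Ds \<subseteq> dual G T \<and>
     D \<in> class_times_list G T Ds \<and> D' \<in> class_times_list G T Ds)"

definition chain_class ::
  "('g, 'm) monoid_scheme \<Rightarrow> 'g topology \<Rightarrow> 'g rep set \<Rightarrow> 'g rep set set" where
  "chain_class G T D = {D' \<in> dual G T. chain_equiv G T D D'}"

definition chain_group ::
  "('g, 'm) monoid_scheme \<Rightarrow> 'g topology \<Rightarrow> 'g rep set set monoid" where
  "chain_group G T =
     \<lparr>carrier = chain_class G T ` dual G T,
      mult = (\<lambda>c\<^sub>0 c\<^sub>1. THE c. \<exists>D\<^sub>0\<in>c\<^sub>0. \<exists>D\<^sub>1\<in>c\<^sub>1. \<exists>D\<in>class_times G T D\<^sub>0 D\<^sub>1. c = chain_class G T D),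
      one = chain_class G T (rep_class G T trivial_rep)\<rparr>"

section \<open>Doplicher-Roberts duality\<close>

text \<open>
  The category with objects \<open>Obj\<close>, full intertwiner spaces and permutation structure \<open>\<epsilon>\<close> is
  equivalent, as a symmetric tensor C*-category, to the nonzero finite-dimensional unitary
  representations of the compact group \<open>G\<close>: \<open>Fo\<close>, \<open>Fm\<close> are the object and arrow maps of the
  equivalence, and the unitaries \<open>J \<sigma> \<tau>\<close> from \<open>Fo \<sigma> \<otimes> Fo \<tau>\<close> to \<open>Fo (\<sigma> \<circ> \<tau>)\<close> and \<open>J\<^sub>0\<close> from \<open>\<complex>\<close>
  to \<open>Fo id\<close> are its tensor structure; both tensor products are strictly associative. Conjugates
  are preserved automatically, as they are determined by equations between arrows.
\<close>

locale dr_duality = compact_group G T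
  for G :: "('g, 'm) monoid_scheme" and T :: "'g topology" +
  fixes Obj :: "('a::cstar_algebra \<Rightarrow> 'a) set"
    and \<epsilon> :: "('a \<Rightarrow> 'a) \<Rightarrow> ('a \<Rightarrow> 'a) \<Rightarrow> 'a"
    and Fo :: "('a \<Rightarrow> 'a) \<Rightarrow> 'g rep"
    and Fm :: "('a \<Rightarrow> 'a) \<Rightarrow> ('a \<Rightarrow> 'a) \<Rightarrow> 'a \<Rightarrow> complex mat"
    and J :: "('a \<Rightarrow> 'a) \<Rightarrow> ('a \<Rightarrow> 'a) \<Rightarrow> complex mat"
    and J\<^sub>0 :: "complex mat"
  assumes Fo_rep: "\<sigma> \<in> Obj \<Longrightarrow> unitary_rep G T (Fo \<sigma>)"
    and Fm_bij: "\<sigma> \<in> Obj \<Longrightarrow> \<tau> \<in> Obj \<Longrightarrow>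
      bij_betw (Fm \<sigma> \<tau>) (intertwiners \<sigma> \<tau>) (rep_intertwiners G (Fo \<sigma>) (Fo \<tau>))"
    and Fm_add: "\<sigma> \<in> Obj \<Longrightarrow> \<tau> \<in> Obj \<Longrightarrow> X \<in> intertwiners \<sigma> \<tau> \<Longrightarrow> Y \<in> intertwiners \<sigma> \<tau> \<Longrightarrow>
      Fm \<sigma> \<tau> (X + Y) = Fm \<sigma> \<tau> X + Fm \<sigma> \<tau> Y"
    and Fm_scaleC: "\<sigma> \<in> Obj \<Longrightarrow> \<tau> \<in> Obj \<Longrightarrow> X \<in> intertwiners \<sigma> \<tau> \<Longrightarrow>
      Fm \<sigma> \<tau> (c *\<^sub>C X) = c \<cdot>\<^sub>m Fm \<sigma> \<tau> X"
    and Fm_one: "\<sigma> \<in> Obj \<Longrightarrow> Fm \<sigma> \<sigma> 1 = 1\<^sub>m (rep_dim G (Fo \<sigma>))"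
    and Fm_comp: "\<sigma> \<in> Obj \<Longrightarrow> \<tau> \<in> Obj \<Longrightarrow> \<upsilon> \<in> Obj \<Longrightarrow>
      X \<in> intertwiners \<sigma> \<tau> \<Longrightarrow> Y \<in> intertwiners \<tau> \<upsilon> \<Longrightarrow>
      Fm \<sigma> \<upsilon> (Y * X) = Fm \<tau> \<upsilon> Y * Fm \<sigma> \<tau> X"
    and Fm_star: "\<sigma> \<in> Obj \<Longrightarrow> \<tau> \<in> Obj \<Longrightarrow> X \<in> intertwiners \<sigma> \<tau> \<Longrightarrow>
      Fm \<tau> \<sigma> (X\<^sup>\<star>) = mat_adjoint (Fm \<sigma> \<tau> X)"
    and Fo_ess_surj: "unitary_rep G T U \<Longrightarrow> \<exists>\<sigma>\<in>Obj. equivalent_rep G (Fo \<sigma>) U"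
    and J_arr: "\<sigma> \<in> Obj \<Longrightarrow> \<tau> \<in> Obj \<Longrightarrow>
      J \<sigma> \<tau> \<in> rep_intertwiners G (tensor_rep (Fo \<sigma>) (Fo \<tau>)) (Fo (\<sigma> \<circ> \<tau>))"
    and J_unitary: "\<sigma> \<in> Obj \<Longrightarrow> \<tau> \<in> Obj \<Longrightarrow> unitary_mat (J \<sigma> \<tau>)"
    and J_natural: "\<sigma> \<in> Obj \<Longrightarrow> \<sigma>' \<in> Obj \<Longrightarrow> \<tau> \<in> Obj \<Longrightarrow> \<tau>' \<in> Obj \<Longrightarrow>
      X \<in> intertwiners \<sigma> \<sigma>' \<Longrightarrow> Y \<in> intertwiners \<tau> \<tau>' \<Longrightarrow>
      Fm (\<sigma> \<circ> \<tau>) (\<sigma>' \<circ> \<tau>') (X * \<sigma> Y) * J \<sigma> \<tau> = J \<sigma>' \<tau>' * kronecker (Fm \<sigma> \<sigma>' X) (Fm \<tau> \<tau>' Y)"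
    and J_assoc: "\<sigma> \<in> Obj \<Longrightarrow> \<tau> \<in> Obj \<Longrightarrow> \<upsilon> \<in> Obj \<Longrightarrow>
      J (\<sigma> \<circ> \<tau>) \<upsilon> * kronecker (J \<sigma> \<tau>) (1\<^sub>m (rep_dim G (Fo \<upsilon>))) =
      J \<sigma> (\<tau> \<circ> \<upsilon>) * kronecker (1\<^sub>m (rep_dim G (Fo \<sigma>))) (J \<tau> \<upsilon>)"
    and J0_arr: "J\<^sub>0 \<in> rep_intertwiners G trivial_rep (Fo id)"
    and J0_unitary: "unitary_mat J\<^sub>0"
    and J_unit_right: "\<sigma> \<in> Obj \<Longrightarrow>
      J \<sigma> id * kronecker (1\<^sub>m (rep_dim G (Fo \<sigma>))) J\<^sub>0 = 1\<^sub>m (rep_dim G (Fo \<sigma>))"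
    and J_unit_left: "\<sigma> \<in> Obj \<Longrightarrow>
      J id \<sigma> * kronecker J\<^sub>0 (1\<^sub>m (rep_dim G (Fo \<sigma>))) = 1\<^sub>m (rep_dim G (Fo \<sigma>))"
    and J_symmetric: "\<sigma> \<in> Obj \<Longrightarrow> \<tau> \<in> Obj \<Longrightarrow>
      Fm (\<sigma> \<circ> \<tau>) (\<tau> \<circ> \<sigma>) (\<epsilon> \<sigma> \<tau>) * J \<sigma> \<tau> =
      J \<tau> \<sigma> * flip_mat (rep_dim G (Fo \<sigma>)) (rep_dim G (Fo \<tau>))"

text \<open>
  The automorphism attached to an irreducible object \<open>\<rho>\<close>: the value of \<open>\<alpha>\<close> at the chain class of
  the class of representations associated with \<open>\<rho>\<close>.
\<close>

definition chain_aut ::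
  "('g, 'm) monoid_scheme \<Rightarrow> 'g topology \<Rightarrow> (('a \<Rightarrow> 'a) \<Rightarrow> 'g rep) \<Rightarrow>
   ('g rep set set \<Rightarrow> 'z \<Rightarrow> 'z) \<Rightarrow> ('a \<Rightarrow> 'a) \<Rightarrow> 'z \<Rightarrow> 'z" where
  "chain_aut G T Fo \<alpha> \<rho> = \<alpha> (chain_class G T (rep_class G T (Fo \<rho>)))"

section \<open>The categories constructed from the duality data\<close>

text \<open>
  In the next definitions \<open>\<beta>\<close> is to be instantiated with \<open>chain_aut G T Fo \<alpha>\<close>. The endomorphism \<open>tilde tens Obj \<beta> \<tau>\<close> does not
  depend on the decomposition of \<open>\<tau>\<close> that is chosen.
\<close>

definition tilde ::
  "('a::cstar_algebra \<Rightarrow> 'z::{cstar_algebra,comm_ring_1} \<Rightarrow> 't::cstar_algebra) \<Rightarrow>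
   ('a \<Rightarrow> 'a) set \<Rightarrow> (('a \<Rightarrow> 'a) \<Rightarrow> 'z \<Rightarrow> 'z) \<Rightarrow> ('a \<Rightarrow> 'a) \<Rightarrow> 't \<Rightarrow> 't" where
  "tilde tens Obj \<beta> \<tau> =
     (if irreducible_endo \<tau> then tensor_hom tens \<tau> (\<beta> \<tau>)
      else SOME \<Phi>. \<exists>S B. irreducible_decomposition Obj \<tau> S B \<and>
        \<Phi> = (\<lambda>x. \<Sum>\<rho>\<in>S. \<Sum>W\<in>B \<rho>. tens W 1 * tensor_hom tens \<rho> (\<beta> \<rho>) x * (tens W 1)\<^sup>\<star>))"

definition T_obj ::
  "('a::cstar_algebra \<Rightarrow> 'z::{cstar_algebra,comm_ring_1} \<Rightarrow> 't::cstar_algebra) \<Rightarrow>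
   ('a \<Rightarrow> 'a) set \<Rightarrow> (('a \<Rightarrow> 'a) \<Rightarrow> 'z \<Rightarrow> 'z) \<Rightarrow> ('t \<Rightarrow> 't) set" where
  "T_obj tens Obj \<beta> = tilde tens Obj \<beta> ` Obj"

text \<open>The arrows of the big category are all \<open>intertwiners\<close>, those of the subcategory are \<open>(\<sigma>, \<tau>) \<otimes> 1\<close>.\<close>

definition TC_arr ::
  "('a::cstar_algebra \<Rightarrow> 'z::{cstar_algebra,comm_ring_1} \<Rightarrow> 't::cstar_algebra) \<Rightarrow>
   ('a \<Rightarrow> 'a) set \<Rightarrow> (('a \<Rightarrow> 'a) \<Rightarrow> 'z \<Rightarrow> 'z) \<Rightarrow> ('t \<Rightarrow> 't) \<Rightarrow> ('t \<Rightarrow> 't) \<Rightarrow> 't set" where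
  "TC_arr tens Obj \<beta> \<phi> \<psi> =
     (let \<sigma> = the_inv_into Obj (tilde tens Obj \<beta>) \<phi>;
          \<tau> = the_inv_into Obj (tilde tens Obj \<beta>) \<psi>
      in (\<lambda>x. tens x 1) ` intertwiners \<sigma> \<tau>)"

end

theory Submission
  imports Defs "Jordan_Normal_Form.Spectral_Radius"
begin

text \<open>
  Every \<open>\<sigma>\<close> is a finite direct sum of irreducibles \<open>\<rho>\<^sub>V = V\<^sup>\<star> \<sigma>(\<cdot>) V\<close>, and its extension acts by
  \<open>a \<otimes> z \<mapsto> \<Sum>\<^sub>V \<sigma>(a) V V\<^sup>\<star> \<otimes> \<alpha>\<^bsub>[\<rho>\<^sub>V]\<^esub>(z)\<close>. Since \<open>\<alpha>\<close> is multiplicative along \<open>\<rho> \<le> \<rho>\<^sub>1 \<rho>\<^sub>2\<close>, comparing such sums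
  term by term (a term \<open>W\<^sup>\<star> X V\<close> with inequivalent components vanishes by Schur's lemma) shows that
  extension respects composition and that \<open>X \<otimes> 1\<close> intertwines the extensions if \<open>X\<close> intertwines the
  given endomorphisms. Conversely, let \<open>t\<close> intertwine the extensions of \<open>\<sigma>\<close> and \<open>\<tau>\<close>. A character
  \<open>\<omega>\<close> of the abelian factor gives a slice map \<open>a \<otimes> z \<mapsto> \<omega>(z) a\<close> that takes \<open>t\<close> into \<open>(\<sigma>, \<tau>)\<close>; cut down
  to components, all slices are multiples of a single unitary \<open>U\<close>, so the corner of \<open>t\<close> is \<open>U \<otimes> z\<close>,
  because elements with scalar slices lie in \<open>1 \<otimes> \<Z>\<close>. As \<open>\<alpha>\<close> acts by automorphisms, \<open>z\<close> can be pulled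
  through the extension of \<open>\<sigma>\<close>.

  The multiplicativity of \<open>\<alpha>\<close> needs that the product of the chain group is well defined. Under the
  duality, \<open>D \<in> D\<^sub>1 \<times> D\<^sub>2\<close> becomes an isometry in \<open>(\<rho>, \<rho>\<^sub>1 \<rho>\<^sub>2)\<close>, and conjugates make the chain relation
  transitive.
\<close>

section \<open>C*-algebras and their homomorphisms\<close>

text \<open>Schur's lemma is where the C*-norm matters. For an intertwiner \<open>X\<close> out of
  an irreducible, \<open>X\<^sup>\<star> * X\<close> is a scalar, but a nonzero \<open>X\<close> can
  be rescaled to an isometry only once that scalar is known to be positive. This sign and the
  contractivity of unital star homomorphisms both come from one device: a self-adjoint element of
  small norm is the real part of a unitary, because a square root of \<open>1 - h * h\<close> is
  available as a fixed point. Finite decompositions exist because the duality supplies a dimension.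
  A non-scalar element of (\<sigma>, \<sigma>) becomes a matrix with a proper eigenspace, the
  projection onto it comes back as a projection of the category, and splitting along it lowers the
  dimension. That scalar slices are the values of all characters at a single \<open>z\<close> is an
  approximation argument: one functional, chosen independently of the character, turns an
  approximation of the element into an approximation by some \<open>tens 1 z\<close>.\<close>

lemma scaleC_one [simp]: "1 *\<^sub>C (x :: 'a::cstar_algebra) = x"
  using scaleC_of_real[of 1 x] by simp

lemma scaleC_zero_left [simp]: "0 *\<^sub>C (x :: 'a::cstar_algebra) = 0"
  using scaleC_of_real[of 0 x] by simp

lemma scaleC_minus_one: "(- 1) *\<^sub>C (x :: 'a::cstar_algebra) = - x"
  using scaleC_of_real[of "-1" x] by simp

lemma scaleC_zero_right [simp]: "c *\<^sub>C (0 :: 'a::cstar_algebra) = 0"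
  using scaleC_add_right[of c 0 "0::'a"] by simp

lemma scaleC_minus_left: "(- c) *\<^sub>C (x :: 'a::cstar_algebra) = - (c *\<^sub>C x)"
  using scaleC_add_left[of c "- c" x] by (simp add: eq_neg_iff_add_eq_0 add.commute)

lemma scaleC_diff_left: "(c - d) *\<^sub>C (x :: 'a::cstar_algebra) = c *\<^sub>C x - d *\<^sub>C x"
  using scaleC_add_left[of c "- d" x] by (simp add: scaleC_minus_left)

lemma scaleC_minus_right: "c *\<^sub>C (- x :: 'a::cstar_algebra) = - (c *\<^sub>C x)"
  using scaleC_add_right[of c x "- x"] by (simp add: eq_neg_iff_add_eq_0 add.commute)

lemma scaleC_diff_right: "c *\<^sub>C (x - y :: 'a::cstar_algebra) = c *\<^sub>C x - c *\<^sub>C y"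
  using scaleC_add_right[of c x "- y"] by (simp add: scaleC_minus_right)

lemma scaleC_sum_right: "c *\<^sub>C (\<Sum>i\<in>I. f i) = (\<Sum>i\<in>I. c *\<^sub>C (f i :: 'a::cstar_algebra))"
  by (induction I rule: infinite_finite_induct) (simp_all add: scaleC_add_right)

lemma scaleC_one_mult: "(c *\<^sub>C 1) * (x :: 'a::cstar_algebra) = c *\<^sub>C x"
  "x * (c *\<^sub>C 1) = c *\<^sub>C x"
  by (simp_all add: mult_scaleC_left mult_scaleC_right)

lemma scaleC_eq_0_iff: "c *\<^sub>C (x :: 'a::cstar_algebra) = 0 \<longleftrightarrow> c = 0 \<or> x = 0"
  using norm_scaleC[of c x] by (metis mult_eq_0_iff norm_eq_zero)

lemma star_zero [simp]: "(0 :: 'a::cstar_algebra)\<^sup>\<star> = 0"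
  using star_add[of 0 "0::'a"] by simp

lemma star_one [simp]: "(1 :: 'a::cstar_algebra)\<^sup>\<star> = 1"
  using star_mult[of 1 "1\<^sup>\<star> :: 'a"] by (simp add: star_star)

lemma star_minus: "(- x :: 'a::cstar_algebra)\<^sup>\<star> = - x\<^sup>\<star>"
  using star_add[of x "- x"] by (simp add: eq_neg_iff_add_eq_0 add.commute)

lemma star_diff: "(x - y :: 'a::cstar_algebra)\<^sup>\<star> = x\<^sup>\<star> - y\<^sup>\<star>"
  using star_add[of x "- y"] by (simp add: star_minus)

lemma star_scaleR: "(r *\<^sub>R x :: 'a::cstar_algebra)\<^sup>\<star> = r *\<^sub>R x\<^sup>\<star>"
  using star_scaleC[of "complex_of_real r" x] by (simp add: scaleC_of_real)

lemma star_sum: "(\<Sum>i\<in>I. f i)\<^sup>\<star> = (\<Sum>i\<in>I. (f i :: 'a::cstar_algebra)\<^sup>\<star>)"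
  by (induction I rule: infinite_finite_induct) (simp_all add: star_add)

section \<open>Analytic consequences of the C*-identity\<close>

lemma norm_star [simp]: "norm (x\<^sup>\<star>) = norm (x :: 'a::cstar_algebra)"
proof -
  have *: "norm y \<le> norm (y\<^sup>\<star>)" for y :: 'a
  proof (cases "y = 0")
    case False
    have "norm y * norm y \<le> norm (y\<^sup>\<star>) * norm y"
      using cstar_identity[of y] norm_mult_ineq[of "y\<^sup>\<star>" y] by (simp add: power2_eq_square)
    with False show ?thesis by simp
  qed simp
  show ?thesis using *[of x] *[of "x\<^sup>\<star>"] by (simp add: star_star)
qed

lemma bounded_linear_star: "bounded_linear (star :: 'a::cstar_algebra \<Rightarrow> 'a)"
  by (rule bounded_linear_intro[where K = 1]) (simp_all add: star_add star_scaleR)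

lemma continuous_on_star [continuous_intros]:
  "continuous_on S f \<Longrightarrow> continuous_on S (\<lambda>x. (f x :: 'a::cstar_algebra)\<^sup>\<star>)"
  by (rule bounded_linear.continuous_on[OF bounded_linear_star])

lemma continuous_on_scaleC [continuous_intros]:
  "continuous_on S f \<Longrightarrow> continuous_on S (\<lambda>x. c *\<^sub>C (f x :: 'a::cstar_algebra))"
  using continuous_on_mult_left[of S f "c *\<^sub>C 1"] by (simp add: scaleC_one_mult)

lemma norm_unitary: "unitary u \<Longrightarrow> norm u = 1"
  using cstar_identity[of u] norm_ge_zero[of u] by (auto simp: unitary_def power2_eq_1_iff)

lemma unital_star_homD:
  assumes "unital_star_hom f"
  shows "f (x + y) = f x + f y" "f (c *\<^sub>C x) = c *\<^sub>C f x" "f (x * y) = f x * f y" "f 1 = 1"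
    "f (x\<^sup>\<star>) = (f x)\<^sup>\<star>"
  using assms unfolding unital_star_hom_def by blast+

lemma unital_star_hom_linear:
  assumes "unital_star_hom f"
  shows "linear f"
  by (rule linearI) (simp_all add: unital_star_homD[OF assms] flip: scaleC_of_real)

lemma unital_star_hom_zero: "unital_star_hom f \<Longrightarrow> f 0 = 0"
  using linear_0 unital_star_hom_linear by blast

lemma unital_star_hom_diff: "unital_star_hom f \<Longrightarrow> f (x - y) = f x - f y"
  using linear_diff unital_star_hom_linear by blast

lemma unital_star_hom_sum: "unital_star_hom f \<Longrightarrow> f (\<Sum>i\<in>I. g i) = (\<Sum>i\<in>I. f (g i))"
  using linear_sum unital_star_hom_linear by blast

lemma unital_star_hom_comp: "unital_star_hom f \<Longrightarrow> unital_star_hom g \<Longrightarrow> unital_star_hom (f \<circ> g)"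
  unfolding unital_star_hom_def by simp

lemma unital_star_hom_id: "unital_star_hom id"
  unfolding unital_star_hom_def by simp

text \<open>The square root \<open>1 - y\<close> of \<open>1 - x\<close> is found as the fixed point of \<open>y \<mapsto> (x + y\<^sup>2) / 2\<close>.\<close>

lemma sqrt_one_minus_exists:
  fixes x :: "'a::cstar_algebra"
  assumes sa: "x\<^sup>\<star> = x" and nx: "norm x < 1"
  obtains k where "k\<^sup>\<star> = k" "k * k = 1 - x" "\<And>w. w * x = x * w \<Longrightarrow> k * w = w * k"
proof -
  \<comment> \<open>The commutation property is built into the domain of the iteration, so the fixed
    point inherits it. The radius \<open>norm x\<close> of the ball is also the contraction constant
    of \<open>g\<close>.\<close>
  define S where "S = {y. norm y \<le> norm x \<and> y\<^sup>\<star> = y \<and> (\<forall>w. w * x = x * w \<longrightarrow> y * w = w * y)}"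
  define g where "g y = (1/2) *\<^sub>R (x + y * y)" for y
  have "S = cball 0 (norm x) \<inter> {y. y\<^sup>\<star> = y} \<inter> (\<Inter>w\<in>{w. w * x = x * w}. {y. y * w = w * y})"
    unfolding S_def by auto
  moreover have "closed {y :: 'a. y\<^sup>\<star> = y}"
    by (intro closed_Collect_eq continuous_intros)
  moreover have "closed {y :: 'a. y * w = w * y}" for w
    by (intro closed_Collect_eq continuous_intros)
  ultimately have "closed S"
    by (auto intro!: closed_Int closed_INT)
  then have compl: "complete S"
    by (simp add: complete_eq_closed)
  have "0 \<in> S" unfolding S_def by simp
  then have ne: "S \<noteq> {}" by blast
  have img: "g ` S \<subseteq> S"
  proof (rule image_subsetI)
    fix y assume y: "y \<in> S"
    have ny: "norm y \<le> norm x" "y\<^sup>\<star> = y" and c: "\<And>w. w * x = x * w \<Longrightarrow> y * w = w * y"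
      using y unfolding S_def by auto
    have "norm (y * y) \<le> norm x * 1"
      using nx by (intro order_trans[OF norm_mult_ineq] mult_mono) (use ny in auto)
    then have "norm (g y) \<le> norm x"
      unfolding g_def using norm_triangle_ineq[of x "y * y"] by simp
    moreover have "(g y)\<^sup>\<star> = g y"
      unfolding g_def by (simp add: star_scaleR star_add star_mult ny sa)
    moreover have "g y * w = w * g y" if "w * x = x * w" for w
    proof -
      have "y * y * w = w * (y * y)"
        using c[OF that] by (metis mult.assoc)
      then show ?thesis
        unfolding g_def using that by (simp add: distrib_left distrib_right)
    qed
    ultimately show "g y \<in> S" unfolding S_def by blast
  qed
  have lip: "\<forall>y\<in>S. \<forall>w\<in>S. dist (g y) (g w) \<le> norm x * dist y w"
  proof (intro ballI)
    fix y w assume "y \<in> S" "w \<in> S"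
    then have n: "norm y \<le> norm x" "norm w \<le> norm x" unfolding S_def by auto
    have "g y - g w = (1/2) *\<^sub>R (y * (y - w) + (y - w) * w)"
      unfolding g_def by (simp add: algebra_simps)
    then have "norm (g y - g w) = (1/2) * norm (y * (y - w) + (y - w) * w)"
      by simp
    also have "\<dots> \<le> (1/2) * (norm y * norm (y - w) + norm (y - w) * norm w)"
      using norm_triangle_ineq[of "y * (y - w)" "(y - w) * w"] norm_mult_ineq[of y "y - w"]
        norm_mult_ineq[of "y - w" w] by simp
    also have "\<dots> \<le> (1/2) * (norm x * norm (y - w) + norm (y - w) * norm x)"
      using n by (intro mult_left_mono add_mono mult_right_mono) auto
    finally show "dist (g y) (g w) \<le> norm x * dist y w"
      by (simp add: dist_norm)
  qed
  from Banach_fix[OF compl ne norm_ge_zero nx img] lip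
  obtain y where y: "y \<in> S" "g y = y" by blast
  show thesis
  proof
    show "(1 - y)\<^sup>\<star> = 1 - y" using y by (simp add: star_diff S_def)
    have "2 *\<^sub>R g y = x + y * y" unfolding g_def by simp
    then have "y + y = x + y * y" using y by (simp add: scaleR_2)
    then show "(1 - y) * (1 - y) = 1 - x"
      by (simp add: algebra_simps)
    show "(1 - y) * w = w * (1 - y)" if "w * x = x * w" for w
      using y that unfolding S_def by (simp add: algebra_simps)
  qed
qed

text \<open>The square root \<open>k\<close> of \<open>1 - h * h\<close> commutes with everything
  that commutes with \<open>h * h\<close>, in particular with \<open>h\<close>. Hence the product of
  \<open>h + \<i> *\<^sub>C k\<close> and its adjoint, in either order, is
  \<open>h * h + k * k = 1\<close>.\<close>

lemma unitary_with_real_part: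
  fixes h :: "'a::cstar_algebra"
  assumes h: "h\<^sup>\<star> = h" "norm (h * h) < 1"
  obtains k where "k * k = 1 - h * h" "unitary (h + \<i> *\<^sub>C k)" "(h + \<i> *\<^sub>C k)\<^sup>\<star> = h - \<i> *\<^sub>C k"
proof -
  have "(h * h)\<^sup>\<star> = h * h" by (simp add: star_mult h)
  then obtain k where k: "k\<^sup>\<star> = k" "k * k = 1 - h * h" "\<And>w. w * (h * h) = h * h * w \<Longrightarrow> k * w = w * k"
    using sqrt_one_minus_exists h(2) by metis
  have kh: "k * h = h * k" by (rule k(3)) (simp add: mult.assoc)
  have s: "(h + \<i> *\<^sub>C k)\<^sup>\<star> = h - \<i> *\<^sub>C k" by (simp add: star_add star_scaleC h k scaleC_minus_left)
  have "unitary (h + \<i> *\<^sub>C k)"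
    unfolding unitary_def s using k(2) kh
    by (simp add: algebra_simps mult_scaleC_left mult_scaleC_right scaleC_scaleC scaleC_minus_one
        scaleC_add_right scaleC_diff_right)
  then show thesis using that k(2) s by blast
qed

text \<open>
  A self-adjoint contraction \<open>h\<close> is the real part of the unitary \<open>h + i \<surd>(1 - h\<^sup>2)\<close>, and unitaries are
  mapped to unitaries.
\<close>

lemma unital_star_hom_contractive:
  fixes f :: "'a::cstar_algebra \<Rightarrow> 'b::cstar_algebra"
  assumes f: "unital_star_hom f"
  shows "norm (f x) \<le> norm x"
proof -
  note fD = unital_star_homD[OF f]
  have sa: "norm (f h) \<le> 1" if h: "h\<^sup>\<star> = h" "norm h < 1" for h
  proof -
    have "norm (h * h) < 1"
      using norm_mult_ineq[of h h] mult_strict_mono'[of "norm h" 1 "norm h" 1] h(2) by simp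
    then obtain k where u: "unitary (h + \<i> *\<^sub>C k)" "(h + \<i> *\<^sub>C k)\<^sup>\<star> = h - \<i> *\<^sub>C k"
      using unitary_with_real_part[OF h(1)] by metis
    define u where "u = h + \<i> *\<^sub>C k"
    have "unitary (f u)"
      using u(1) unfolding unitary_def u_def[symmetric] by (simp add: fD(4) flip: fD(3,5))
    then have n: "norm (f u) = 1" "norm (f (u\<^sup>\<star>)) = 1" by (auto simp: fD(5) norm_unitary)
    have "h + h = u + u\<^sup>\<star>" using u(2) unfolding u_def by simp
    then have "f h + f h = f u + f (u\<^sup>\<star>)" by (metis fD(1))
    then have "norm (2 *\<^sub>R f h) \<le> 2"
      using norm_triangle_ineq[of "f u" "f (u\<^sup>\<star>)"] n by (simp add: scaleR_2)
    then show ?thesis by simp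
  qed
  \<comment> \<open>The bound for norms below 1 is applied to \<open>h / r\<close> for every
    \<open>r\<close> above \<open>norm h\<close>; then \<open>r\<close> decreases to
    \<open>norm h\<close>.\<close>
  have sa': "norm (f h) \<le> norm h" if h: "h\<^sup>\<star> = h" for h
  proof (rule dense_ge)
    fix r assume r: "norm h < r"
    then have r0: "r > 0" using norm_ge_zero[of h] by linarith
    have "norm (f ((1/r) *\<^sub>R h)) \<le> 1"
      by (rule sa) (use h r r0 in \<open>auto simp: star_scaleR\<close>)
    moreover have "f ((1/r) *\<^sub>R h) = (1/r) *\<^sub>R f h"
      using unital_star_hom_linear[OF f] by (simp add: linear_cmul)
    ultimately show "norm (f h) \<le> r" using r0 by simp
  qed
  have "(norm (f x))\<^sup>2 = norm (f (x\<^sup>\<star> * x))"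
    by (simp add: cstar_identity fD)
  also have "\<dots> \<le> norm (x\<^sup>\<star> * x)"
    by (rule sa') (simp add: star_mult star_star)
  also have "\<dots> = (norm x)\<^sup>2" by (rule cstar_identity)
  finally show ?thesis by (simp add: abs_le_square_iff[symmetric])
qed

lemma unital_star_hom_bounded_linear: "unital_star_hom f \<Longrightarrow> bounded_linear f"
  by (rule bounded_linear_intro[where K = 1])
    (simp_all add: unital_star_homD unital_star_hom_contractive linear_cmul[OF unital_star_hom_linear])

text \<open>The closure of a contractive relation with dense domain is the graph of a function.\<close>

lemma star_hom_extension:
  fixes R :: "('a::cstar_algebra \<times> 'b::cstar_algebra) set"
  assumes add: "\<And>x y x' y'. (x, y) \<in> R \<Longrightarrow> (x', y') \<in> R \<Longrightarrow> (x + x', y + y') \<in> R"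
    and scale: "\<And>x y c. (x, y) \<in> R \<Longrightarrow> (c *\<^sub>C x, c *\<^sub>C y) \<in> R"
    and mult: "\<And>x y x' y'. (x, y) \<in> R \<Longrightarrow> (x', y') \<in> R \<Longrightarrow> (x * x', y * y') \<in> R"
    and star: "\<And>x y. (x, y) \<in> R \<Longrightarrow> (x\<^sup>\<star>, y\<^sup>\<star>) \<in> R"
    and one: "(1, 1) \<in> R"
    and contr: "\<And>x y. (x, y) \<in> R \<Longrightarrow> norm y \<le> norm x"
    and dense: "closure (Domain R) = UNIV"
  obtains f where "unital_star_hom f" "\<And>x y. (x, y) \<in> R \<Longrightarrow> f x = y"
proof -
  let ?C = "closure R"
  \<comment> \<open>A continuous operation that preserves \<open>R\<close> preserves its closure.
    Scaling and star are treated as binary operations that ignore their second argument.\<close>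
  have bin: "h p q \<in> ?C"
    if "p \<in> ?C" "q \<in> ?C" "continuous_on UNIV (\<lambda>z. h (fst z) (snd z))" "\<And>p q. p \<in> R \<Longrightarrow> q \<in> R \<Longrightarrow> h p q \<in> R"
    for p q and h :: "'a \<times> 'b \<Rightarrow> 'a \<times> 'b \<Rightarrow> 'a \<times> 'b"
  proof -
    have "(\<lambda>z. h (fst z) (snd z)) ` closure (R \<times> R) \<subseteq> ?C"
      using that(4)
      by (intro image_closure_subset continuous_on_subset[OF that(3)]) (auto intro!: subsetD[OF closure_subset])
    moreover have "(p, q) \<in> closure (R \<times> R)" using that(1,2) unfolding closure_Times by simp
    ultimately show ?thesis by force
  qed
  have Cadd: "(x + x', y + y') \<in> ?C" if "(x, y) \<in> ?C" "(x', y') \<in> ?C" for x y x' y'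
    using bin[OF that, of "\<lambda>p q. (fst p + fst q, snd p + snd q)"] add by (force intro: continuous_intros)
  have Cmult: "(x * x', y * y') \<in> ?C" if "(x, y) \<in> ?C" "(x', y') \<in> ?C" for x y x' y'
    using bin[OF that, of "\<lambda>p q. (fst p * fst q, snd p * snd q)"] mult by (force intro: continuous_intros)
  have Cscale: "(c *\<^sub>C x, c *\<^sub>C y) \<in> ?C" if "(x, y) \<in> ?C" for c x y
    using bin[OF that that, of "\<lambda>p q. (c *\<^sub>C fst p, c *\<^sub>C snd p)"] scale by (force intro: continuous_intros)
  have Cstar: "(x\<^sup>\<star>, y\<^sup>\<star>) \<in> ?C" if "(x, y) \<in> ?C" for x y
    using bin[OF that that, of "\<lambda>p q. ((fst p)\<^sup>\<star>, (snd p)\<^sup>\<star>)"] star by (force intro: continuous_intros)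
  have "closure R \<subseteq> {p. norm (snd p) \<le> norm (fst p)}"
    using contr by (intro closure_minimal closed_Collect_le continuous_intros) auto
  then have Ccontr: "norm y \<le> norm x" if "(x, y) \<in> ?C" for x y using that by auto
  \<comment> \<open>The difference of the two pairs is \<open>(0, y - y')\<close>, and contractivity
    on the closure forces its second entry to vanish.\<close>
  have uniq: "y = y'" if "(x, y) \<in> ?C" "(x, y') \<in> ?C" for x y y'
    using Ccontr[OF Cadd[OF that(1) Cscale[OF that(2), of "-1"]]] by (simp add: scaleC_minus_one)
  have total: "\<exists>y. (x, y) \<in> ?C" for x
  proof -
    obtain X where X: "\<forall>n. X n \<in> Domain R" "X \<longlonglongrightarrow> x"
      using dense closure_sequential[of x "Domain R"] by auto
    then have "\<forall>n. \<exists>y. (X n, y) \<in> R" by blast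
    then obtain Y where Y: "\<And>n. (X n, Y n) \<in> R" by metis
    have "norm (Y m - Y n) \<le> norm (X m - X n)" for m n
      using contr[OF add[OF Y[of m] scale[OF Y[of n], of "-1"]]] by (simp add: scaleC_minus_one)
    moreover have "Cauchy X" using X(2) by (rule LIMSEQ_imp_Cauchy)
    ultimately have "Cauchy Y"
      unfolding Cauchy_iff by (meson le_less_trans)
    then obtain y where "Y \<longlonglongrightarrow> y" by (metis Cauchy_convergent_iff convergentD)
    then have "(\<lambda>n. (X n, Y n)) \<longlonglongrightarrow> (x, y)" by (rule tendsto_Pair[OF X(2)])
    then have "(x, y) \<in> ?C"
      unfolding closure_sequential using Y by (intro exI[of _ "\<lambda>n. (X n, Y n)"]) simp
    then show ?thesis by blast
  qed
  define f where "f x = (THE y. (x, y) \<in> ?C)" for x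
  have fI: "f x = y" if "(x, y) \<in> ?C" for x y
    unfolding f_def using that uniq by blast
  have fC: "(x, f x) \<in> ?C" for x
    using total[of x] fI by blast
  have RC: "R \<subseteq> ?C" by (rule closure_subset)
  show thesis
  proof
    show "unital_star_hom f"
      unfolding unital_star_hom_def
    proof (intro conjI allI)
      show "f 1 = 1" using fI one RC by blast
    qed (intro fI Cadd Cmult Cstar Cscale fC)+
    show "f x = y" if "(x, y) \<in> R" for x y
      using fI that RC by blast
  qed
qed

lemma closed_isometric_image:
  fixes f :: "'a::banach \<Rightarrow> 'b::real_normed_vector"
  assumes "linear f" "\<And>x. norm (f x) = norm x" "closed S" "Real_Vector_Spaces.subspace S"
  shows "closed (f ` S)"
proof -
  have bl: "bounded_linear f"
    using assms(1,2) by (intro bounded_linear_intro[where K = 1]) (simp_all add: linear_add linear_cmul)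
  have "complete (f ` S)"
    by (rule complete_isometric_image[of 1 S])
       (use assms bl in \<open>auto simp: complete_eq_closed\<close>)
  then show ?thesis by (rule complete_imp_closed)
qed

lemma scalarsE: "x \<in> scalars \<Longrightarrow> (\<And>c. x = c *\<^sub>C 1 \<Longrightarrow> P) \<Longrightarrow> P"
  unfolding scalars_def by blast

lemma scalarsI: "c *\<^sub>C 1 \<in> scalars"
  unfolding scalars_def by blast

section \<open>Norming functionals on finitely generated subspaces\<close>

text \<open>The extension of a dominated functional by one dimension. The set \<open>B\<close> is
  independent so that the new functional can be given by its values on \<open>insert x B\<close>. It
  is a linear map on the whole space, but the bound is claimed on the span only.\<close>

lemma hahn_banach_step:
  fixes \<phi> :: "'a::real_normed_vector \<Rightarrow> real"
  assumes lin: "linear \<phi>" and ind: "independent B" and le: "\<And>y. y \<in> span B \<Longrightarrow> \<phi> y \<le> norm y"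
    and x: "x \<notin> span B"
  obtains \<psi> where "linear \<psi>" "\<And>y. y \<in> span B \<Longrightarrow> \<psi> y = \<phi> y"
    "\<And>y. y \<in> span (insert x B) \<Longrightarrow> \<psi> y \<le> norm y"
proof -
  \<comment> \<open>The admissible values at \<open>x\<close> lie above every
    \<open>\<phi> y - norm (y - x)\<close> and below every \<open>norm (y' + x) - \<phi> y'\<close>.
    By the triangle inequality this interval is not empty, and its lower end is taken.\<close>
  define c where "c = (SUP y\<in>span B. \<phi> y - norm (y - x))"
  have cmp: "\<phi> y - norm (y - x) \<le> norm (y' + x) - \<phi> y'" if "y \<in> span B" "y' \<in> span B" for y y'
  proof -
    have "\<phi> y + \<phi> y' \<le> norm (y + y')"
      using le[OF span_add[OF that]] by (simp add: linear_add[OF lin])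
    also have "\<dots> \<le> norm (y - x) + norm (y' + x)"
      using norm_triangle_ineq[of "y - x" "y' + x"] by simp
    finally show ?thesis by simp
  qed
  have bdd: "bdd_above ((\<lambda>y. \<phi> y - norm (y - x)) ` span B)"
    using cmp[OF _ span_zero] by (intro bdd_aboveI2) blast
  have c_ge: "\<phi> y - norm (y - x) \<le> c" if "y \<in> span B" for y
    unfolding c_def by (rule cSUP_upper[OF that bdd])
  have c_le: "c \<le> norm (y + x) - \<phi> y" if "y \<in> span B" for y
    unfolding c_def by (rule cSUP_least) (use cmp[OF _ that] span_zero in auto)
  have "independent (insert x B)"
    using ind x by (rule independent_insertI[rotated])
  then obtain \<psi> where \<psi>: "linear \<psi>" "\<And>b. b \<in> insert x B \<Longrightarrow> \<psi> b = (if b = x then c else \<phi> b)"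
    using linear_independent_extend[of "insert x B" "\<lambda>b. if b = x then c else \<phi> b"] by blast
  have "b \<noteq> x" if "b \<in> B" for b
    using x that span_base by blast
  then have eq: "\<psi> y = \<phi> y" if "y \<in> span B" for y
    using linear_eq_on_span[OF \<psi>(1) lin _ that] \<psi>(2) by simp
  have cx: "\<psi> x = c" using \<psi>(2)[of x] by simp
  show thesis
  proof
    fix y assume "y \<in> span (insert x B)"
    then obtain r where r: "y - r *\<^sub>R x \<in> span B"
      unfolding span_breakdown_eq by blast
    define w where "w = y - r *\<^sub>R x"
    have y: "y = w + r *\<^sub>R x" unfolding w_def by simp
    have w: "s *\<^sub>R w \<in> span B" for s using r unfolding w_def by (rule span_scale)
    have py: "\<psi> y = \<phi> w + r * c"
      unfolding y using w[of 1] by (simp add: linear_add[OF \<psi>(1)] linear_cmul[OF \<psi>(1)] eq cx)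
    consider "r = 0" | "r > 0" | "r < 0" by linarith
    then show "\<psi> y \<le> norm y"
    proof cases
      case 1
      then show ?thesis using py y le[of w] w[of 1] by simp
    next
      case 2
      have "r * c \<le> r * (norm ((1/r) *\<^sub>R w + x) - \<phi> ((1/r) *\<^sub>R w))"
        using c_le[OF w] 2 by (intro mult_left_mono) auto
      also have "\<dots> = norm (r *\<^sub>R ((1/r) *\<^sub>R w + x)) - \<phi> w"
        using 2 by (simp add: linear_cmul[OF lin] right_diff_distrib)
      also have "r *\<^sub>R ((1/r) *\<^sub>R w + x) = y"
        using 2 y by (simp add: scaleR_add_right)
      finally show ?thesis using py by simp
    next
      case 3
      have "(- r) * (\<phi> ((1/(-r)) *\<^sub>R w) - norm ((1/(-r)) *\<^sub>R w - x)) \<le> (- r) * c"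
        using c_ge[OF w, of "1/(-r)"] 3 by (intro mult_left_mono) linarith+
      moreover have "(- r) * (\<phi> ((1/(-r)) *\<^sub>R w) - norm ((1/(-r)) *\<^sub>R w - x))
          = \<phi> w - norm ((- r) *\<^sub>R ((1/(-r)) *\<^sub>R w - x))"
        using 3 unfolding linear_cmul[OF lin] norm_scaleR by (simp add: right_diff_distrib)
      moreover have "(- r) *\<^sub>R ((1/(-r)) *\<^sub>R w - x) = y"
        using 3 y by (simp add: scaleR_diff_right)
      ultimately have "\<phi> w - norm y \<le> (- r) * c" by (simp only:)
      then show ?thesis using py by simp
    qed
  qed (use \<psi>(1) eq in auto)
qed

text \<open>The extension starts on the line through \<open>u\<close>, where the norm is attained,
  and adds the elements of \<open>F\<close> one at a time. Elements that already lie in the span are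
  skipped to keep the generating set independent.\<close>

lemma hahn_banach_finite:
  fixes u :: "'a::real_normed_vector"
  assumes "finite F" "u \<noteq> 0"
  obtains \<phi> where "linear \<phi>" "\<phi> u = norm u" "\<And>y. y \<in> span (insert u F) \<Longrightarrow> \<phi> y \<le> norm y"
proof -
  have "\<exists>\<phi> B. linear \<phi> \<and> \<phi> u = norm u \<and> independent B \<and> insert u F \<subseteq> span B \<and>
    (\<forall>y\<in>span B. \<phi> y \<le> norm y)"
    using \<open>finite F\<close>
  proof induction
    case empty
    have ind: "independent {u}" using \<open>u \<noteq> 0\<close> by simp
    then obtain \<phi> where \<phi>: "linear \<phi>" "\<phi> u = norm u"
      using linear_independent_extend[of "{u}" norm] by auto
    have "\<phi> (k *\<^sub>R u) \<le> norm (k *\<^sub>R u)" for k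
      using mult_right_mono[of k "\<bar>k\<bar>" "norm u"] by (simp add: linear_cmul[OF \<phi>(1)] \<phi>(2))
    then have "\<forall>y\<in>span {u}. \<phi> y \<le> norm y"
      unfolding span_singleton by blast
    with \<phi> ind show ?case by (intro exI[of _ \<phi>] exI[of _ "{u}"]) (auto intro: span_base)
  next
    case (insert x F)
    then obtain \<phi> B where *: "linear \<phi>" "\<phi> u = norm u" "independent B" "insert u F \<subseteq> span B"
      "\<forall>y\<in>span B. \<phi> y \<le> norm y"
      by blast
    show ?case
    proof (cases "x \<in> span B")
      case True
      with * show ?thesis by blast
    next
      case False
      obtain \<psi> where \<psi>: "linear \<psi>" "\<And>y. y \<in> span B \<Longrightarrow> \<psi> y = \<phi> y"
        "\<And>y. y \<in> span (insert x B) \<Longrightarrow> \<psi> y \<le> norm y"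
        using hahn_banach_step[OF *(1,3) _ False] *(5) by blast
      have "insert u (insert x F) \<subseteq> span (insert x B)"
        using *(4) span_mono[of B "insert x B"] span_base[of x "insert x B"] by blast
      moreover have "independent (insert x B)"
        using False *(3) by (rule independent_insertI)
      moreover have "\<psi> u = norm u" using \<psi>(2) * by auto
      ultimately show ?thesis using \<psi> by blast
    qed
  qed
  then obtain \<phi> B where *: "linear \<phi>" "\<phi> u = norm u" "insert u F \<subseteq> span B"
    "\<forall>y\<in>span B. \<phi> y \<le> norm y"
    by blast
  moreover have "span (insert u F) \<subseteq> span B"
    using *(3) by (simp add: span_minimal)
  ultimately show thesis using that by blast
qed

text \<open>A real functional \<open>f\<close> is the real part of the complex functional \<open>x \<mapsto> f x - i f (i x)\<close>.\<close>

lemma complex_functional_finite: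
  fixes X :: "nat \<Rightarrow> 'a::cstar_algebra"
  obtains \<phi> :: "'a \<Rightarrow> complex" where "\<And>x y. \<phi> (x + y) = \<phi> x + \<phi> y" "\<And>c x. \<phi> (c *\<^sub>C x) = c * \<phi> x"
    "\<phi> 1 = 1" "\<And>d c. norm (\<phi> (d *\<^sub>C 1 + (\<Sum>i<n. c i *\<^sub>C X i))) \<le> 2 * norm (d *\<^sub>C 1 + (\<Sum>i<n. c i *\<^sub>C X i))"
proof -
  \<comment> \<open>Together with 1, these vectors span over the reals the complex span of 1 and the
    \<open>X i\<close>, so the real bound controls both the real and the imaginary part.\<close>
  define F where "F = insert (\<i> *\<^sub>C 1) (X ` {..<n} \<union> (\<lambda>i. \<i> *\<^sub>C X i) ` {..<n})"
  have "finite F" unfolding F_def by simp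
  then obtain f where f: "linear f" "f (1 :: 'a) = norm (1 :: 'a)"
    "\<And>y. y \<in> span (insert 1 F) \<Longrightarrow> f y \<le> norm y"
    using hahn_banach_finite[of F "1 :: 'a"] by auto
  note lin = linear_add[OF f(1)] linear_cmul[OF f(1)]
  have neg: "f (- x) = - f x" for x using linear_neg[OF f(1)] .
  have f': "\<bar>f y\<bar> \<le> norm y" if "y \<in> span (insert 1 F)" for y
    using f(3)[OF that] f(3)[OF span_neg[OF that]] neg[of y] by simp
  define \<psi> where "\<psi> x = Complex (f x) (- f (\<i> *\<^sub>C x))" for x
  have add: "\<psi> (x + y) = \<psi> x + \<psi> y" for x y
    unfolding \<psi>_def by (simp add: scaleC_add_right lin complex_eq_iff)
  have split: "c *\<^sub>C x = Re c *\<^sub>R x + Im c *\<^sub>R (\<i> *\<^sub>C x)" for c and x :: 'a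
  proof -
    have "c *\<^sub>C x = (complex_of_real (Re c) + complex_of_real (Im c) * \<i>) *\<^sub>C x"
      by (subst complex_eq[of c]) (simp only: mult.commute)
    then show ?thesis by (simp only: scaleC_add_left flip: scaleC_scaleC scaleC_of_real)
  qed
  have scale: "\<psi> (c *\<^sub>C x) = c * \<psi> x" for c x
  proof -
    have "f (c *\<^sub>C x) = Re c * f x + Im c * f (\<i> *\<^sub>C x)"
      unfolding split[of c x] by (simp add: lin)
    moreover have "\<i> *\<^sub>C c *\<^sub>C x = Re c *\<^sub>R (\<i> *\<^sub>C x) - Im c *\<^sub>R x"
    proof -
      have "\<i> *\<^sub>C c *\<^sub>C x = c *\<^sub>C \<i> *\<^sub>C x"
        by (simp only: scaleC_scaleC mult.commute)
      also have "\<dots> = Re c *\<^sub>R (\<i> *\<^sub>C x) + Im c *\<^sub>R (\<i> *\<^sub>C \<i> *\<^sub>C x)" by (rule split)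
      also have "\<i> *\<^sub>C \<i> *\<^sub>C x = - x" by (simp add: scaleC_scaleC scaleC_minus_one)
      finally show ?thesis by simp
    qed
    then have "f (\<i> *\<^sub>C c *\<^sub>C x) = Re c * f (\<i> *\<^sub>C x) - Im c * f x"
      by (simp add: lin linear_diff[OF f(1)])
    ultimately show ?thesis
      unfolding \<psi>_def by (simp add: complex_eq_iff)
  qed
  \<comment> \<open>The imaginary part of \<open>\<psi> 1\<close> is not computed. As its real part
    is 1, its modulus is at least 1, so dividing by \<open>\<psi> 1\<close> normalises the
    functional without increasing the bound.\<close>
  have Re1: "Re (\<psi> 1) = 1" unfolding \<psi>_def by (simp add: f)
  then have w: "norm (\<psi> 1) \<ge> 1" "\<psi> 1 \<noteq> 0"
    using abs_Re_le_cmod[of "\<psi> 1"] by auto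
  \<comment> \<open>The factor 2 arises because the modulus is estimated by the sum of the absolute
    values of real and imaginary part, each of which is at most \<open>norm x\<close>.\<close>
  have bound: "norm (\<psi> x) \<le> 2 * norm x"
    if x: "x = d *\<^sub>C 1 + (\<Sum>i<n. c i *\<^sub>C X i)" for x d c
  proof -
    have sp: "c *\<^sub>C 1 \<in> span (insert 1 F)" "i < n \<Longrightarrow> c *\<^sub>C X i \<in> span (insert 1 F)" for c i
      unfolding split[of c]
      by (intro span_add span_scale span_base; simp add: F_def)+
    have "d *\<^sub>C 1 + (\<Sum>i<n. c i *\<^sub>C X i) \<in> span (insert 1 F)" for d c
      by (intro span_add span_sum sp) auto
    from this[of d c] this[of "\<i> * d" "\<lambda>i. \<i> * c i"]
    have "x \<in> span (insert 1 F)" "\<i> *\<^sub>C x \<in> span (insert 1 F)"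
      unfolding x by (simp_all add: scaleC_add_right scaleC_sum_right scaleC_scaleC)
    from f'[OF this(1)] f'[OF this(2)]
    have "\<bar>f x\<bar> + \<bar>f (\<i> *\<^sub>C x)\<bar> \<le> 2 * norm x"
      by (simp add: norm_scaleC)
    then show ?thesis
      using cmod_le[of "\<psi> x"] unfolding \<psi>_def by simp
  qed
  show thesis
  proof
    show "norm (\<psi> (d *\<^sub>C 1 + (\<Sum>i<n. c i *\<^sub>C X i)) / \<psi> 1) \<le> 2 * norm (d *\<^sub>C 1 + (\<Sum>i<n. c i *\<^sub>C X i))" for d c
    proof -
      have "norm (\<psi> (d *\<^sub>C 1 + (\<Sum>i<n. c i *\<^sub>C X i))) / norm (\<psi> 1) \<le>
          norm (\<psi> (d *\<^sub>C 1 + (\<Sum>i<n. c i *\<^sub>C X i)))"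
        using w by (simp add: divide_le_eq mult_left_le mult_ge1_I mult_le_cancel_left1)
      with bound[OF refl, of d c] show ?thesis by (simp add: norm_divide)
    qed
  qed (use w in \<open>auto simp: add scale add_divide_distrib\<close>)
qed

section \<open>Homomorphisms on the tensor product\<close>

lemma character_contractive: "\<omega> \<in> characters \<Longrightarrow> norm (\<omega> z) \<le> norm z"
  unfolding characters_def using unital_star_hom_contractive by blast

lemma characters_comp: "\<omega> \<in> characters \<Longrightarrow> unital_star_hom \<beta> \<Longrightarrow> \<omega> \<circ> \<beta> \<in> characters"
  unfolding characters_def using unital_star_hom_comp by blast

context cstar_tensor_product
begin

lemma tens_scaleR_left: "tens (r *\<^sub>R x) z = r *\<^sub>R tens x z"
  using tens_scaleC_left[of "complex_of_real r"] by (simp add: scaleC_of_real)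

lemma tens_scaleR_right: "tens x (r *\<^sub>R z) = r *\<^sub>R tens x z"
  using tens_scaleC_right[of x "complex_of_real r"] by (simp add: scaleC_of_real)

lemma tens_zero_left [simp]: "tens 0 z = 0"
  using tens_scaleC_left[of 0 0 z] by simp

lemma tens_sum_left: "tens (\<Sum>i\<in>I. f i) z = (\<Sum>i\<in>I. tens (f i) z)"
  by (induction I rule: infinite_finite_induct) (simp_all add: tens_add_left)

lemma linear_tens_right: "linear (tens x)"
  by (rule linearI) (simp_all add: tens_add_right tens_scaleR_right)

lemma linear_tens_left: "linear (\<lambda>x. tens x z)"
  by (rule linearI) (simp_all add: tens_add_left tens_scaleR_left)

lemma tens_left_inject [simp]: "tens x 1 = tens y 1 \<longleftrightarrow> x = y"
  using norm_tens[of "x - y" 1] linear_diff[OF linear_tens_left[of 1], of x y] by auto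

text \<open>Without characters every supremum in \<open>norm_tens_sum\<close> would be the same
  supremum of the empty set, and \<open>tens 1 1 = 1\<close> would have the norm of the empty
  sum.\<close>

lemma characters_nonempty: "(characters :: ('z \<Rightarrow> complex) set) \<noteq> {}"
proof
  assume "(characters :: ('z \<Rightarrow> complex) set) = {}"
  then have "norm (\<Sum>i<n. tens (X i) (Z i)) = norm (\<Sum>i<m. tens (X' i) (Z' i))" for n m :: nat and X X' Z Z'
    unfolding norm_tens_sum by simp
  from this[where n = 1 and X = "\<lambda>_. 1" and Z = "\<lambda>_. 1" and m = 0] show False by (simp add: tens_one)
qed

text \<open>A supremum of reals bounds its members only if the set is bounded above; this holds
  because characters are contractive.\<close>

lemma norm_slice_sum_le:
  assumes "\<omega> \<in> characters"
  shows "norm (\<Sum>i<(n::nat). \<omega> (Z i) *\<^sub>C X i) \<le> norm (\<Sum>i<n. tens (X i) (Z i))"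
proof -
  have "norm (\<Sum>i<n. \<omega>' (Z i) *\<^sub>C X i) \<le> (\<Sum>i<n. norm (Z i) * norm (X i))" if "\<omega>' \<in> characters" for \<omega>'
    by (rule sum_norm_le) (use character_contractive[OF that] in \<open>simp add: norm_scaleC mult_right_mono\<close>)
  then have "bdd_above ((\<lambda>\<omega>'. norm (\<Sum>i<n. \<omega>' (Z i) *\<^sub>C X i)) ` characters)"
    by (rule bdd_aboveI2)
  then show ?thesis
    unfolding norm_tens_sum by (rule cSUP_upper[OF assms])
qed

lemma sum_list_tens: "sum_list (map (case_prod F) L) = (\<Sum>i<length L. F (fst (L ! i)) (snd (L ! i)))"
  by (simp add: sum_list_sum_nth atLeast0LessThan case_prod_beta)

lemma cspan_tens_list:
  assumes "t \<in> cspan {tens x z | x z. True}"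
  shows "\<exists>L. t = sum_list (map (case_prod tens) L)"
proof -
  let ?S = "{sum_list (map (case_prod tens) L) | L. True}"
  have "csubspace ?S"
  proof (rule module.subspaceI[OF module_scaleC])
    show "0 \<in> ?S" by (rule CollectI, rule exI[of _ "[]"]) simp
    show "s + t \<in> ?S" if "s \<in> ?S" "t \<in> ?S" for s t
    proof -
      from that obtain L M where "s = sum_list (map (case_prod tens) L)" "t = sum_list (map (case_prod tens) M)"
        by blast
      then have "s + t = sum_list (map (case_prod tens) (L @ M))" by simp
      then show ?thesis by blast
    qed
    show "c *\<^sub>C s \<in> ?S" if "s \<in> ?S" for c s
    proof -
      from that obtain L where "s = sum_list (map (case_prod tens) L)" by blast
      moreover have "c *\<^sub>C sum_list (map (case_prod tens) L)
          = sum_list (map (case_prod tens) (map (map_prod ((*\<^sub>C) c) id) L))"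
        by (induction L) (auto simp: scaleC_add_right tens_scaleC_left)
      ultimately show ?thesis by blast
    qed
  qed
  moreover have "{tens x z | x z. True} \<subseteq> ?S"
  proof (clarify)
    fix x z
    show "\<exists>L. tens x z = sum_list (map (case_prod tens) L) \<and> True"
      by (rule exI[of _ "[(x, z)]"]) simp
  qed
  ultimately have "cspan {tens x z | x z. True} \<subseteq> ?S"
    by (rule module.span_minimal[OF module_scaleC, rotated])
  with assms show ?thesis by blast
qed

lemma closure_tens_list: "closure {sum_list (map (case_prod tens) L) | L. True} = UNIV"
  using tens_dense closure_mono[of "cspan {tens x z | x z. True}" "{sum_list (map (case_prod tens) L) | L. True}"]
    cspan_tens_list by blast

lemma tens_approx:
  assumes "e > 0"
  obtains n :: nat and X Z where "norm (t - (\<Sum>i<n. tens (X i) (Z i))) < e"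
proof -
  have "t \<in> closure {sum_list (map (case_prod tens) L) | L. True}"
    using closure_tens_list by simp
  then obtain L where "dist (sum_list (map (case_prod tens) L)) t < e"
    using assms unfolding closure_approachable by blast
  then show thesis
    unfolding sum_list_tens by (intro that[where n = "length L"]) (simp add: dist_norm norm_minus_commute)
qed

lemma bounded_linear_eqI:
  assumes "bounded_linear f" "bounded_linear g" and eq: "\<And>a z. f (tens a z) = g (tens a z)"
  shows "f = (g :: 't \<Rightarrow> 'b::real_normed_vector)"
proof
  fix t
  have "closed {t. f t = g t}"
    by (intro closed_Collect_eq linear_continuous_on assms)
  moreover have "f (sum_list (map (case_prod tens) L)) = g (sum_list (map (case_prod tens) L))" for L
    by (induction L) (auto simp: eq bounded_linear.linear[OF assms(1)] bounded_linear.linear[OF assms(2)]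
      linear_0 linear_add)
  then have "{sum_list (map (case_prod tens) L) | L. True} \<subseteq> {t. f t = g t}" by blast
  ultimately have "closure {sum_list (map (case_prod tens) L) | L. True} \<subseteq> {t. f t = g t}"
    by (rule closure_minimal[rotated])
  then show "f t = g t" using closure_tens_list by blast
qed

lemma star_hom_eqI:
  assumes "unital_star_hom f" "unital_star_hom g" "\<And>a z. f (tens a z) = g (tens a z)"
  shows "f = g"
  using assms by (intro bounded_linear_eqI unital_star_hom_bounded_linear)

text \<open>The relation \<open>R\<close> pairs the two evaluations of the same formal sum. Its
  single-valuedness is not verified on representations of an element as a sum; it is a consequence
  of contractivity in \<open>star_hom_extension\<close>. Lists serve as formal sums because addition
  is then concatenation.\<close>

lemma star_hom_on_tensor:
  fixes F :: "'a \<Rightarrow> 'z \<Rightarrow> 'b::cstar_algebra"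
  assumes scale: "\<And>c x z. F (c *\<^sub>C x) z = c *\<^sub>C F x z"
    and mult: "\<And>x y z w. F (x * y) (z * w) = F x z * F y w"
    and star: "\<And>x z. F (x\<^sup>\<star>) (z\<^sup>\<star>) = (F x z)\<^sup>\<star>" and one: "F 1 1 = 1"
    and contr: "\<And>(n::nat) X Z. norm (\<Sum>i<n. F (X i) (Z i)) \<le> norm (\<Sum>i<n. tens (X i) (Z i))"
  obtains f where "unital_star_hom f" "\<And>a z. f (tens a z) = F a z"
proof -
  let ?s = "\<lambda>F L. sum_list (map (case_prod F) L)"
  define R where "R = {(?s tens L, ?s F L) | L. True}"
  have RI: "(?s tens L, ?s F L) \<in> R" for L unfolding R_def by blast
  have Radd: "(x + x', y + y') \<in> R" if xy: "(x, y) \<in> R" "(x', y') \<in> R" for x y x' y'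
  proof -
    from xy obtain L M where "x = ?s tens L" "y = ?s F L" "x' = ?s tens M" "y' = ?s F M"
      unfolding R_def by blast
    then show ?thesis using RI[of "L @ M"] by simp
  qed
  have Rone: "(1, 1) \<in> R"
    using RI[of "[(1, 1)]"] by (simp add: one tens_one)
  have Rzero: "(0, 0) \<in> R"
    using RI[of "[]"] by simp
  have Rscale: "(c *\<^sub>C x, c *\<^sub>C y) \<in> R" if "(x, y) \<in> R" for c x y
  proof -
    from that obtain L where L: "x = ?s tens L" "y = ?s F L"
      unfolding R_def by blast
    have "c *\<^sub>C ?s tens L = ?s tens (map (map_prod ((*\<^sub>C) c) id) L)"
      "c *\<^sub>C ?s F L = ?s F (map (map_prod ((*\<^sub>C) c) id) L)"
      by (induction L) (auto simp: scaleC_add_right tens_scaleC_left scale)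
    then show ?thesis using RI L by metis
  qed
  have Rstar: "(x\<^sup>\<star>, y\<^sup>\<star>) \<in> R" if "(x, y) \<in> R" for x y
  proof -
    from that obtain L where L: "x = ?s tens L" "y = ?s F L"
      unfolding R_def by blast
    have "(?s tens L)\<^sup>\<star> = ?s tens (map (map_prod star star) L)"
      "(?s F L)\<^sup>\<star> = ?s F (map (map_prod star star) L)"
      by (induction L) (auto simp: star_add tens_star star)
    then show ?thesis using RI L by metis
  qed
  have Rmult1: "(tens a z * x, F a z * y) \<in> R" if "(x, y) \<in> R" for a z x y
  proof -
    from that obtain L where L: "x = ?s tens L" "y = ?s F L"
      unfolding R_def by blast
    have "tens a z * ?s tens L = ?s tens (map (map_prod ((*) a) ((*) z)) L)"
      "F a z * ?s F L = ?s F (map (map_prod ((*) a) ((*) z)) L)"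
      by (induction L) (auto simp: distrib_left tens_mult mult)
    then show ?thesis using RI L by metis
  qed
  have "(?s tens L * x, ?s F L * y) \<in> R" if "(x, y) \<in> R" for L x y
    by (induction L) (auto simp: Rzero distrib_right intro!: Radd Rmult1 that)
  then have Rmult: "(x * x', y * y') \<in> R" if "(x, y) \<in> R" "(x', y') \<in> R" for x y x' y'
    using that unfolding R_def[of] by blast
  have Rcontr: "norm y \<le> norm x" if "(x, y) \<in> R" for x y
  proof -
    from that obtain L where "x = ?s tens L" "y = ?s F L"
      unfolding R_def by blast
    then show ?thesis unfolding sum_list_tens by (simp only: contr)
  qed
  have "Domain R = {?s tens L | L. True}" unfolding R_def by blast
  then have "closure (Domain R) = UNIV" using closure_tens_list by simp
  then obtain f where f: "unital_star_hom f" "\<And>x y. (x, y) \<in> R \<Longrightarrow> f x = y"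
    using star_hom_extension[OF Radd Rscale Rmult Rstar Rone Rcontr] by blast
  show thesis
  proof
    show "f (tens a z) = F a z" for a z
      using f(2) RI[of "[(a, z)]"] by simp
  qed (rule f)
qed

text \<open>If \<omega> is a character, so is \<omega> \<circ> \<beta>. As \<rho> is contractive,
  the contribution of \<omega> to the norm of the image is at most the contribution of \<omega>
  \<circ> \<beta> to the norm of the original sum.\<close>

lemma tensor_hom:
  assumes \<rho>: "unital_star_hom \<rho>" and \<beta>: "unital_star_hom \<beta>"
  shows "unital_star_hom (tensor_hom tens \<rho> \<beta>)" "tensor_hom tens \<rho> \<beta> (tens a z) = tens (\<rho> a) (\<beta> z)"
proof -
  have contr: "norm (\<Sum>i<n. tens (\<rho> (X i)) (\<beta> (Z i))) \<le> norm (\<Sum>i<n. tens (X i) (Z i))"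
    for n :: nat and X Z
    unfolding norm_tens_sum[of "\<lambda>i. \<rho> (X i)"]
  proof (rule cSUP_least[OF characters_nonempty])
    fix \<omega> :: "'z \<Rightarrow> complex" assume \<omega>: "\<omega> \<in> characters"
    have "norm (\<Sum>i<n. \<omega> (\<beta> (Z i)) *\<^sub>C \<rho> (X i)) = norm (\<rho> (\<Sum>i<n. (\<omega> \<circ> \<beta>) (Z i) *\<^sub>C X i))"
      by (simp add: unital_star_hom_sum[OF \<rho>] unital_star_homD[OF \<rho>])
    also have "\<dots> \<le> norm (\<Sum>i<n. (\<omega> \<circ> \<beta>) (Z i) *\<^sub>C X i)"
      by (rule unital_star_hom_contractive[OF \<rho>])
    also have "\<dots> \<le> norm (\<Sum>i<n. tens (X i) (Z i))"
      by (rule norm_slice_sum_le) (rule characters_comp[OF \<omega> \<beta>])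
    finally show "norm (\<Sum>i<n. \<omega> (\<beta> (Z i)) *\<^sub>C \<rho> (X i)) \<le> norm (\<Sum>i<n. tens (X i) (Z i))" .
  qed
  note D = unital_star_homD[OF \<rho>] unital_star_homD[OF \<beta>]
  obtain f where f: "unital_star_hom f" "\<And>a z. f (tens a z) = tens (\<rho> a) (\<beta> z)"
    using star_hom_on_tensor[of "\<lambda>a z. tens (\<rho> a) (\<beta> z)"] contr
    by (auto simp: D tens_scaleC_left tens_mult tens_star tens_one)
  have "\<exists>!\<Phi>. unital_star_hom \<Phi> \<and> (\<forall>a z. \<Phi> (tens a z) = tens (\<rho> a) (\<beta> z))"
  proof (rule ex1I[of _ f])
    show "\<Phi> = f" if "unital_star_hom \<Phi> \<and> (\<forall>a z. \<Phi> (tens a z) = tens (\<rho> a) (\<beta> z))" for \<Phi>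
      by (rule star_hom_eqI) (use that f in auto)
  qed (use f in auto)
  from theI'[OF this]
  show "unital_star_hom (tensor_hom tens \<rho> \<beta>)" "tensor_hom tens \<rho> \<beta> (tens a z) = tens (\<rho> a) (\<beta> z)"
    unfolding tensor_hom_def by blast+
qed

text \<open>For a character \<omega> this is the product map of the identity and \<omega>. Since
  \<omega> is multiplicative, it is a homomorphism and not just a linear map, and so it carries
  intertwining relations to intertwining relations.\<close>

definition slice :: "('z \<Rightarrow> complex) \<Rightarrow> 't \<Rightarrow> 'a" where
  "slice \<omega> = (SOME f. unital_star_hom f \<and> (\<forall>a z. f (tens a z) = \<omega> z *\<^sub>C a))"

lemma slice:
  assumes "\<omega> \<in> characters"
  shows "unital_star_hom (slice \<omega>)" "slice \<omega> (tens a z) = \<omega> z *\<^sub>C a"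
proof -
  have \<omega>: "unital_star_hom \<omega>" using assms unfolding characters_def by simp
  note D = unital_star_homD[OF \<omega>]
  obtain f where "unital_star_hom f" "\<And>a z. f (tens a z) = \<omega> z *\<^sub>C a"
  proof (rule star_hom_on_tensor[of "\<lambda>a z. \<omega> z *\<^sub>C a"])
    show "\<omega> z *\<^sub>C c *\<^sub>C x = c *\<^sub>C \<omega> z *\<^sub>C x" for c z x
      by (simp only: scaleC_scaleC mult.commute)
    show "\<omega> (z * w) *\<^sub>C (x * y) = \<omega> z *\<^sub>C x * \<omega> w *\<^sub>C y" for z w x y
      by (simp add: D mult_scaleC_left mult_scaleC_right scaleC_scaleC mult.commute)
    show "\<omega> (z\<^sup>\<star>) *\<^sub>C x\<^sup>\<star> = (\<omega> z *\<^sub>C x)\<^sup>\<star>" for z x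
      by (simp add: D star_scaleC star_complex_def)
    show "\<omega> 1 *\<^sub>C 1 = (1 :: 'a)"
      by (simp add: D)
  qed (simp_all add: norm_slice_sum_le[OF assms])
  then have "\<exists>f. unital_star_hom f \<and> (\<forall>a z. f (tens a z) = \<omega> z *\<^sub>C a)" by blast
  from someI_ex[OF this]
  show "unital_star_hom (slice \<omega>)" "slice \<omega> (tens a z) = \<omega> z *\<^sub>C a"
    unfolding slice_def by blast+
qed

lemma slice_one: "\<omega> \<in> characters \<Longrightarrow> slice \<omega> (tens a 1) = a"
  using slice(2)[of \<omega> a 1] by (auto simp: characters_def unital_star_homD)

text \<open>For finite sums of elementary tensors this is the supremum formula. A general
  \<open>t\<close> is within \<open>e / 2\<close> of such a sum; the error enters once through the
  slices, which are contractive, and once through the norm itself.\<close>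

lemma norm_le_slices:
  assumes "\<And>\<omega>. \<omega> \<in> characters \<Longrightarrow> norm (slice \<omega> t) \<le> r"
  shows "norm t \<le> r"
proof (rule field_le_epsilon)
  fix e :: real assume "e > 0"
  then obtain n :: nat and X Z where d: "norm (t - (\<Sum>i<n. tens (X i) (Z i))) < e / 2"
    using tens_approx[OF half_gt_zero] by metis
  let ?d = "\<Sum>i<n. tens (X i) (Z i)"
  have "norm ?d \<le> r + e / 2"
    unfolding norm_tens_sum
  proof (rule cSUP_least[OF characters_nonempty])
    fix \<omega> :: "'z \<Rightarrow> complex" assume \<omega>: "\<omega> \<in> characters"
    note s = slice(1)[OF \<omega>]
    have "(\<Sum>i<n. \<omega> (Z i) *\<^sub>C X i) = slice \<omega> t - slice \<omega> (t - ?d)"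
      by (simp add: unital_star_hom_diff[OF s] unital_star_hom_sum[OF s] slice(2)[OF \<omega>])
    then have "norm (\<Sum>i<n. \<omega> (Z i) *\<^sub>C X i) \<le> norm (slice \<omega> t) + norm (slice \<omega> (t - ?d))"
      by (simp add: norm_triangle_ineq4)
    then show "norm (\<Sum>i<n. \<omega> (Z i) *\<^sub>C X i) \<le> r + e / 2"
      using assms[OF \<omega>] unital_star_hom_contractive[OF s, of "t - ?d"] d by linarith
  qed
  then show "norm t \<le> r + e"
    using d norm_triangle_sub[of t ?d] by linarith
qed

text \<open>
  If \<open>t\<close> is close to \<open>\<Sum> X\<^sub>i \<otimes> Z\<^sub>i\<close> and has scalar slices, then it is also close to
  \<open>1 \<otimes> (\<Sum> \<phi>(X\<^sub>i) Z\<^sub>i)\<close> for a functional \<open>\<phi>\<close> of norm at most 2 with \<open>\<phi>(1) = 1\<close>.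
\<close>

lemma scalar_slices_in_range:
  assumes sc: "\<And>\<omega>. \<omega> \<in> characters \<Longrightarrow> slice \<omega> t \<in> scalars"
  shows "t \<in> range (tens 1)"
proof -
  have "closed (range (tens 1))"
    by (rule closed_isometric_image) (simp_all add: linear_tens_right norm_tens)
  moreover have "t \<in> closure (range (tens 1))"
    unfolding closure_approachable
  proof (intro allI impI)
    fix e :: real assume "e > 0"
    then obtain n :: nat and X Z where d: "norm (t - (\<Sum>i<n. tens (X i) (Z i))) < e / 3"
      by (rule tens_approx[of "e / 3" t, OF divide_pos_pos]) simp_all
    let ?d = "\<Sum>i<n. tens (X i) (Z i)"
    \<comment> \<open>The functional depends only on the \<open>X i\<close> and not on the
      character, so the element \<open>z\<close> built from it serves all characters at
      once.\<close>
    obtain \<phi> :: "'a \<Rightarrow> complex" where \<phi>: "\<And>x y. \<phi> (x + y) = \<phi> x + \<phi> y" "\<And>c x. \<phi> (c *\<^sub>C x) = c * \<phi> x"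
      "\<phi> 1 = 1"
      and \<phi>_le: "\<And>d c. norm (\<phi> (d *\<^sub>C 1 + (\<Sum>i<n. c i *\<^sub>C X i))) \<le> 2 * norm (d *\<^sub>C 1 + (\<Sum>i<n. c i *\<^sub>C X i))"
    proof (rule complex_functional_finite[where n = n and X = X], goal_cases)
      case (1 \<phi>)
      show ?case by (rule 1(1)) (fact 1)+
    qed
    have \<phi>_sum: "\<phi> (\<Sum>i\<in>I. f i) = (\<Sum>i\<in>I. \<phi> (f i))" for I :: "nat set" and f
      using \<phi>(2)[of 0 0] by (induction I rule: infinite_finite_induct) (simp_all add: \<phi>(1))
    define z where "z = (\<Sum>i<n. \<phi> (X i) *\<^sub>C Z i)"
    have "norm (t - tens 1 z) \<le> 2 * (e / 3)"
    proof (rule norm_le_slices)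
      fix \<omega> :: "'z \<Rightarrow> complex" assume \<omega>: "\<omega> \<in> characters"
      note s = slice(1)[OF \<omega>]
      have h\<omega>: "unital_star_hom \<omega>" using \<omega> unfolding characters_def by simp
      obtain c where c: "slice \<omega> t = c *\<^sub>C 1" using sc[OF \<omega>] by (rule scalarsE)
      \<comment> \<open>The slice of \<open>t - ?d\<close>, written as a combination of 1 and the
        \<open>X i\<close>, to which the bound on \<phi> applies. Its image under \<phi> is
        \<open>c - \<omega> z\<close>, because \<phi> maps 1 to 1.\<close>
      let ?y = "c *\<^sub>C 1 + (\<Sum>i<n. (- \<omega> (Z i)) *\<^sub>C X i)"
      have y: "slice \<omega> (t - ?d) = ?y"
        by (simp add: unital_star_hom_diff[OF s] unital_star_hom_sum[OF s] slice(2)[OF \<omega>] c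
            scaleC_minus_left sum_negf)
      have "slice \<omega> (t - tens 1 z) = (c - \<omega> z) *\<^sub>C 1"
        by (simp add: unital_star_hom_diff[OF s] slice(2)[OF \<omega>] c
            scaleC_diff_left)
      also have "c - \<omega> z = \<phi> ?y"
        unfolding z_def \<phi>(1) \<phi>_sum \<phi>(2)
        by (simp add: \<phi>(3) unital_star_hom_sum[OF h\<omega>] unital_star_homD[OF h\<omega>] scaleC_complex_def
            sum_negf mult.commute)
      finally have "norm (slice \<omega> (t - tens 1 z)) = norm (\<phi> ?y)" by (simp add: norm_scaleC)
      also have "\<dots> \<le> 2 * norm ?y" by (rule \<phi>_le)
      also have "\<dots> \<le> 2 * (e / 3)"
        using unital_star_hom_contractive[OF s, of "t - ?d"] d y by simp
      finally show "norm (slice \<omega> (t - tens 1 z)) \<le> 2 * (e / 3)" .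
    qed
    with \<open>e > 0\<close> have "dist (tens 1 z) t < e"
      unfolding dist_norm norm_minus_commute[of "tens 1 z"] by linarith
    then show "\<exists>y\<in>range (tens 1). dist y t < e" by blast
  qed
  ultimately show ?thesis by (simp add: closure_closed)
qed

text \<open>A slice of a central element commutes with every \<open>a\<close>, since
  \<open>a\<close> is the slice of \<open>tens a 1\<close>. Hence all slices of central elements are
  scalars, and such elements lie in the second factor.\<close>

lemma center_tensor:
  assumes "(center :: 'a set) = scalars"
  shows "(center :: 't set) = range (tens 1)"
proof
  show "(center :: 't set) \<subseteq> range (tens 1)"
  proof
    fix t :: 't assume t: "t \<in> center"
    have "slice \<omega> t \<in> center" if "\<omega> \<in> characters" for \<omega>
    proof -
      have "slice \<omega> (t * tens a 1) = slice \<omega> (tens a 1 * t)" for a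
        using t unfolding center_def by simp
      then have "slice \<omega> t * a = a * slice \<omega> t" for a
        by (simp add: unital_star_homD(3)[OF slice(1)[OF that]] slice_one[OF that])
      then show ?thesis unfolding center_def by blast
    qed
    then show "t \<in> range (tens 1)"
      using assms by (intro scalar_slices_in_range) blast
  qed
  show "range (tens 1) \<subseteq> (center :: 't set)"
  proof
    fix t assume "t \<in> range (tens 1)"
    then obtain z where z: "t = tens 1 z" by blast
    have "(\<lambda>x. t * x) = (\<lambda>x. x * t)"
      by (rule bounded_linear_eqI[OF bounded_linear_mult_right bounded_linear_mult_left])
        (simp add: z tens_mult mult.commute[of z])
    then show "t \<in> center" unfolding center_def by (simp add: fun_eq_iff)
  qed
qed

end

section \<open>Intertwiners\<close>

text \<open>
  \<open>r - a\<^sup>2\<close> is \<open>r\<close> times the square of the imaginary part of a unitary with real part \<open>a / \<surd>r\<close>.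
\<close>

lemma norm_diff_square_le:
  fixes a :: "'a::cstar_algebra"
  assumes a: "a\<^sup>\<star> = a" and r: "norm (a * a) < r"
  shows "norm (r *\<^sub>R 1 - a * a) \<le> r"
proof -
  have r0: "r > 0" using r norm_ge_zero[of "a * a"] by linarith
  define h where "h = (1 / sqrt r) *\<^sub>R a"
  have hh: "h * h = (1 / r) *\<^sub>R (a * a)" unfolding h_def using r0 by simp
  have h: "h\<^sup>\<star> = h" unfolding h_def by (simp add: star_scaleR a)
  have "norm (h * h) < 1" unfolding hh using r r0 by simp
  then obtain k where k: "k * k = 1 - h * h" "unitary (h + \<i> *\<^sub>C k)" "(h + \<i> *\<^sub>C k)\<^sup>\<star> = h - \<i> *\<^sub>C k"
    using unitary_with_real_part[OF h] by metis
  define u where "u = h + \<i> *\<^sub>C k"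
  have us: "u\<^sup>\<star> = h - \<i> *\<^sub>C k" unfolding u_def by (rule k(3))
  have n: "norm u = 1" "norm (u\<^sup>\<star>) = 1" using norm_unitary[OF k(2)] unfolding u_def by simp_all
  have "(2 * \<i>) *\<^sub>C k = u - u\<^sup>\<star>"
    unfolding us unfolding u_def by (simp flip: scaleC_add_left)
  then have "2 * norm k \<le> 2"
    using norm_triangle_ineq4[of u "u\<^sup>\<star>"] n norm_scaleC[of "2 * \<i>" k] by (simp add: norm_mult)
  then have "norm (k * k) \<le> 1"
    using norm_mult_ineq[of k k] mult_le_one[of "norm k" "norm k"] by simp
  moreover have "r *\<^sub>R 1 - a * a = r *\<^sub>R (k * k)"
    unfolding k(1) hh using r0 by (simp add: scaleR_diff_right)
  ultimately show ?thesis using r0 by (simp add: mult_left_le)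
qed

text \<open>
  If \<open>x\<^sup>\<star> x = - 1\<close>, then \<open>p = x x\<^sup>\<star>\<close> satisfies \<open>p\<^sup>2 = - p\<close>, and \<open>2 (x\<^sup>\<star> x + x x\<^sup>\<star>) = h\<^sup>2 + k\<^sup>2\<close> with \<open>h\<close>, \<open>k\<close>
  self-adjoint. Hence \<open>h\<^sup>2 + k\<^sup>2 + 2 p\<^sup>2 + 2 = 0\<close>, which contradicts \<open>norm_diff_square_le\<close>.
\<close>

lemma star_mult_self_neq_minus_one:
  fixes x :: "'a::cstar_algebra"
  shows "x\<^sup>\<star> * x \<noteq> - 1"
proof
  assume x: "x\<^sup>\<star> * x = - 1"
  define h where "h = x + x\<^sup>\<star>"
  define k where "k = \<i> *\<^sub>C (x - x\<^sup>\<star>)"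
  define p where "p = x * x\<^sup>\<star>"
  have sa: "h\<^sup>\<star> = h" "k\<^sup>\<star> = k" "p\<^sup>\<star> = p"
    unfolding h_def k_def p_def
    by (simp_all add: star_add star_diff star_scaleC star_mult star_star add.commute scaleC_minus_left
        scaleC_diff_right)
  have pp: "p * p = - p"
  proof -
    have "p * p = x * (x\<^sup>\<star> * x) * x\<^sup>\<star>" by (simp only: p_def mult.assoc)
    then show ?thesis unfolding x p_def by simp
  qed
  have "k * k = - ((x - x\<^sup>\<star>) * (x - x\<^sup>\<star>))"
    unfolding k_def by (simp add: mult_scaleC_left mult_scaleC_right scaleC_scaleC scaleC_minus_one)
  then have "h * h + k * k = x * x\<^sup>\<star> + x * x\<^sup>\<star> + (x\<^sup>\<star> * x + x\<^sup>\<star> * x)"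
    unfolding h_def by (simp add: algebra_simps)
  then have sum0: "h * h + k * k + (p * p + p * p) + 2 = 0"
    unfolding pp x by (simp add: p_def)
  \<comment> \<open>The summand 1 provides the strict inequality that
    \<open>norm_diff_square_le\<close> asks for.\<close>
  define r where "r a = norm (a * a) + 1" for a :: 'a
  have "norm (r a *\<^sub>R 1 - a * a) \<le> r a" if "a\<^sup>\<star> = a" for a
    using norm_diff_square_le[OF that] unfolding r_def by simp
  note le = this[OF sa(1)] this[OF sa(2)] this[OF sa(3)]
  let ?s = "r h + r k + r p + r p"
  have "h * h + k * k + (p * p + p * p) = - 2"
    using sum0 by (simp only: eq_neg_iff_add_eq_0)
  \<comment> \<open>The scalar \<open>?s + 2\<close> is a sum of four elements whose norms are
    bounded by \<open>r h\<close>, \<open>r k\<close>, \<open>r p\<close> and \<open>r p\<close>,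
    but these bounds add up to \<open>?s\<close> only.\<close>
  then have "of_real (?s + 2) = of_real ?s - (h * h + k * k + (p * p + p * p))"
    by simp
  also have "\<dots> = (r h *\<^sub>R 1 - h * h) + (r k *\<^sub>R 1 - k * k) + (r p *\<^sub>R 1 - p * p) + (r p *\<^sub>R 1 - p * p)"
    unfolding of_real_def scaleR_add_left by (simp add: algebra_simps)
  also have "norm \<dots> \<le> ?s"
    using le by (intro norm_triangle_le add_mono) auto
  finally have "\<bar>?s + 2\<bar> \<le> ?s" by (simp only: norm_of_real)
  then show False by simp
qed

text \<open>Self-adjointness makes the scalar real and the C*-identity gives its modulus. A negative
  scalar could be rescaled to -1, which \<open>star_mult_self_neq_minus_one\<close>
  excludes.\<close>

lemma star_mult_self_scalar:
  fixes x :: "'a::cstar_algebra"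
  assumes "x\<^sup>\<star> * x \<in> scalars"
  shows "x\<^sup>\<star> * x = (norm x)\<^sup>2 *\<^sub>R 1"
proof -
  obtain c where c: "x\<^sup>\<star> * x = c *\<^sub>C 1" using assms by (rule scalarsE)
  have "cnj c *\<^sub>C 1 = (c *\<^sub>C 1 :: 'a)"
    using c star_mult[of "x\<^sup>\<star>" x] star_scaleC[of c "1 :: 'a"] by (simp add: star_star)
  then have "cnj c = c"
    using scaleC_eq_0_iff[of "cnj c - c" "1 :: 'a"] by (simp add: scaleC_diff_left)
  then obtain r where r: "c = complex_of_real r"
    by (metis Reals_cnj_iff Reals_cases)
  have n: "\<bar>r\<bar> = (norm x)\<^sup>2"
    using cstar_identity[of x] unfolding c r by (simp add: norm_scaleC)
  have "r \<ge> 0"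
  proof (rule ccontr)
    assume "\<not> r \<ge> 0"
    then have neg: "r < 0" by simp
    define y where "y = (1 / sqrt (- r)) *\<^sub>R x"
    have "y\<^sup>\<star> * y = (1 / (- r)) *\<^sub>R (x\<^sup>\<star> * x)"
      unfolding y_def using neg by (simp add: star_scaleR)
    also have "\<dots> = - 1" unfolding c r scaleC_of_real using neg by simp
    finally show False using star_mult_self_neq_minus_one by blast
  qed
  with n show ?thesis unfolding c r scaleC_of_real by simp
qed

lemma intertwinersD: "X \<in> intertwiners \<sigma> \<tau> \<Longrightarrow> X * \<sigma> b = \<tau> b * X"
  unfolding intertwiners_def by blast

lemma intertwinersI: "(\<And>b. X * \<sigma> b = \<tau> b * X) \<Longrightarrow> X \<in> intertwiners \<sigma> \<tau>"
  unfolding intertwiners_def by blast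

lemma intertwiners_one: "1 \<in> intertwiners \<sigma> \<sigma>"
  by (rule intertwinersI) simp

lemma intertwiners_mult:
  assumes "X \<in> intertwiners \<sigma> \<tau>" "Y \<in> intertwiners \<tau> \<upsilon>"
  shows "Y * X \<in> intertwiners \<sigma> \<upsilon>"
proof (rule intertwinersI)
  fix b
  have "Y * X * \<sigma> b = (Y * \<tau> b) * X" using intertwinersD[OF assms(1), of b] by (simp add: mult.assoc)
  then show "Y * X * \<sigma> b = \<upsilon> b * (Y * X)"
    using intertwinersD[OF assms(2), of b] by (simp add: mult.assoc)
qed

lemma csubspace_intertwiners: "csubspace (intertwiners \<sigma> \<tau>)"
  by (rule module.subspaceI[OF module_scaleC])
    (auto simp: intertwiners_def distrib_left distrib_right mult_scaleC_left mult_scaleC_right)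

lemma intertwiners_scaleC: "X \<in> intertwiners \<sigma> \<tau> \<Longrightarrow> c *\<^sub>C X \<in> intertwiners \<sigma> \<tau>"
  using csubspace_intertwiners by (rule module.subspace_scale[OF module_scaleC])

lemma intertwiners_scaleR: "X \<in> intertwiners \<sigma> \<tau> \<Longrightarrow> r *\<^sub>R X \<in> intertwiners \<sigma> \<tau>"
  using intertwiners_scaleC[of X \<sigma> \<tau> "complex_of_real r"] by (simp add: scaleC_of_real)

lemma intertwiners_star:
  assumes "unital_star_hom \<sigma>" "unital_star_hom \<tau>" "X \<in> intertwiners \<sigma> \<tau>"
  shows "X\<^sup>\<star> \<in> intertwiners \<tau> \<sigma>"
proof (rule intertwinersI)
  fix b
  have "(X * \<sigma> (b\<^sup>\<star>))\<^sup>\<star> = (\<tau> (b\<^sup>\<star>) * X)\<^sup>\<star>" using intertwinersD[OF assms(3)] by simp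
  then show "X\<^sup>\<star> * \<tau> b = \<sigma> b * X\<^sup>\<star>"
    by (simp add: star_mult star_star unital_star_homD(5)[OF assms(1)] unital_star_homD(5)[OF assms(2)])
qed

lemma intertwiners_tensor:
  assumes "unital_star_hom \<sigma>" "X \<in> intertwiners \<sigma> \<sigma>'" "Y \<in> intertwiners \<tau> \<tau>'"
  shows "X * \<sigma> Y \<in> intertwiners (\<sigma> \<circ> \<tau>) (\<sigma>' \<circ> \<tau>')"
proof (rule intertwinersI)
  fix b
  have "X * \<sigma> Y * \<sigma> (\<tau> b) = X * \<sigma> (\<tau>' b * Y)"
    using intertwinersD[OF assms(3), of b] by (simp add: mult.assoc flip: unital_star_homD(3)[OF assms(1)])
  also have "\<dots> = X * \<sigma> (\<tau>' b) * \<sigma> Y"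
    by (simp add: unital_star_homD(3)[OF assms(1)] mult.assoc)
  also have "\<dots> = \<sigma>' (\<tau>' b) * (X * \<sigma> Y)"
    by (simp only: intertwinersD[OF assms(2)] mult.assoc)
  finally show "X * \<sigma> Y * (\<sigma> \<circ> \<tau>) b = (\<sigma>' \<circ> \<tau>') b * (X * \<sigma> Y)" by simp
qed

lemma closed_intertwiners: "closed (intertwiners \<sigma> \<tau>)"
proof -
  have "intertwiners \<sigma> \<tau> = (\<Inter>b. {X. X * \<sigma> b = \<tau> b * X})" unfolding intertwiners_def by blast
  moreover have "closed {X. X * \<sigma> b = \<tau> b * X}" for b
    by (intro closed_Collect_eq continuous_intros)
  ultimately show ?thesis by (simp only:) (intro closed_INT ballI)
qed

lemma irreducible_endoD: "irreducible_endo \<rho> \<Longrightarrow> X \<in> intertwiners \<rho> \<rho> \<Longrightarrow> X \<in> scalars"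
  unfolding irreducible_endo_def by blast

lemma schur_star_mult_self:
  assumes "unital_star_hom \<rho>" "unital_star_hom \<sigma>" "irreducible_endo \<rho>" "X \<in> intertwiners \<rho> \<sigma>"
  shows "X\<^sup>\<star> * X = (norm X)\<^sup>2 *\<^sub>R 1"
  using intertwiners_mult[OF assms(4) intertwiners_star[OF assms(1,2,4)]] assms(3)
  by (intro star_mult_self_scalar irreducible_endoD)

lemma schur_isometry:
  assumes "unital_star_hom \<rho>" "unital_star_hom \<sigma>" "irreducible_endo \<rho>" "X \<in> intertwiners \<rho> \<sigma>" "X \<noteq> 0"
  shows "isometry ((1 / norm X) *\<^sub>R X)"
  using schur_star_mult_self[OF assms(1-4)] assms(5)
  by (simp add: isometry_def star_scaleR power2_eq_square)

text \<open>Irreducibility of \<rho> makes \<open>X\<^sup>\<star> * X\<close> a scalar and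
  irreducibility of \<sigma> makes \<open>X * X\<^sup>\<star>\<close> one. The two scalars agree
  because \<open>X\<close> and its star have the same norm.\<close>

lemma schur_unitary:
  assumes "unital_star_hom \<rho>" "unital_star_hom \<sigma>" "irreducible_endo \<rho>" "irreducible_endo \<sigma>"
    "X \<in> intertwiners \<rho> \<sigma>" "X \<noteq> 0"
  shows "unitary ((1 / norm X) *\<^sub>R X)" "equivalent_endo \<rho> \<sigma>"
proof -
  have "X * X\<^sup>\<star> = (norm X)\<^sup>2 *\<^sub>R 1"
    using schur_star_mult_self[OF assms(2,1,4) intertwiners_star[OF assms(1,2,5)]] by (simp add: star_star)
  then show *: "unitary ((1 / norm X) *\<^sub>R X)"
    using schur_star_mult_self[OF assms(1-3,5)] assms(6)
    by (simp add: unitary_def star_scaleR power2_eq_square)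
  show "equivalent_endo \<rho> \<sigma>"
    unfolding equivalent_endo_def using * assms(5) intertwiners_scaleR by blast
qed

lemma equivalent_endo_refl: "equivalent_endo \<rho> \<rho>"
  unfolding equivalent_endo_def using intertwiners_one by (intro bexI[of _ 1]) (auto simp: unitary_def)

lemma equivalent_endo_sym:
  "unital_star_hom \<rho> \<Longrightarrow> unital_star_hom \<sigma> \<Longrightarrow> equivalent_endo \<rho> \<sigma> \<Longrightarrow> equivalent_endo \<sigma> \<rho>"
  unfolding equivalent_endo_def unitary_def using intertwiners_star by (metis star_star)

lemma unitary_mult: "unitary U \<Longrightarrow> unitary V \<Longrightarrow> unitary (V * U)"
proof -
  assume *: "unitary U" "unitary V"
  have "(V * U)\<^sup>\<star> * (V * U) = U\<^sup>\<star> * (V\<^sup>\<star> * V) * U" "(V * U) * (V * U)\<^sup>\<star> = V * (U * U\<^sup>\<star>) * V\<^sup>\<star>"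
    by (simp_all only: star_mult mult.assoc)
  with * show "unitary (V * U)" by (simp add: unitary_def)
qed

lemma equivalent_endo_trans: "equivalent_endo \<rho> \<sigma> \<Longrightarrow> equivalent_endo \<sigma> \<tau> \<Longrightarrow> equivalent_endo \<rho> \<tau>"
  unfolding equivalent_endo_def using intertwiners_mult unitary_mult by metis

section \<open>Decompositions into irreducibles\<close>

text \<open>
  A frame of \<open>\<sigma>\<close> is an orthonormal family of isometries \<open>V\<close> with irreducible components
  \<open>V\<^sup>\<star> \<sigma>(\<cdot>) V\<close>; in contrast to \<open>irreducible_decomposition\<close>, equivalent components may be distinct.
\<close>

definition component :: "('a::cstar_algebra \<Rightarrow> 'a) \<Rightarrow> 'a \<Rightarrow> 'a \<Rightarrow> 'a" where
  "component \<sigma> V = (\<lambda>x. V\<^sup>\<star> * \<sigma> x * V)"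

text \<open>For two or more elements these are the relations of the generators of a Cuntz
  algebra.\<close>

definition orthonormal :: "'a::cstar_algebra set \<Rightarrow> bool" where
  "orthonormal Q \<longleftrightarrow> finite Q \<and> (\<forall>V\<in>Q. \<forall>W\<in>Q. V\<^sup>\<star> * W = (if V = W then 1 else 0)) \<and> (\<Sum>V\<in>Q. V * V\<^sup>\<star>) = 1"

definition frame :: "('a::cstar_algebra \<Rightarrow> 'a) set \<Rightarrow> ('a \<Rightarrow> 'a) \<Rightarrow> 'a set \<Rightarrow> bool" where
  "frame Obj \<sigma> Q \<longleftrightarrow> orthonormal Q \<and>
     (\<forall>V\<in>Q. component \<sigma> V \<in> Obj \<and> irreducible_endo (component \<sigma> V) \<and> V \<in> intertwiners (component \<sigma> V) \<sigma>)"

lemma orthonormalD: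
  assumes "orthonormal Q"
  shows "finite Q" "V \<in> Q \<Longrightarrow> W \<in> Q \<Longrightarrow> V\<^sup>\<star> * W = (if V = W then 1 else 0)" "(\<Sum>V\<in>Q. V * V\<^sup>\<star>) = 1"
  using assms unfolding orthonormal_def by blast+

lemma frameD:
  assumes "frame Obj \<sigma> Q"
  shows "orthonormal Q" "V \<in> Q \<Longrightarrow> component \<sigma> V \<in> Obj" "V \<in> Q \<Longrightarrow> irreducible_endo (component \<sigma> V)"
    "V \<in> Q \<Longrightarrow> V \<in> intertwiners (component \<sigma> V) \<sigma>"
  using assms unfolding frame_def by blast+

lemma component_eq:
  assumes "isometry V" "V \<in> intertwiners \<rho> \<sigma>"
  shows "component \<sigma> V = \<rho>"
proof
  fix x
  have "V\<^sup>\<star> * \<sigma> x * V = (V\<^sup>\<star> * V) * \<rho> x"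
    by (simp add: mult.assoc intertwinersD[OF assms(2)])
  then show "component \<sigma> V x = \<rho> x"
    using assms(1) by (simp add: component_def isometry_def)
qed

lemma orthonormal_sum_left: "orthonormal Q \<Longrightarrow> x = (\<Sum>V\<in>Q. V * V\<^sup>\<star> * x)"
  using orthonormalD(3)[of Q] by (simp flip: sum_distrib_right)

lemma orthonormal_sum_right: "orthonormal Q \<Longrightarrow> x = (\<Sum>V\<in>Q. x * (V * V\<^sup>\<star>))"
  using orthonormalD(3)[of Q] by (simp flip: sum_distrib_left)

lemma star_hom_direct_sum:
  fixes \<phi> :: "'a::cstar_algebra \<Rightarrow> 'b::cstar_algebra \<Rightarrow> 'a"
  assumes Q: "orthonormal Q" and \<phi>: "\<And>V. V \<in> Q \<Longrightarrow> unital_star_hom (\<phi> V)"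
  shows "unital_star_hom (\<lambda>x. \<Sum>V\<in>Q. V * \<phi> V x * V\<^sup>\<star>)"
  unfolding unital_star_hom_def
proof (intro conjI allI)
  fix x y :: 'b and c
  note D = unital_star_homD[OF \<phi>]
  show "(\<Sum>V\<in>Q. V * \<phi> V (x + y) * V\<^sup>\<star>) = (\<Sum>V\<in>Q. V * \<phi> V x * V\<^sup>\<star>) + (\<Sum>V\<in>Q. V * \<phi> V y * V\<^sup>\<star>)"
    by (simp add: D distrib_left distrib_right sum.distrib)
  show "(\<Sum>V\<in>Q. V * \<phi> V (c *\<^sub>C x) * V\<^sup>\<star>) = c *\<^sub>C (\<Sum>V\<in>Q. V * \<phi> V x * V\<^sup>\<star>)"
    by (simp add: D mult_scaleC_left mult_scaleC_right scaleC_sum_right)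
  show "(\<Sum>V\<in>Q. V * \<phi> V (x\<^sup>\<star>) * V\<^sup>\<star>) = (\<Sum>V\<in>Q. V * \<phi> V x * V\<^sup>\<star>)\<^sup>\<star>"
    by (simp add: D star_sum star_mult star_star mult.assoc)
  show "(\<Sum>V\<in>Q. V * \<phi> V 1 * V\<^sup>\<star>) = 1"
    using orthonormalD(3)[OF Q] by (simp add: D)
  have "(V * \<phi> V x * V\<^sup>\<star>) * (W * \<phi> W y * W\<^sup>\<star>) = (if V = W then V * \<phi> V (x * y) * V\<^sup>\<star> else 0)"
    if "V \<in> Q" "W \<in> Q" for V W
  proof -
    have "(V * \<phi> V x * V\<^sup>\<star>) * (W * \<phi> W y * W\<^sup>\<star>) = V * \<phi> V x * (V\<^sup>\<star> * W) * \<phi> W y * W\<^sup>\<star>"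
      by (simp add: mult.assoc)
    then show ?thesis
      unfolding orthonormalD(2)[OF Q that] using that by (simp add: D mult.assoc)
  qed
  then show "(\<Sum>V\<in>Q. V * \<phi> V (x * y) * V\<^sup>\<star>) = (\<Sum>V\<in>Q. V * \<phi> V x * V\<^sup>\<star>) * (\<Sum>V\<in>Q. V * \<phi> V y * V\<^sup>\<star>)"
    using orthonormalD(1)[OF Q] by (simp add: sum_product sum.delta')
qed

text \<open>For reducible objects \<open>tilde\<close> selects some irreducible decomposition, so
  one has to exist. In each equivalence class of components of the frame one representative is
  fixed, and every \<open>V\<close> is transported to it by a unitary.\<close>

lemma frame_irreducible_decomposition:
  assumes hom: "\<And>\<rho>. \<rho> \<in> Obj \<Longrightarrow> unital_star_hom \<rho>" and \<sigma>: "unital_star_hom \<sigma>"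
    and Q: "frame Obj \<sigma> Q"
  obtains S B where "irreducible_decomposition Obj \<sigma> S B"
proof -
  note Qo = frameD(1)[OF Q] and Qf = frameD(2-4)[OF Q]
  define c where "c = component \<sigma>"
  have Q': "c V \<in> Obj" "irreducible_endo (c V)" "V \<in> intertwiners (c V) \<sigma>" "unital_star_hom (c V)"
    if "V \<in> Q" for V
    using Qf[OF that] hom unfolding c_def by blast+
  \<comment> \<open>On components, the predicate under \<open>SOME\<close> is the same for
    equivalent arguments, so the chosen representative depends on the equivalence class
    only.\<close>
  define r where "r \<rho> = (SOME \<rho>'. \<rho>' \<in> c ` Q \<and> equivalent_endo \<rho>' \<rho>)" for \<rho>
  have r: "r \<rho> \<in> c ` Q" "equivalent_endo (r \<rho>) \<rho>" if "\<rho> \<in> c ` Q" for \<rho>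
    using someI[of "\<lambda>\<rho>'. \<rho>' \<in> c ` Q \<and> equivalent_endo \<rho>' \<rho>" \<rho>] that equivalent_endo_refl
    unfolding r_def by blast+
  have homc: "unital_star_hom \<rho>" "irreducible_endo \<rho>" "\<rho> \<in> Obj" if "\<rho> \<in> c ` Q" for \<rho>
    using Q' that by blast+
  have r_eq: "r \<rho> = r \<rho>'" if "equivalent_endo \<rho> \<rho>'" "\<rho> \<in> c ` Q" "\<rho>' \<in> c ` Q" for \<rho> \<rho>'
  proof -
    have s: "equivalent_endo \<rho>' \<rho>"
      by (rule equivalent_endo_sym[OF homc(1)[OF that(2)] homc(1)[OF that(3)] that(1)])
    have "\<kappa> \<in> c ` Q \<and> equivalent_endo \<kappa> \<rho> \<longleftrightarrow> \<kappa> \<in> c ` Q \<and> equivalent_endo \<kappa> \<rho>'" for \<kappa>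
      using equivalent_endo_trans[OF _ that(1)] equivalent_endo_trans[OF _ s] by blast
    then show ?thesis unfolding r_def by simp
  qed
  have "\<forall>V\<in>Q. \<exists>U. U \<in> intertwiners (r (c V)) (c V) \<and> unitary U"
    using r unfolding equivalent_endo_def by blast
  then obtain U where U: "\<And>V. V \<in> Q \<Longrightarrow> U V \<in> intertwiners (r (c V)) (c V)" "\<And>V. V \<in> Q \<Longrightarrow> unitary (U V)"
    by metis
  define S where "S = (\<lambda>V. r (c V)) ` Q"
  define B where "B \<rho> = (\<lambda>V. V * U V) ` {V \<in> Q. r (c V) = \<rho>}" for \<rho>
  have fin: "finite Q" using Qo by (rule orthonormalD)
  have orth: "(V * U V)\<^sup>\<star> * (W * U W) = (if V = W then 1 else 0)" if "V \<in> Q" "W \<in> Q" for V W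
  proof -
    have "(V * U V)\<^sup>\<star> * (W * U W) = (U V)\<^sup>\<star> * (V\<^sup>\<star> * W) * U W"
      by (simp add: star_mult mult.assoc)
    then show ?thesis
      unfolding orthonormalD(2)[OF Qo that] using U(2)[OF that(2)] by (simp add: unitary_def)
  qed
  have inj: "inj_on (\<lambda>V. V * U V) Q"
  proof (rule inj_onI)
    fix V W assume "V \<in> Q" "W \<in> Q" "V * U V = W * U W"
    then show "V = W" using orth[of V W] orth[of V V] by (auto split: if_splits)
  qed
  have Sc: "S \<subseteq> c ` Q" unfolding S_def using r(1) by blast
  have rr: "r \<rho> = \<rho>" if \<rho>S: "\<rho> \<in> S" for \<rho>
  proof -
    obtain V where V: "V \<in> Q" "\<rho> = r (c V)" using \<rho>S unfolding S_def by blast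
    have cV: "c V \<in> c ` Q" using V(1) by blast
    show ?thesis unfolding V(2) by (rule r_eq[OF r(2)[OF cV] r(1)[OF cV] cV])
  qed
  have "irreducible_decomposition Obj \<sigma> S B"
    unfolding irreducible_decomposition_def
  proof (intro conjI ballI impI allI)
    show "finite S" unfolding S_def using fin by simp
    show "S \<subseteq> Obj" using Sc homc(3) by blast
    show "irreducible_endo \<rho>" if "\<rho> \<in> S" for \<rho> using Sc homc(2) that by blast
    show "\<rho> = \<rho>'" if "\<rho> \<in> S" "\<rho>' \<in> S" "equivalent_endo \<rho> \<rho>'" for \<rho> \<rho>'
      using rr[OF that(1)] rr[OF that(2)] r_eq[OF that(3)] Sc that(1,2) by auto
    show "orthonormal_basis \<rho> \<sigma> (B \<rho>)" if \<rho>S: "\<rho> \<in> S" for \<rho>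
      unfolding orthonormal_basis_def
    proof (intro conjI ballI)
      have \<rho>: "unital_star_hom \<rho>" "irreducible_endo \<rho>" "\<rho> \<in> c ` Q" using Sc homc \<rho>S by blast+
      show "finite (B \<rho>)" unfolding B_def using fin by simp
      show "V\<^sup>\<star> * W = (if V = W then 1 else 0)" if VW: "V \<in> B \<rho>" "W \<in> B \<rho>" for V W
      proof -
        obtain V' W' where "V = V' * U V'" "W = W' * U W'" "V' \<in> Q" "W' \<in> Q"
          using VW unfolding B_def by blast
        then show ?thesis using orth[of V' W'] inj_onD[OF inj, of V' W'] by auto
      qed
      show "cspan (B \<rho>) = intertwiners \<rho> \<sigma>"
      proof
        have "B \<rho> \<subseteq> intertwiners \<rho> \<sigma>"
          unfolding B_def using U(1) Q'(3) intertwiners_mult by blast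
        then show "cspan (B \<rho>) \<subseteq> intertwiners \<rho> \<sigma>"
          using csubspace_intertwiners by (rule module.span_minimal[OF module_scaleC])
        show "intertwiners \<rho> \<sigma> \<subseteq> cspan (B \<rho>)"
        proof
          fix X assume X: "X \<in> intertwiners \<rho> \<sigma>"
          \<comment> \<open>By Schur's lemma this term of the expansion of \<open>X\<close> along
            the frame is a scalar multiple of \<open>V * U V\<close> if the component of
            \<open>V\<close> belongs to the class of \<rho>, and zero otherwise.\<close>
          have "V * V\<^sup>\<star> * X \<in> cspan (B \<rho>)" if V: "V \<in> Q" for V
          proof -
            have VX: "V\<^sup>\<star> * X \<in> intertwiners \<rho> (c V)"
              using intertwiners_star[OF Q'(4)[OF V] \<sigma> Q'(3)[OF V]] X by (rule intertwiners_mult[rotated])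
            show ?thesis
            proof (cases "r (c V) = \<rho>")
              case True
              then have UV: "U V \<in> intertwiners \<rho> (c V)" using U(1)[OF V] by simp
              have "(U V)\<^sup>\<star> * (V\<^sup>\<star> * X) \<in> scalars"
                using irreducible_endoD[OF \<rho>(2) intertwiners_mult[OF VX intertwiners_star[OF \<rho>(1) Q'(4)[OF V] UV]]] .
              then obtain k where "(U V)\<^sup>\<star> * (V\<^sup>\<star> * X) = k *\<^sub>C 1" by (rule scalarsE)
              then have "V * (U V * (U V)\<^sup>\<star>) * (V\<^sup>\<star> * X) = k *\<^sub>C (V * U V)"
                by (simp add: mult.assoc mult_scaleC_right)
              moreover have "U V * (U V)\<^sup>\<star> = 1" using U(2)[OF V] by (simp add: unitary_def)
              ultimately have "V * V\<^sup>\<star> * X = k *\<^sub>C (V * U V)"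
                by (simp add: mult.assoc)
              moreover have "V * U V \<in> B \<rho>" unfolding B_def using V True by blast
              ultimately show ?thesis
                by (simp add: module.span_scale[OF module_scaleC] module.span_base[OF module_scaleC])
            next
              case False
              have "V\<^sup>\<star> * X = 0"
              proof (rule ccontr)
                assume "V\<^sup>\<star> * X \<noteq> 0"
                then have "equivalent_endo \<rho> (c V)"
                  using schur_unitary(2)[OF \<rho>(1) Q'(4)[OF V] \<rho>(2) Q'(2)[OF V] VX] by blast
                then have "r \<rho> = r (c V)" using r_eq \<rho>(3) V by blast
                with False rr[OF \<rho>S] show False by simp
              qed
              then show ?thesis by (simp add: mult.assoc module.span_zero[OF module_scaleC])
            qed
          qed
          then have "(\<Sum>V\<in>Q. V * V\<^sup>\<star> * X) \<in> cspan (B \<rho>)"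
            by (rule module.span_sum[OF module_scaleC])
          then show "X \<in> cspan (B \<rho>)" using orthonormal_sum_left[OF Qo, of X] by simp
        qed
      qed
    qed
    show "\<sigma> x = (\<Sum>\<rho>\<in>S. \<Sum>W\<in>B \<rho>. W * \<rho> x * W\<^sup>\<star>)" for x
    proof -
      have "(\<Sum>W\<in>B \<rho>. W * \<rho> x * W\<^sup>\<star>) = (\<Sum>V\<in>{V \<in> Q. r (c V) = \<rho>}. \<sigma> x * (V * V\<^sup>\<star>))" for \<rho>
      proof -
        have "V * U V * \<rho> x * (V * U V)\<^sup>\<star> = \<sigma> x * (V * V\<^sup>\<star>)" if "V \<in> Q" "r (c V) = \<rho>" for V
        proof -
          have "V * U V * \<rho> x * (V * U V)\<^sup>\<star> = V * (U V * \<rho> x) * (U V)\<^sup>\<star> * V\<^sup>\<star>"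
            by (simp add: star_mult mult.assoc)
          also have "U V * \<rho> x = c V x * U V" using U(1)[OF that(1)] that(2) intertwinersD by blast
          also have "V * (c V x * U V) * (U V)\<^sup>\<star> * V\<^sup>\<star> = V * c V x * (U V * (U V)\<^sup>\<star>) * V\<^sup>\<star>"
            by (simp add: mult.assoc)
          also have "\<dots> = \<sigma> x * (V * V\<^sup>\<star>)"
            using U(2)[OF that(1)] intertwinersD[OF Q'(3)[OF that(1)], of x]
            by (simp add: unitary_def mult.assoc)
          finally show ?thesis .
        qed
        then show ?thesis
          unfolding B_def by (subst sum.reindex) (auto intro!: sum.cong inj_on_subset[OF inj])
      qed
      then have "(\<Sum>\<rho>\<in>S. \<Sum>W\<in>B \<rho>. W * \<rho> x * W\<^sup>\<star>) = (\<Sum>V\<in>Q. \<sigma> x * (V * V\<^sup>\<star>))"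
        using sum.group[of Q S "\<lambda>V. r (c V)" "\<lambda>V. \<sigma> x * (V * V\<^sup>\<star>)"] fin unfolding S_def by simp
      then show ?thesis using orthonormal_sum_right[OF Qo, of "\<sigma> x"] by simp
    qed
  qed
  then show thesis by (rule that)
qed

text \<open>Each basis element determines its \<rho> as its component, so the bases are disjoint.
  Elements of different bases are orthogonal by Schur's lemma, as their components are
  inequivalent.\<close>

lemma irreducible_decomposition_frame:
  assumes hom: "\<And>\<rho>. \<rho> \<in> Obj \<Longrightarrow> unital_star_hom \<rho>" and \<sigma>: "unital_star_hom \<sigma>"
    and D: "irreducible_decomposition Obj \<sigma> S B"
  shows "frame Obj \<sigma> (\<Union>\<rho>\<in>S. B \<rho>)" "\<And>\<rho> V. \<rho> \<in> S \<Longrightarrow> V \<in> B \<rho> \<Longrightarrow> component \<sigma> V = \<rho>"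
    "\<And>f. (\<Sum>\<rho>\<in>S. \<Sum>V\<in>B \<rho>. f V) = (\<Sum>V\<in>(\<Union>\<rho>\<in>S. B \<rho>). f V)"
proof -
  have fin: "finite S" and SO: "S \<subseteq> Obj" and irr: "\<And>\<rho>. \<rho> \<in> S \<Longrightarrow> irreducible_endo \<rho>"
    and ineq: "\<And>\<rho> \<rho>'. \<rho> \<in> S \<Longrightarrow> \<rho>' \<in> S \<Longrightarrow> equivalent_endo \<rho> \<rho>' \<Longrightarrow> \<rho> = \<rho>'"
    and onb: "\<And>\<rho>. \<rho> \<in> S \<Longrightarrow> orthonormal_basis \<rho> \<sigma> (B \<rho>)"
    and dec: "\<And>x. \<sigma> x = (\<Sum>\<rho>\<in>S. \<Sum>W\<in>B \<rho>. W * \<rho> x * W\<^sup>\<star>)"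
    using D by (simp_all add: irreducible_decomposition_def)
  have finB: "finite (B \<rho>)" if "\<rho> \<in> S" for \<rho>
    using onb[OF that] unfolding orthonormal_basis_def by blast
  have inter: "V \<in> intertwiners \<rho> \<sigma>" if "\<rho> \<in> S" "V \<in> B \<rho>" for \<rho> V
    using onb[OF that(1)] module.span_base[OF module_scaleC that(2)] unfolding orthonormal_basis_def by blast
  have orth: "V\<^sup>\<star> * W = (if V = W then 1 else 0)" if "\<rho> \<in> S" "V \<in> B \<rho>" "W \<in> B \<rho>" for \<rho> V W
    using onb[OF that(1)] that(2,3) unfolding orthonormal_basis_def by blast
  have iso: "isometry V" if "\<rho> \<in> S" "V \<in> B \<rho>" for \<rho> V
    using orth[OF that(1) that(2) that(2)] unfolding isometry_def by simp
  show comp: "component \<sigma> V = \<rho>" if "\<rho> \<in> S" "V \<in> B \<rho>" for \<rho> V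
    using component_eq[OF iso[OF that] inter[OF that]] .
  have disj: "B \<rho> \<inter> B \<rho>' = {}" if "\<rho> \<in> S" "\<rho>' \<in> S" "\<rho> \<noteq> \<rho>'" for \<rho> \<rho>'
  proof (rule equals0I)
    fix V assume "V \<in> B \<rho> \<inter> B \<rho>'"
    then have "component \<sigma> V = \<rho>" "component \<sigma> V = \<rho>'" using comp that by blast+
    with that show False by simp
  qed
  show sum: "(\<Sum>\<rho>\<in>S. \<Sum>V\<in>B \<rho>. f V) = (\<Sum>V\<in>(\<Union>\<rho>\<in>S. B \<rho>). f V)" for f
    by (rule sum.UNION_disjoint[symmetric]) (use fin finB disj in auto)
  show "frame Obj \<sigma> (\<Union>\<rho>\<in>S. B \<rho>)"
    unfolding frame_def orthonormal_def
  proof (intro conjI ballI)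
    show "finite (\<Union>\<rho>\<in>S. B \<rho>)" using fin finB by blast
    \<comment> \<open>Completeness is the decomposition formula evaluated at 1.\<close>
    have "1 = (\<Sum>\<rho>\<in>S. \<Sum>V\<in>B \<rho>. V * V\<^sup>\<star>)"
      using dec[of 1] SO hom unital_star_homD(4)[OF \<sigma>]
      by (simp add: unital_star_homD(4) subset_iff cong: sum.cong)
    then show "(\<Sum>V\<in>(\<Union>\<rho>\<in>S. B \<rho>). V * V\<^sup>\<star>) = 1" unfolding sum by simp
    fix V assume "V \<in> (\<Union>\<rho>\<in>S. B \<rho>)"
    then obtain \<rho> where \<rho>: "\<rho> \<in> S" "V \<in> B \<rho>" by blast
    show "component \<sigma> V \<in> Obj" "irreducible_endo (component \<sigma> V)" "V \<in> intertwiners (component \<sigma> V) \<sigma>"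
      unfolding comp[OF \<rho>] using \<rho> SO irr inter by blast+
    fix W assume "W \<in> (\<Union>\<rho>\<in>S. B \<rho>)"
    then obtain \<rho>' where \<rho>': "\<rho>' \<in> S" "W \<in> B \<rho>'" by blast
    show "V\<^sup>\<star> * W = (if V = W then 1 else 0)"
    proof (cases "\<rho> = \<rho>'")
      case True
      then show ?thesis using orth \<rho> \<rho>' by blast
    next
      case False
      have h: "unital_star_hom \<rho>" "unital_star_hom \<rho>'" using \<rho> \<rho>' SO hom by blast+
      have "V\<^sup>\<star> * W \<in> intertwiners \<rho>' \<rho>"
        using intertwiners_mult[OF inter[OF \<rho>'] intertwiners_star[OF h(1) \<sigma> inter[OF \<rho>]]] .
      moreover have "\<not> equivalent_endo \<rho>' \<rho>" using ineq[OF \<rho>'(1) \<rho>(1)] False by blast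
      ultimately have "V\<^sup>\<star> * W = 0"
        using schur_unitary(2)[OF h(2,1) irr[OF \<rho>'(1)] irr[OF \<rho>(1)]] by blast
      moreover have "V \<noteq> W" using disj[OF \<rho>(1) \<rho>'(1) False] \<rho>(2) \<rho>'(2) by blast
      ultimately show ?thesis by simp
    qed
  qed
qed

section \<open>The extended endomorphisms\<close>

text \<open>What the construction of the lifted endomorphisms takes from the duality: finite frames
  and a family \<beta> of automorphisms. The assumption \<open>\<beta>_comp\<close> expresses the
  homomorphism property on the chain group in terms of intertwiners alone, so neither the group nor
  its representations appear.\<close>

locale chain_data =
  tp: cstar_tensor_product tens + dr_category_with Obj intertwiners \<epsilon>
  for tens :: "'a::cstar_algebra \<Rightarrow> 'z::{cstar_algebra,comm_ring_1} \<Rightarrow> 't::cstar_algebra"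
    and Obj :: "('a \<Rightarrow> 'a) set" and \<epsilon> :: "('a \<Rightarrow> 'a) \<Rightarrow> ('a \<Rightarrow> 'a) \<Rightarrow> 'a" +
  fixes \<beta> :: "('a \<Rightarrow> 'a) \<Rightarrow> 'z \<Rightarrow> 'z"
  assumes trivial_center: "(center :: 'a set) = scalars"
    and frame_exists: "\<sigma> \<in> Obj \<Longrightarrow> \<exists>Q. frame Obj \<sigma> Q"
    and \<beta>_hom: "\<rho> \<in> Obj \<Longrightarrow> irreducible_endo \<rho> \<Longrightarrow> unital_star_hom (\<beta> \<rho>)"
    and \<beta>_bij: "\<rho> \<in> Obj \<Longrightarrow> irreducible_endo \<rho> \<Longrightarrow> bij (\<beta> \<rho>)"
    and \<beta>_comp: "\<rho> \<in> Obj \<Longrightarrow> \<rho>\<^sub>1 \<in> Obj \<Longrightarrow> \<rho>\<^sub>2 \<in> Obj \<Longrightarrow>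
      irreducible_endo \<rho> \<Longrightarrow> irreducible_endo \<rho>\<^sub>1 \<Longrightarrow> irreducible_endo \<rho>\<^sub>2 \<Longrightarrow>
      M \<in> intertwiners \<rho> (\<rho>\<^sub>1 \<circ> \<rho>\<^sub>2) \<Longrightarrow> M \<noteq> 0 \<Longrightarrow> \<beta> \<rho> = \<beta> \<rho>\<^sub>1 \<circ> \<beta> \<rho>\<^sub>2"
begin

abbreviation lift :: "('a \<Rightarrow> 'a) \<Rightarrow> 't \<Rightarrow> 't" where
  "lift \<equiv> tilde tens Obj \<beta>"

lemma irreducible_id: "irreducible_endo (id :: 'a \<Rightarrow> 'a)"
  using unit_irreducible unfolding irreducible_endo_def .

text \<open>Multiplicativity along \<open>1\<close>, viewed as an arrow from \<open>id\<close> to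
  \<open>id \<circ> id\<close>, makes \<open>\<beta> id\<close> idempotent, and an idempotent
  bijection is the identity.\<close>

lemma \<beta>_id: "\<beta> id = id"
proof -
  have "\<beta> id = \<beta> id \<circ> \<beta> id"
    by (rule \<beta>_comp[of id id id 1]) (auto simp: obj_id irreducible_id intertwiners_one)
  then show ?thesis
    using \<beta>_bij[OF obj_id irreducible_id] by (metis bij_is_inj comp_id fun.inj_map_strong inj_eq o_apply eq_id_iff)
qed

text \<open>The case of \<open>\<beta>_comp\<close> in which the second factor is \<open>id\<close>:
  equivalent irreducibles carry the same automorphism.\<close>

lemma \<beta>_eq:
  assumes "\<rho> \<in> Obj" "\<rho>' \<in> Obj" "irreducible_endo \<rho>" "irreducible_endo \<rho>'" "X \<in> intertwiners \<rho> \<rho>'" "X \<noteq> 0"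
  shows "\<beta> \<rho> = \<beta> \<rho>'"
  using \<beta>_comp[of \<rho> \<rho>' id X] assms by (simp add: obj_id irreducible_id \<beta>_id)

lemma frame_intertwiner:
  assumes "\<sigma> \<in> Obj" "\<tau> \<in> Obj" "frame Obj \<sigma> Q" "frame Obj \<tau> P" "V \<in> Q" "W \<in> P" "X \<in> intertwiners \<sigma> \<tau>"
  shows "W\<^sup>\<star> * X * V \<in> intertwiners (component \<sigma> V) (component \<tau> W)"
proof -
  note V = frameD[OF assms(3)] and W = frameD[OF assms(4)]
  show ?thesis
    using intertwiners_mult[OF intertwiners_mult[OF V(4)[OF assms(5)] assms(7)]
        intertwiners_star[OF obj_hom[OF W(2)[OF assms(6)]] obj_hom[OF assms(2)] W(4)[OF assms(6)]]]
    by (simp add: mult.assoc)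
qed

lemma frame_proj_commute:
  assumes "\<sigma> \<in> Obj" "frame Obj \<sigma> Q" "V \<in> Q"
  shows "V * V\<^sup>\<star> * \<sigma> a = \<sigma> a * (V * V\<^sup>\<star>)"
proof -
  note V = frameD(2,4)[OF assms(2,3)]
  have "V * V\<^sup>\<star> \<in> intertwiners \<sigma> \<sigma>"
    using intertwiners_mult[OF intertwiners_star[OF obj_hom[OF V(1)] obj_hom[OF assms(1)] V(2)] V(2)] .
  then show ?thesis by (rule intertwinersD)
qed

text \<open>For \<open>X = 1\<close> this is the independence of \<open>lift \<sigma>\<close> of the chosen frame.\<close>

lemma frame_sum_intertwiner:
  assumes \<sigma>: "\<sigma> \<in> Obj" and \<tau>: "\<tau> \<in> Obj" and Q: "frame Obj \<sigma> Q" and P: "frame Obj \<tau> P"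
    and X: "X \<in> intertwiners \<sigma> \<tau>"
  shows "(\<Sum>V\<in>Q. tens (X * \<sigma> a * (V * V\<^sup>\<star>)) (\<beta> (component \<sigma> V) z)) =
    (\<Sum>W\<in>P. tens (\<tau> a * (W * W\<^sup>\<star>) * X) (\<beta> (component \<tau> W) z))"
proof -
  have term_eq: "tens (W * W\<^sup>\<star> * (X * \<sigma> a * (V * V\<^sup>\<star>))) (\<beta> (component \<sigma> V) z) =
      tens (\<tau> a * (W * W\<^sup>\<star>) * X * (V * V\<^sup>\<star>)) (\<beta> (component \<tau> W) z)" if VW: "V \<in> Q" "W \<in> P" for V W
  proof -
    have "W * W\<^sup>\<star> * (X * \<sigma> a * (V * V\<^sup>\<star>)) = W * W\<^sup>\<star> * \<tau> a * X * (V * V\<^sup>\<star>)"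
      by (simp add: intertwinersD[OF X] mult.assoc)
    also have "\<dots> = \<tau> a * (W * W\<^sup>\<star>) * X * (V * V\<^sup>\<star>)"
      by (simp add: frame_proj_commute[OF \<tau> P VW(2)])
    finally have 1: "W * W\<^sup>\<star> * (X * \<sigma> a * (V * V\<^sup>\<star>)) = \<tau> a * (W * W\<^sup>\<star>) * X * (V * V\<^sup>\<star>)" .
    show ?thesis
    proof (cases "W\<^sup>\<star> * X * V = 0")
      case True
      have "\<tau> a * (W * W\<^sup>\<star>) * X * (V * V\<^sup>\<star>) = \<tau> a * W * (W\<^sup>\<star> * X * V) * V\<^sup>\<star>"
        by (simp only: mult.assoc)
      then show ?thesis unfolding 1 True by simp
    next
      case False
      have "\<beta> (component \<sigma> V) = \<beta> (component \<tau> W)"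
        using frameD(2,3)[OF Q VW(1)] frameD(2,3)[OF P VW(2)] frame_intertwiner[OF \<sigma> \<tau> Q P VW X] False
        by (intro \<beta>_eq)
      then show ?thesis unfolding 1 by simp
    qed
  qed
  have "(\<Sum>V\<in>Q. tens (X * \<sigma> a * (V * V\<^sup>\<star>)) (\<beta> (component \<sigma> V) z)) =
      (\<Sum>V\<in>Q. \<Sum>W\<in>P. tens (W * W\<^sup>\<star> * (X * \<sigma> a * (V * V\<^sup>\<star>))) (\<beta> (component \<sigma> V) z))"
    using orthonormal_sum_left[OF frameD(1)[OF P]] by (simp flip: tp.tens_sum_left)
  also have "\<dots> = (\<Sum>V\<in>Q. \<Sum>W\<in>P. tens (\<tau> a * (W * W\<^sup>\<star>) * X * (V * V\<^sup>\<star>)) (\<beta> (component \<tau> W) z))"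
    by (intro sum.cong refl term_eq)
  also have "\<dots> = (\<Sum>W\<in>P. \<Sum>V\<in>Q. tens (\<tau> a * (W * W\<^sup>\<star>) * X * (V * V\<^sup>\<star>)) (\<beta> (component \<tau> W) z))"
    by (rule sum.swap)
  also have "\<dots> = (\<Sum>W\<in>P. tens (\<tau> a * (W * W\<^sup>\<star>) * X) (\<beta> (component \<tau> W) z))"
    using orthonormal_sum_right[OF frameD(1)[OF Q]] by (simp flip: tp.tens_sum_left)
  finally show ?thesis .
qed

text \<open>Both branches of \<open>tilde\<close> are brought to one form. An irreducible object has
  the frame \<open>{1}\<close>; otherwise the selected decomposition is itself a frame. Later
  arguments use only the resulting formula on elementary tensors.\<close>

lemma lift_frame:
  assumes \<sigma>: "\<sigma> \<in> Obj"
  obtains Q where "frame Obj \<sigma> Q" "unital_star_hom (lift \<sigma>)"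
    "\<And>a z. lift \<sigma> (tens a z) = (\<Sum>V\<in>Q. tens (\<sigma> a * (V * V\<^sup>\<star>)) (\<beta> (component \<sigma> V) z))"
proof (cases "irreducible_endo \<sigma>")
  case True
  have c: "component \<sigma> 1 = \<sigma>" unfolding component_def by simp
  have "frame Obj \<sigma> {1}"
    unfolding frame_def orthonormal_def by (auto simp: c \<sigma> True intertwiners_one)
  moreover note tp.tensor_hom[OF obj_hom[OF \<sigma>] \<beta>_hom[OF \<sigma> True]]
  ultimately show thesis
    using that[of "{1}"] True unfolding tilde_def by (simp add: c)
next
  case False
  note h\<sigma> = obj_hom[OF \<sigma>]
  let ?\<Phi> = "\<lambda>S B x. \<Sum>\<rho>\<in>S. \<Sum>W\<in>B \<rho>. tens W 1 * tensor_hom tens \<rho> (\<beta> \<rho>) x * (tens W 1)\<^sup>\<star>"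
  obtain Q0 where "frame Obj \<sigma> Q0" using frame_exists[OF \<sigma>] by blast
  with obj_hom h\<sigma> obtain S0 B0 where "irreducible_decomposition Obj \<sigma> S0 B0"
    by (rule frame_irreducible_decomposition)
  then have "\<exists>\<Phi>. \<exists>S B. irreducible_decomposition Obj \<sigma> S B \<and> \<Phi> = ?\<Phi> S B" by blast
  from someI_ex[OF this] obtain S B where D: "irreducible_decomposition Obj \<sigma> S B" and l: "lift \<sigma> = ?\<Phi> S B"
    using False unfolding tilde_def by auto
  note F = irreducible_decomposition_frame[OF obj_hom h\<sigma> D]
  define Q where "Q = (\<Union>\<rho>\<in>S. B \<rho>)"
  have fr: "frame Obj \<sigma> Q" unfolding Q_def by (rule F(1))
  note o = orthonormalD[OF frameD(1)[OF fr]]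
  let ?h = "\<lambda>V. tensor_hom tens (component \<sigma> V) (\<beta> (component \<sigma> V))"
  have h: "unital_star_hom (?h V)" "?h V (tens a z) = tens (component \<sigma> V a) (\<beta> (component \<sigma> V) z)"
    if "V \<in> Q" for V a z
    using tp.tensor_hom[OF obj_hom \<beta>_hom] frameD(2,3)[OF fr that] by blast+
  have lQ: "lift \<sigma> = (\<lambda>x. \<Sum>V\<in>Q. tens V 1 * ?h V x * (tens V 1)\<^sup>\<star>)"
    unfolding l Q_def by (intro ext trans[OF _ F(3)] sum.cong refl) (simp add: F(2))
  have inj: "inj_on (\<lambda>V. tens V 1) Q" by (rule inj_onI) simp
  have "orthonormal ((\<lambda>V. tens V 1) ` Q)"
    unfolding orthonormal_def
    using o by (auto simp: sum.reindex[OF inj] tp.tens_star tp.tens_mult tp.tens_one simp flip: tp.tens_sum_left)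
  \<comment> \<open>In \<open>star_hom_direct_sum\<close> the homomorphisms are indexed by the
    isometries of the target algebra, here \<open>tens V 1\<close>, so \<open>V\<close> has to be
    recovered from \<open>tens V 1\<close>.\<close>
  moreover have "unital_star_hom (?h (the_inv_into Q (\<lambda>V. tens V 1) V))" if "V \<in> (\<lambda>V. tens V 1) ` Q" for V
    using h(1) that by (auto simp: the_inv_into_f_f[OF inj])
  ultimately have "unital_star_hom (\<lambda>x. \<Sum>V\<in>(\<lambda>V. tens V 1) ` Q. V * ?h (the_inv_into Q (\<lambda>V. tens V 1) V) x * V\<^sup>\<star>)"
    by (rule star_hom_direct_sum)
  then have "unital_star_hom (lift \<sigma>)"
    unfolding lQ by (simp add: sum.reindex[OF inj] the_inv_into_f_f[OF inj] cong: sum.cong)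
  moreover have "lift \<sigma> (tens a z) = (\<Sum>V\<in>Q. tens (\<sigma> a * (V * V\<^sup>\<star>)) (\<beta> (component \<sigma> V) z))" for a z
    unfolding lQ using intertwinersD[OF frameD(4)[OF fr]]
    by (intro sum.cong refl) (simp add: h(2) tp.tens_star tp.tens_mult flip: mult.assoc)
  ultimately show thesis using that fr by blast
qed

lemma lift_hom: "\<sigma> \<in> Obj \<Longrightarrow> unital_star_hom (lift \<sigma>)"
  by (rule lift_frame)

lemma lift_tens:
  assumes "\<sigma> \<in> Obj" "frame Obj \<sigma> P"
  shows "lift \<sigma> (tens a z) = (\<Sum>V\<in>P. tens (\<sigma> a * (V * V\<^sup>\<star>)) (\<beta> (component \<sigma> V) z))"
proof (rule lift_frame[OF assms(1)])
  fix Q assume Q: "frame Obj \<sigma> Q"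
    "\<And>a z. lift \<sigma> (tens a z) = (\<Sum>V\<in>Q. tens (\<sigma> a * (V * V\<^sup>\<star>)) (\<beta> (component \<sigma> V) z))"
  then show ?thesis
    using frame_sum_intertwiner[OF assms(1) assms(1) Q(1) assms(2) intertwiners_one] by simp
qed

text \<open>The automorphisms fix 1, so no twist is visible on \<open>tens a 1\<close>. For this
  reason the permutation and conjugation structures carry over without correction factors.\<close>

lemma lift_tens_one:
  assumes "\<sigma> \<in> Obj"
  shows "lift \<sigma> (tens a 1) = tens (\<sigma> a) 1"
proof -
  obtain Q where Q: "frame Obj \<sigma> Q" using frame_exists[OF assms] by blast
  have "lift \<sigma> (tens a 1) = (\<Sum>V\<in>Q. tens (\<sigma> a * (V * V\<^sup>\<star>)) 1)"
    unfolding lift_tens[OF assms Q]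
    using unital_star_homD(4)[OF \<beta>_hom] frameD(2,3)[OF Q] by (intro sum.cong refl) simp
  then show ?thesis
    using orthonormal_sum_right[OF frameD(1)[OF Q], of "\<sigma> a"] by (simp flip: tp.tens_sum_left)
qed

lemma lift_inj: "inj_on lift Obj"
proof (rule inj_onI)
  fix \<sigma> \<tau> assume "\<sigma> \<in> Obj" "\<tau> \<in> Obj" "lift \<sigma> = lift \<tau>"
  then have "tens (\<sigma> a) 1 = tens (\<tau> a) 1" for a using lift_tens_one by metis
  then show "\<sigma> = \<tau>" by auto
qed

lemma lift_intertwiner:
  assumes \<sigma>: "\<sigma> \<in> Obj" and \<tau>: "\<tau> \<in> Obj" and X: "X \<in> intertwiners \<sigma> \<tau>"
  shows "tens X 1 \<in> intertwiners (lift \<sigma>) (lift \<tau>)"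
proof -
  obtain Q P where Q: "frame Obj \<sigma> Q" and P: "frame Obj \<tau> P" using frame_exists \<sigma> \<tau> by metis
  have "(\<lambda>t. tens X 1 * lift \<sigma> t) = (\<lambda>t. lift \<tau> t * tens X 1)"
  proof (rule tp.bounded_linear_eqI)
    show "bounded_linear (\<lambda>t. tens X 1 * lift \<sigma> t)"
      by (rule bounded_linear_compose[OF bounded_linear_mult_right unital_star_hom_bounded_linear[OF lift_hom[OF \<sigma>]]])
    show "bounded_linear (\<lambda>t. lift \<tau> t * tens X 1)"
      by (rule bounded_linear_compose[OF bounded_linear_mult_left unital_star_hom_bounded_linear[OF lift_hom[OF \<tau>]]])
    show "tens X 1 * lift \<sigma> (tens a z) = lift \<tau> (tens a z) * tens X 1" for a z
      unfolding lift_tens[OF \<sigma> Q] lift_tens[OF \<tau> P]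
      using frame_sum_intertwiner[OF \<sigma> \<tau> Q P X]
      by (simp add: sum_distrib_left sum_distrib_right tp.tens_mult mult.assoc)
  qed
  then show ?thesis by (intro intertwinersI) (rule fun_cong)
qed

lemma lift_id: "lift id = id"
proof (rule tp.star_hom_eqI[OF lift_hom[OF obj_id] unital_star_hom_id])
  have c: "component id (1 :: 'a) = id" unfolding component_def by auto
  have "frame Obj id {1}"
    unfolding frame_def orthonormal_def by (auto simp: c obj_id irreducible_id intertwiners_one)
  from lift_tens[OF obj_id this] show "lift id (tens a z) = id (tens a z)" for a z
    by (simp add: c \<beta>_id)
qed

lemma lift_comp:
  assumes \<sigma>: "\<sigma> \<in> Obj" and \<tau>: "\<tau> \<in> Obj"
  shows "lift \<sigma> \<circ> lift \<tau> = lift (\<sigma> \<circ> \<tau>)"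
proof (rule tp.star_hom_eqI[OF unital_star_hom_comp[OF lift_hom[OF \<sigma>] lift_hom[OF \<tau>]]
      lift_hom[OF obj_comp[OF \<sigma> \<tau>]]])
  fix a z
  note \<sigma>\<tau> = obj_comp[OF \<sigma> \<tau>]
  note h = unital_star_homD[OF obj_hom[OF \<sigma>]]
  obtain Q P R where Q: "frame Obj \<sigma> Q" and P: "frame Obj \<tau> P" and R: "frame Obj (\<sigma> \<circ> \<tau>) R"
    using frame_exists \<sigma> \<tau> \<sigma>\<tau> by metis
  let ?q = "component \<sigma>" and ?p = "component \<tau>" and ?r = "component (\<sigma> \<circ> \<tau>)"
  \<comment> \<open>This is the range projection of the isometry \<open>\<sigma> W * V\<close>,
    which embeds the composite of the two components into \<sigma> \<circ> \<tau>.\<close>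
  let ?E = "\<lambda>V W. \<sigma> (W * W\<^sup>\<star>) * (V * V\<^sup>\<star>)"
  have term_eq: "tens (\<sigma> (\<tau> a) * ?E V W * (Y * Y\<^sup>\<star>)) (\<beta> (?q V) (\<beta> (?p W) z)) =
      tens (\<sigma> (\<tau> a) * ?E V W * (Y * Y\<^sup>\<star>)) (\<beta> (?r Y) z)" if "V \<in> Q" "W \<in> P" "Y \<in> R" for V W Y
  proof -
    note V = frameD(2-4)[OF Q that(1)] and W = frameD(2-4)[OF P that(2)] and Y = frameD(2-4)[OF R that(3)]
    \<comment> \<open>The part of \<open>Y\<close> that runs from its own component into the
      composite of the components at \<open>V\<close> and \<open>W\<close>. If it vanishes, so do
      both sides; otherwise \<open>\<beta>_comp\<close> applies to it.\<close>
    define M where "M = ?q V (W\<^sup>\<star>) * (V\<^sup>\<star> * Y)"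
    have "V\<^sup>\<star> \<in> intertwiners \<sigma> (?q V)" by (rule intertwiners_star[OF obj_hom[OF V(1)] obj_hom[OF \<sigma>] V(3)])
    moreover have "W\<^sup>\<star> \<in> intertwiners \<tau> (?p W)" by (rule intertwiners_star[OF obj_hom[OF W(1)] obj_hom[OF \<tau>] W(3)])
    ultimately have "V\<^sup>\<star> * \<sigma> (W\<^sup>\<star>) \<in> intertwiners (\<sigma> \<circ> \<tau>) (?q V \<circ> ?p W)"
      by (rule intertwiners_tensor[OF obj_hom[OF \<sigma>]])
    then have "V\<^sup>\<star> * \<sigma> (W\<^sup>\<star>) * Y \<in> intertwiners (?r Y) (?q V \<circ> ?p W)"
      by (rule intertwiners_mult[OF Y(3)])
    moreover have "V\<^sup>\<star> * \<sigma> (W\<^sup>\<star>) * Y = M"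
      unfolding M_def using \<open>V\<^sup>\<star> \<in> intertwiners \<sigma> (?q V)\<close> by (simp add: intertwinersD mult.assoc)
    ultimately have M: "M \<in> intertwiners (?r Y) (?q V \<circ> ?p W)" by simp
    have "?E V W = \<sigma> W * (\<sigma> (W\<^sup>\<star>) * V) * V\<^sup>\<star>" by (simp add: h mult.assoc)
    also have "\<sigma> (W\<^sup>\<star>) * V = V * ?q V (W\<^sup>\<star>)" using intertwinersD[OF V(3)] by simp
    finally have E: "?E V W * (Y * Y\<^sup>\<star>) = \<sigma> W * V * M * Y\<^sup>\<star>"
      unfolding M_def by (simp add: mult.assoc)
    show ?thesis
    proof (cases "M = 0")
      case True
      then show ?thesis using E by (simp add: mult.assoc)
    next
      case False
      have "\<beta> (?r Y) = \<beta> (?q V) \<circ> \<beta> (?p W)"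
        by (rule \<beta>_comp[OF Y(1) V(1) W(1) Y(2) V(2) W(2) M False])
      then show ?thesis by simp
    qed
  qed
  have "lift \<sigma> (lift \<tau> (tens a z)) = (\<Sum>W\<in>P. \<Sum>V\<in>Q. tens (\<sigma> (\<tau> a) * ?E V W) (\<beta> (?q V) (\<beta> (?p W) z)))"
    unfolding lift_tens[OF \<tau> P] unital_star_hom_sum[OF lift_hom[OF \<sigma>]] lift_tens[OF \<sigma> Q]
    by (simp add: h mult.assoc)
  also have "\<dots> = (\<Sum>W\<in>P. \<Sum>V\<in>Q. \<Sum>Y\<in>R. tens (\<sigma> (\<tau> a) * ?E V W * (Y * Y\<^sup>\<star>)) (\<beta> (?q V) (\<beta> (?p W) z)))"
    unfolding tp.tens_sum_left[symmetric] orthonormal_sum_right[OF frameD(1)[OF R], symmetric] ..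
  also have "\<dots> = (\<Sum>W\<in>P. \<Sum>V\<in>Q. \<Sum>Y\<in>R. tens (\<sigma> (\<tau> a) * ?E V W * (Y * Y\<^sup>\<star>)) (\<beta> (?r Y) z))"
    by (intro sum.cong refl term_eq)
  also have "\<dots> = (\<Sum>W\<in>P. \<Sum>Y\<in>R. \<Sum>V\<in>Q. tens (\<sigma> (\<tau> a) * ?E V W * (Y * Y\<^sup>\<star>)) (\<beta> (?r Y) z))"
    by (intro sum.cong refl sum.swap)
  also have "\<dots> = (\<Sum>Y\<in>R. \<Sum>W\<in>P. \<Sum>V\<in>Q. tens (\<sigma> (\<tau> a) * ?E V W * (Y * Y\<^sup>\<star>)) (\<beta> (?r Y) z))"
    by (rule sum.swap)
  also have "\<dots> = (\<Sum>Y\<in>R. tens (\<sigma> (\<tau> a) * (\<Sum>W\<in>P. \<Sum>V\<in>Q. ?E V W) * (Y * Y\<^sup>\<star>)) (\<beta> (?r Y) z))"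
    by (simp add: tp.tens_sum_left sum_distrib_left sum_distrib_right)
  also have "(\<Sum>W\<in>P. \<Sum>V\<in>Q. ?E V W) = 1"
    using orthonormalD(3)[OF frameD(1)[OF Q]] orthonormalD(3)[OF frameD(1)[OF P]]
    by (simp flip: sum_distrib_left sum_distrib_right unital_star_hom_sum[OF obj_hom[OF \<sigma>]]) (simp add: h)
  also have "(\<Sum>Y\<in>R. tens (\<sigma> (\<tau> a) * 1 * (Y * Y\<^sup>\<star>)) (\<beta> (?r Y) z)) = lift (\<sigma> \<circ> \<tau>) (tens a z)"
    unfolding lift_tens[OF \<sigma>\<tau> R] by simp
  finally show "(lift \<sigma> \<circ> lift \<tau>) (tens a z) = lift (\<sigma> \<circ> \<tau>) (tens a z)" by simp
qed

text \<open>
  By Schur's lemma the slices of \<open>t\<close> are multiples of one unitary \<open>U\<close>, so that \<open>(U\<^sup>\<star> \<otimes> 1) t\<close> has scalar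
  slices.
\<close>

lemma slices_irreducible:
  assumes hom: "unital_star_hom \<rho>" "unital_star_hom \<rho>'" and irr: "irreducible_endo \<rho>" "irreducible_endo \<rho>'"
    and t: "\<And>\<omega>. \<omega> \<in> characters \<Longrightarrow> tp.slice \<omega> t \<in> intertwiners \<rho> \<rho>'"
  obtains U z where "U \<in> intertwiners \<rho> \<rho>'" "t = tens U z"
proof (cases "\<exists>X. X \<in> intertwiners \<rho> \<rho>' \<and> X \<noteq> 0")
  case False
  then have "tp.slice \<omega> t = 0" if "\<omega> \<in> characters" for \<omega> using t[OF that] by blast
  then have "norm t \<le> 0" by (intro tp.norm_le_slices) simp
  then show thesis
    using that[of 0 0] module.subspace_0[OF module_scaleC csubspace_intertwiners[of \<rho> \<rho>']] by simp
next
  case True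
  then obtain X where X: "X \<in> intertwiners \<rho> \<rho>'" "X \<noteq> 0" by blast
  define U where "U = (1 / norm X) *\<^sub>R X"
  have U: "U \<in> intertwiners \<rho> \<rho>'" "U * U\<^sup>\<star> = 1"
    unfolding U_def using intertwiners_scaleR[OF X(1)] schur_unitary(1)[OF hom irr X] by (auto simp: unitary_def)
  have "tens (U\<^sup>\<star>) 1 * t \<in> range (tens 1)"
  proof (rule tp.scalar_slices_in_range)
    fix \<omega> :: "'z \<Rightarrow> complex" assume \<omega>: "\<omega> \<in> characters"
    have "tp.slice \<omega> (tens (U\<^sup>\<star>) 1 * t) = U\<^sup>\<star> * tp.slice \<omega> t"
      by (simp add: unital_star_homD(3)[OF tp.slice(1)[OF \<omega>]] tp.slice_one[OF \<omega>])
    also have "\<dots> \<in> scalars"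
      by (rule irreducible_endoD[OF irr(1) intertwiners_mult[OF t[OF \<omega>] intertwiners_star[OF hom U(1)]]])
    finally show "tp.slice \<omega> (tens (U\<^sup>\<star>) 1 * t) \<in> scalars" .
  qed
  then obtain z where "tens (U\<^sup>\<star>) 1 * t = tens 1 z" by blast
  then have "tens U 1 * (tens (U\<^sup>\<star>) 1 * t) = tens U z" by (simp add: tp.tens_mult)
  then have "t = tens U z" using U(2) by (simp add: tp.tens_mult tp.tens_one flip: mult.assoc)
  with U(1) show thesis by (rule that)
qed

lemma lift_intertwiners:
  assumes \<sigma>: "\<sigma> \<in> Obj" and \<tau>: "\<tau> \<in> Obj"
  shows "intertwiners (lift \<sigma>) (lift \<tau>) =
    cspan {X * lift \<sigma> Z | X Z. X \<in> (\<lambda>x. tens x 1) ` intertwiners \<sigma> \<tau> \<and> Z \<in> center}" (is "?L = cspan ?G")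
proof
  have "?G \<subseteq> ?L"
  proof clarify
    fix X and Z :: 't assume X: "X \<in> intertwiners \<sigma> \<tau>" and Z: "Z \<in> center"
    have "Z * x = x * Z" for x using Z unfolding center_def by blast
    then have "lift \<sigma> Z \<in> intertwiners (lift \<sigma>) (lift \<sigma>)"
      by (intro intertwinersI) (simp flip: unital_star_homD(3)[OF lift_hom[OF \<sigma>]])
    then show "tens X 1 * lift \<sigma> Z \<in> ?L"
      by (rule intertwiners_mult) (rule lift_intertwiner[OF \<sigma> \<tau> X])
  qed
  then show "cspan ?G \<subseteq> ?L"
    using csubspace_intertwiners by (rule module.span_minimal[OF module_scaleC])
  show "?L \<subseteq> cspan ?G"
  proof
    fix t assume t: "t \<in> ?L"
    obtain Q P where Q: "frame Obj \<sigma> Q" and P: "frame Obj \<tau> P" using frame_exists \<sigma> \<tau> by metis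
    note oQ = orthonormalD[OF frameD(1)[OF Q]] and oP = orthonormalD[OF frameD(1)[OF P]]
    \<comment> \<open>The relation for \<open>t\<close> is tested only on \<open>tens b 1\<close>,
      where both lifts act untwisted.\<close>
    have slice_t: "tp.slice \<omega> t \<in> intertwiners \<sigma> \<tau>" if \<omega>: "\<omega> \<in> characters" for \<omega>
    proof (rule intertwinersI)
      fix b
      have "tp.slice \<omega> (t * lift \<sigma> (tens b 1)) = tp.slice \<omega> (lift \<tau> (tens b 1) * t)"
        using intertwinersD[OF t] by simp
      then show "tp.slice \<omega> t * \<sigma> b = \<tau> b * tp.slice \<omega> t"
        by (simp add: lift_tens_one \<sigma> \<tau> unital_star_homD(3)[OF tp.slice(1)[OF \<omega>]] tp.slice_one[OF \<omega>])
    qed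
    have "tens (W * W\<^sup>\<star>) 1 * t * tens (V * V\<^sup>\<star>) 1 \<in> cspan ?G" if VW: "V \<in> Q" "W \<in> P" for V W
    proof -
      note V = frameD(2-4)[OF Q VW(1)] and W = frameD(2-4)[OF P VW(2)]
      note hV = obj_hom[OF V(1)] and hW = obj_hom[OF W(1)]
      let ?s = "tens (W\<^sup>\<star>) 1 * t * tens V 1"
      have "tp.slice \<omega> ?s \<in> intertwiners (component \<sigma> V) (component \<tau> W)" if \<omega>: "\<omega> \<in> characters" for \<omega>
        using frame_intertwiner[OF \<sigma> \<tau> Q P VW slice_t[OF \<omega>]]
        by (simp add: unital_star_homD(3)[OF tp.slice(1)[OF \<omega>]] tp.slice_one[OF \<omega>])
      then obtain U z where U: "U \<in> intertwiners (component \<sigma> V) (component \<tau> W)" and s: "?s = tens U z"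
        by (rule slices_irreducible[OF hV hW V(2) W(2)])
      let ?X = "W * U * V\<^sup>\<star>"
      have X: "?X \<in> intertwiners \<sigma> \<tau>"
        using intertwiners_mult[OF intertwiners_star[OF hV obj_hom[OF \<sigma>] V(3)] intertwiners_mult[OF U W(3)]] .
      obtain y where y: "\<beta> (component \<sigma> V) y = z"
        using \<beta>_bij[OF V(1,2)] by (metis bij_pointE)
      have "tens (W * W\<^sup>\<star>) 1 * t * tens (V * V\<^sup>\<star>) 1 = tens W 1 * ?s * tens (V\<^sup>\<star>) 1"
        by (simp add: mult.assoc tp.tens_mult) (simp add: tp.tens_mult flip: mult.assoc)
      also have "\<dots> = tens ?X z"
        unfolding s by (simp add: tp.tens_mult)
      also have "\<dots> = tens ?X 1 * lift \<sigma> (tens 1 y)"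
      proof -
        \<comment> \<open>Orthogonality of the frame leaves only the summand of \<open>V\<close> in
          the lift of \<open>tens 1 y\<close>, and there the automorphism takes \<open>y\<close> to
          \<open>z\<close>.\<close>
        have "tens ?X 1 * tens (\<sigma> 1 * (V' * V'\<^sup>\<star>)) (\<beta> (component \<sigma> V') y) = (if V = V' then tens ?X z else 0)"
          if V': "V' \<in> Q" for V'
        proof -
          have "?X * (V' * V'\<^sup>\<star>) = W * U * (V\<^sup>\<star> * V') * V'\<^sup>\<star>" by (simp add: mult.assoc)
          also have "\<dots> = (if V = V' then ?X else 0)" unfolding oQ(2)[OF VW(1) V'] by simp
          finally show ?thesis
            using y by (cases "V = V'") (auto simp: tp.tens_mult unital_star_homD(4)[OF obj_hom[OF \<sigma>]])
        qed
        then show ?thesis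
          unfolding lift_tens[OF \<sigma> Q] sum_distrib_left using oQ(1) VW(1) by simp
      qed
      also have "\<dots> \<in> cspan ?G"
        using X tp.center_tensor[OF trivial_center] by (intro module.span_base[OF module_scaleC]) blast
      finally show ?thesis .
    qed
    then have "(\<Sum>V\<in>Q. \<Sum>W\<in>P. tens (W * W\<^sup>\<star>) 1 * t * tens (V * V\<^sup>\<star>) 1) \<in> cspan ?G"
      by (intro module.span_sum[OF module_scaleC])
    moreover have "(\<Sum>V\<in>Q. \<Sum>W\<in>P. tens (W * W\<^sup>\<star>) 1 * t * tens (V * V\<^sup>\<star>) 1) = t"
      using oQ(3) oP(3)
      by (simp add: tp.tens_one flip: sum_distrib_left sum_distrib_right tp.tens_sum_left)
    ultimately show "t \<in> cspan ?G" by simp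
  qed
qed

end

section \<open>The category of lifted endomorphisms and its untwisted subcategory\<close>

context chain_data
begin

abbreviation lobj :: "('t \<Rightarrow> 't) set" where
  "lobj \<equiv> T_obj tens Obj \<beta>"

abbreviation larr :: "('t \<Rightarrow> 't) \<Rightarrow> ('t \<Rightarrow> 't) \<Rightarrow> 't set" where
  "larr \<equiv> TC_arr tens Obj \<beta>"

lemma embedding_hom: "unital_star_hom (\<lambda>x. tens x 1)"
  unfolding unital_star_hom_def
  by (simp add: tp.tens_add_left tp.tens_scaleC_left tp.tens_mult tp.tens_one tp.tens_star)

lemma TC_arr_lift:
  assumes "\<sigma> \<in> Obj" "\<tau> \<in> Obj"
  shows "larr (lift \<sigma>) (lift \<tau>) = (\<lambda>x. tens x 1) ` intertwiners \<sigma> \<tau>"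
  unfolding TC_arr_def by (simp add: the_inv_into_f_f[OF lift_inj] assms)

lemma full_category: "tensor_cstar_category (lobj) intertwiners"
proof
  show "id \<in> lobj"
    unfolding T_obj_def using lift_id obj_id by (metis image_eqI)
  show "\<phi> \<circ> \<psi> \<in> lobj" if "\<phi> \<in> lobj" "\<psi> \<in> lobj" for \<phi> \<psi>
    using that obj_comp unfolding T_obj_def by (auto simp: lift_comp)
  show hom: "unital_star_hom \<phi>" if "\<phi> \<in> lobj" for \<phi>
    using that lift_hom unfolding T_obj_def by blast
  show "X\<^sup>\<star> \<in> intertwiners \<psi> \<phi>"
    if "\<phi> \<in> lobj" "\<psi> \<in> lobj" "X \<in> intertwiners \<phi> \<psi>" for \<phi> \<psi> X
    using intertwiners_star[OF hom[OF that(1)] hom[OF that(2)] that(3)] .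
  show "X * \<sigma> Y \<in> intertwiners (\<sigma> \<circ> \<tau>) (\<sigma>' \<circ> \<tau>')"
    if "\<sigma> \<in> lobj" "X \<in> intertwiners \<sigma> \<sigma>'" "Y \<in> intertwiners \<tau> \<tau>'" for \<sigma> \<tau> \<sigma>' \<tau>' X Y
    using intertwiners_tensor[OF hom[OF that(1)] that(2,3)] .
qed (rule subset_refl csubspace_intertwiners closed_intertwiners intertwiners_one intertwiners_mult; assumption)+

lemma T_objE:
  assumes "\<phi> \<in> lobj"
  obtains \<sigma> where "\<sigma> \<in> Obj" "\<phi> = lift \<sigma>"
  using assms unfolding T_obj_def by blast

lemma T_objI: "\<sigma> \<in> Obj \<Longrightarrow> lift \<sigma> \<in> lobj"
  unfolding T_obj_def by blast

lemma TC_arrE: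
  assumes "\<sigma> \<in> Obj" "\<tau> \<in> Obj" "X \<in> larr (lift \<sigma>) (lift \<tau>)"
  obtains X' where "X' \<in> intertwiners \<sigma> \<tau>" "X = tens X' 1"
  using assms(3) unfolding TC_arr_lift[OF assms(1,2)] by blast

lemma TC_arrI:
  "\<sigma> \<in> Obj \<Longrightarrow> \<tau> \<in> Obj \<Longrightarrow> X \<in> intertwiners \<sigma> \<tau> \<Longrightarrow> tens X 1 \<in> larr (lift \<sigma>) (lift \<tau>)"
  unfolding TC_arr_lift by blast

text \<open>The embedding \<open>a \<mapsto> tens a 1\<close> is an isometric star homomorphism that
  carries the action of \<sigma> to that of \<open>lift \<sigma>\<close>, and \<open>lift\<close>
  respects composition. Thus every axiom is the image of the same axiom for the given category;
  isometry is what keeps the arrow spaces closed.\<close>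

lemma sub_category: "tensor_cstar_category (lobj) (larr)"
proof -
  interpret full: tensor_cstar_category "lobj" intertwiners by (rule full_category)
  note e = unital_star_homD[OF embedding_hom]
  show ?thesis
  proof
    show "larr \<phi> \<psi> \<subseteq> intertwiners \<phi> \<psi>"
      if \<phi>: "\<phi> \<in> lobj" and \<psi>: "\<psi> \<in> lobj" for \<phi> \<psi>
    proof -
      obtain \<sigma> \<tau> where *: "\<sigma> \<in> Obj" "\<tau> \<in> Obj" "\<phi> = lift \<sigma>" "\<psi> = lift \<tau>"
        using \<phi> \<psi> by (metis T_objE)
      show ?thesis unfolding *(3,4) TC_arr_lift[OF *(1,2)] using lift_intertwiner[OF *(1,2)] by blast
    qed
    show "csubspace (larr \<phi> \<psi>)" "closed (larr \<phi> \<psi>)"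
      if \<phi>: "\<phi> \<in> lobj" and \<psi>: "\<psi> \<in> lobj" for \<phi> \<psi>
    proof -
      obtain \<sigma> \<tau> where *: "\<sigma> \<in> Obj" "\<tau> \<in> Obj" "\<phi> = lift \<sigma>" "\<psi> = lift \<tau>"
        using \<phi> \<psi> by (metis T_objE)
      note s = csubspace_intertwiners[of \<sigma> \<tau>]
      note s' = module.subspace_0[OF module_scaleC s] module.subspace_add[OF module_scaleC s]
        module.subspace_scale[OF module_scaleC s]
      show "csubspace (larr \<phi> \<psi>)"
        unfolding *(3,4) TC_arr_lift[OF *(1,2)]
      proof (rule module.subspaceI[OF module_scaleC])
        show "0 \<in> (\<lambda>x. tens x 1) ` intertwiners \<sigma> \<tau>" using s'(1) by (rule image_eqI[rotated]) simp
      qed (auto simp: tp.tens_add_left[symmetric] tp.tens_scaleC_left[symmetric] intro!: imageI s'(2,3))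
      have "Real_Vector_Spaces.subspace (intertwiners \<sigma> \<tau>)"
        using s'(1,2) by (intro subspaceI intertwiners_scaleR) auto
      then show "closed (larr \<phi> \<psi>)"
        unfolding *(3,4) TC_arr_lift[OF *(1,2)]
        using closed_intertwiners by (intro closed_isometric_image tp.linear_tens_left) (auto simp: tp.norm_tens)
    qed
    show "1 \<in> larr \<phi> \<phi>" if \<phi>: "\<phi> \<in> lobj" for \<phi>
    proof -
      obtain \<sigma> where *: "\<sigma> \<in> Obj" "\<phi> = lift \<sigma>" using \<phi> by (rule T_objE)
      show ?thesis using TC_arrI[OF *(1) *(1) intertwiners_one] unfolding *(2) by (simp add: tp.tens_one)
    qed
    show "Y * X \<in> larr \<phi> \<theta>"
      if obj: "\<phi> \<in> lobj" "\<psi> \<in> lobj" "\<theta> \<in> lobj"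
        and XY: "X \<in> larr \<phi> \<psi>" "Y \<in> larr \<psi> \<theta>" for \<phi> \<psi> \<theta> X Y
    proof -
      obtain \<sigma> \<tau> \<upsilon> where *: "\<sigma> \<in> Obj" "\<tau> \<in> Obj" "\<upsilon> \<in> Obj" "\<phi> = lift \<sigma>" "\<psi> = lift \<tau>" "\<theta> = lift \<upsilon>"
        using obj by (metis T_objE)
      obtain X' where X: "X' \<in> intertwiners \<sigma> \<tau>" "X = tens X' 1" using XY(1) unfolding * by (rule TC_arrE[OF *(1,2)])
      obtain Y' where Y: "Y' \<in> intertwiners \<tau> \<upsilon>" "Y = tens Y' 1" using XY(2) unfolding * by (rule TC_arrE[OF *(2,3)])
      show ?thesis
        using TC_arrI[OF *(1,3) intertwiners_mult[OF X(1) Y(1)]] unfolding *(4-6) X(2) Y(2) by (simp add: e)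
    qed
    show "X\<^sup>\<star> \<in> larr \<psi> \<phi>"
      if obj: "\<phi> \<in> lobj" "\<psi> \<in> lobj" and X: "X \<in> larr \<phi> \<psi>" for \<phi> \<psi> X
    proof -
      obtain \<sigma> \<tau> where *: "\<sigma> \<in> Obj" "\<tau> \<in> Obj" "\<phi> = lift \<sigma>" "\<psi> = lift \<tau>"
        using obj by (metis T_objE)
      obtain X' where X': "X' \<in> intertwiners \<sigma> \<tau>" "X = tens X' 1" using X unfolding * by (rule TC_arrE[OF *(1,2)])
      show ?thesis
        using TC_arrI[OF *(2,1) arr_star[OF *(1,2) X'(1)]] unfolding *(3,4) X'(2) by (simp add: e)
    qed
    show "X * \<phi> Y \<in> larr (\<phi> \<circ> \<psi>) (\<phi>' \<circ> \<psi>')"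
      if obj: "\<phi> \<in> lobj" "\<phi>' \<in> lobj" "\<psi> \<in> lobj" "\<psi>' \<in> lobj"
        and XY: "X \<in> larr \<phi> \<phi>'" "Y \<in> larr \<psi> \<psi>'" for \<phi> \<phi>' \<psi> \<psi>' X Y
    proof -
      obtain \<sigma> where 1: "\<sigma> \<in> Obj" "\<phi> = lift \<sigma>" using obj(1) by (rule T_objE)
      obtain \<sigma>' where 2: "\<sigma>' \<in> Obj" "\<phi>' = lift \<sigma>'" using obj(2) by (rule T_objE)
      obtain \<tau> where 3: "\<tau> \<in> Obj" "\<psi> = lift \<tau>" using obj(3) by (rule T_objE)
      obtain \<tau>' where 4: "\<tau>' \<in> Obj" "\<psi>' = lift \<tau>'" using obj(4) by (rule T_objE)
      obtain X' where X: "X' \<in> intertwiners \<sigma> \<sigma>'" "X = tens X' 1"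
        using XY(1) unfolding 1 2 by (rule TC_arrE[OF 1(1) 2(1)])
      obtain Y' where Y: "Y' \<in> intertwiners \<tau> \<tau>'" "Y = tens Y' 1"
        using XY(2) unfolding 3 4 by (rule TC_arrE[OF 3(1) 4(1)])
      show ?thesis
        using TC_arrI[OF obj_comp[OF 1(1) 3(1)] obj_comp[OF 2(1) 4(1)] arr_tensor[OF 1(1) 2(1) 3(1) 4(1) X(1) Y(1)]]
        unfolding 1(2) 2(2) 3(2) 4(2) X(2) Y(2) by (simp add: e lift_tens_one 1(1) lift_comp 2(1) 3(1) 4(1))
    qed
  qed (fact full.obj_hom full.obj_id full.obj_comp)+
qed

lemma sub_dr_category: "dr_category (lobj) (larr)"
proof -
  interpret sub: tensor_cstar_category "lobj" "larr" by (rule sub_category)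
  note e = unital_star_homD[OF embedding_hom, symmetric]
  note e' = tp.tens_mult tp.tens_star
  \<comment> \<open>A permutation structure takes the lifted endomorphisms as arguments, so the
    original objects are recovered through the injectivity of \<open>lift\<close>.\<close>
  define \<delta> where "\<delta> \<phi> \<psi> = tens (\<epsilon> (the_inv_into Obj lift \<phi>) (the_inv_into Obj lift \<psi>)) 1" for \<phi> \<psi>
  have \<delta>: "\<delta> (lift \<sigma>) (lift \<tau>) = tens (\<epsilon> \<sigma> \<tau>) 1" if "\<sigma> \<in> Obj" "\<tau> \<in> Obj" for \<sigma> \<tau>
    unfolding \<delta>_def by (simp add: the_inv_into_f_f[OF lift_inj] that)
  have one_iff: "tens x 1 = 1 \<longleftrightarrow> x = 1" for x using tp.tens_left_inject[of x 1] by (simp only: tp.tens_one)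
  have "dr_category_with (lobj) (larr) \<delta>"
  proof
    show "larr id id = scalars"
      using TC_arr_lift[OF obj_id obj_id]
      by (simp add: lift_id unit_irreducible scalars_def image_image tp.tens_scaleC_left tp.tens_one)
    show "\<exists>\<rho>\<in>lobj. \<exists>V\<in>larr \<phi> \<rho>. \<exists>W\<in>larr \<psi> \<rho>.
        isometry V \<and> isometry W \<and> V * V\<^sup>\<star> + W * W\<^sup>\<star> = 1"
      if obj: "\<phi> \<in> lobj" "\<psi> \<in> lobj" for \<phi> \<psi>
    proof -
      obtain \<sigma> \<tau> where *: "\<sigma> \<in> Obj" "\<tau> \<in> Obj" "\<phi> = lift \<sigma>" "\<psi> = lift \<tau>"
        using obj by (metis T_objE)
      obtain \<rho> V W where **: "\<rho> \<in> Obj" "V \<in> intertwiners \<sigma> \<rho>" "W \<in> intertwiners \<tau> \<rho>"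
        "isometry V" "isometry W" "V * V\<^sup>\<star> + W * W\<^sup>\<star> = 1"
        using direct_sums[OF *(1,2)] by blast
      show ?thesis
        unfolding *(3,4)
        by (rule bexI[OF _ T_objI[OF **(1)]], rule bexI[OF _ TC_arrI[OF *(1) **(1,2)]],
            rule bexI[OF _ TC_arrI[OF *(2) **(1,3)]])
          (use **(4-6) in \<open>simp add: isometry_def e' one_iff flip: tp.tens_add_left\<close>)
    qed
    show "\<exists>\<psi>\<in>lobj. \<exists>V\<in>larr \<psi> \<phi>. isometry V \<and> V * V\<^sup>\<star> = E"
      if obj: "\<phi> \<in> lobj" and E: "E \<in> larr \<phi> \<phi>" "projection E" "E \<noteq> 0" for \<phi> E
    proof -
      obtain \<sigma> where *: "\<sigma> \<in> Obj" "\<phi> = lift \<sigma>" using obj by (rule T_objE)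
      obtain E' where E': "E' \<in> intertwiners \<sigma> \<sigma>" "E = tens E' 1" using E(1) unfolding * by (rule TC_arrE[OF *(1,1)])
      have "projection E'" "E' \<noteq> 0"
        using E(2,3) unfolding E'(2) projection_def by (auto simp: e')
      then obtain \<tau> V where **: "\<tau> \<in> Obj" "V \<in> intertwiners \<tau> \<sigma>" "isometry V" "V * V\<^sup>\<star> = E'"
        using subobjects[OF *(1) E'(1)] by blast
      show ?thesis
        unfolding *(2)
        by (rule bexI[OF _ T_objI[OF **(1)]], rule bexI[OF _ TC_arrI[OF **(1) *(1) **(2)]])
          (use **(3,4) E'(2) in \<open>simp add: isometry_def e' one_iff\<close>)
    qed
    show "\<delta> \<phi> \<psi> \<in> larr (\<phi> \<circ> \<psi>) (\<psi> \<circ> \<phi>)" "unitary (\<delta> \<phi> \<psi>)" "\<delta> \<phi> \<psi> * \<delta> \<psi> \<phi> = 1"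
      if obj: "\<phi> \<in> lobj" "\<psi> \<in> lobj" for \<phi> \<psi>
    proof -
      obtain \<sigma> \<tau> where *: "\<sigma> \<in> Obj" "\<tau> \<in> Obj" "\<phi> = lift \<sigma>" "\<psi> = lift \<tau>"
        using obj by (metis T_objE)
      show "\<delta> \<phi> \<psi> \<in> larr (\<phi> \<circ> \<psi>) (\<psi> \<circ> \<phi>)"
        unfolding *(3,4) lift_comp[OF *(1,2)] lift_comp[OF *(2,1)] \<delta>[OF *(1,2)]
        by (rule TC_arrI[OF obj_comp[OF *(1,2)] obj_comp[OF *(2,1)] perm_arr[OF *(1,2)]])
      show "unitary (\<delta> \<phi> \<psi>)"
        using perm_unitary[OF *(1,2)] unfolding *(3,4) \<delta>[OF *(1,2)] by (simp add: unitary_def e' one_iff)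
      show "\<delta> \<phi> \<psi> * \<delta> \<psi> \<phi> = 1"
        using perm_involutive[OF *(1,2)] unfolding *(3,4) \<delta>[OF *(1,2)] \<delta>[OF *(2,1)] by (simp add: e' one_iff)
    qed
    show "\<delta> id \<phi> = 1" "\<delta> \<phi> id = 1" if obj: "\<phi> \<in> lobj" for \<phi>
    proof -
      obtain \<sigma> where *: "\<sigma> \<in> Obj" "\<phi> = lift \<sigma>" using obj by (rule T_objE)
      show "\<delta> id \<phi> = 1" "\<delta> \<phi> id = 1"
        using \<delta>[OF obj_id *(1)] \<delta>[OF *(1) obj_id] perm_unit[OF *(1)] unfolding *(2) lift_id by (simp_all add: one_iff)
    qed
    show "\<delta> (\<phi> \<circ> \<psi>) \<theta> = \<delta> \<phi> \<theta> * \<phi> (\<delta> \<psi> \<theta>)"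
      if obj: "\<phi> \<in> lobj" "\<psi> \<in> lobj" "\<theta> \<in> lobj" for \<phi> \<psi> \<theta>
    proof -
      obtain \<sigma> \<tau> \<upsilon> where *: "\<sigma> \<in> Obj" "\<tau> \<in> Obj" "\<upsilon> \<in> Obj" "\<phi> = lift \<sigma>" "\<psi> = lift \<tau>" "\<theta> = lift \<upsilon>"
        using obj by (metis T_objE)
      show ?thesis
        using perm_comp[OF *(1-3)]
        by (simp add: *(4-6) lift_comp[OF *(1,2)] \<delta>[OF obj_comp[OF *(1,2)] *(3)] \<delta>[OF *(1,3)] \<delta>[OF *(2,3)]
            lift_tens_one[OF *(1)] e')
    qed
    show "\<delta> \<phi>' \<psi>' * (A * \<phi> B) = (B * \<psi> A) * \<delta> \<phi> \<psi>"
      if obj: "\<phi> \<in> lobj" "\<phi>' \<in> lobj" "\<psi> \<in> lobj" "\<psi>' \<in> lobj"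
        and AB: "A \<in> larr \<phi> \<phi>'" "B \<in> larr \<psi> \<psi>'" for \<phi> \<phi>' \<psi> \<psi>' A B
    proof -
      obtain \<sigma> where 1: "\<sigma> \<in> Obj" "\<phi> = lift \<sigma>" using obj(1) by (rule T_objE)
      obtain \<sigma>' where 2: "\<sigma>' \<in> Obj" "\<phi>' = lift \<sigma>'" using obj(2) by (rule T_objE)
      obtain \<tau> where 3: "\<tau> \<in> Obj" "\<psi> = lift \<tau>" using obj(3) by (rule T_objE)
      obtain \<tau>' where 4: "\<tau>' \<in> Obj" "\<psi>' = lift \<tau>'" using obj(4) by (rule T_objE)
      obtain A' where A: "A' \<in> intertwiners \<sigma> \<sigma>'" "A = tens A' 1"
        using AB(1) unfolding 1 2 by (rule TC_arrE[OF 1(1) 2(1)])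
      obtain B' where B: "B' \<in> intertwiners \<tau> \<tau>'" "B = tens B' 1"
        using AB(2) unfolding 3 4 by (rule TC_arrE[OF 3(1) 4(1)])
      show ?thesis
        using perm_natural[OF 1(1) 2(1) 3(1) 4(1) A(1) B(1)]
        by (simp add: 1(2) 2(2) 3(2) 4(2) A(2) B(2) \<delta>[OF 1(1) 3(1)] \<delta>[OF 2(1) 4(1)] lift_tens_one[OF 1(1)]
            lift_tens_one[OF 3(1)] e')
    qed
    show "\<exists>\<phi>c\<in>lobj. \<exists>R\<in>larr id (\<phi>c \<circ> \<phi>). let S = \<delta> \<phi>c \<phi> * R in
        S\<^sup>\<star> * \<phi> R = 1 \<and> R\<^sup>\<star> * \<phi>c S = 1" if obj: "\<phi> \<in> lobj" for \<phi>
    proof -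
      obtain \<sigma> where *: "\<sigma> \<in> Obj" "\<phi> = lift \<sigma>" using obj by (rule T_objE)
      obtain \<sigma>c R where **: "\<sigma>c \<in> Obj" "R \<in> intertwiners id (\<sigma>c \<circ> \<sigma>)"
        "(\<epsilon> \<sigma>c \<sigma> * R)\<^sup>\<star> * \<sigma> R = 1" "R\<^sup>\<star> * \<sigma>c (\<epsilon> \<sigma>c \<sigma> * R) = 1"
        using conjugates[OF *(1)] unfolding Let_def by blast
      have "tens R 1 \<in> larr id (lift \<sigma>c \<circ> lift \<sigma>)"
        using TC_arrI[OF obj_id obj_comp[OF **(1) *(1)] **(2)] by (simp add: lift_id lift_comp[OF **(1) *(1)])
      then show ?thesis
        unfolding *(2) Let_def
        by (intro bexI[OF _ T_objI[OF **(1)]] bexI[of _ "tens R 1"])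
          (use **(3,4) in \<open>simp_all add: \<delta>[OF **(1) *(1)] e' lift_tens_one[OF **(1)] lift_tens_one[OF *(1)] one_iff\<close>)
    qed
  qed
  then show ?thesis unfolding dr_category_def by blast
qed

lemma admissible: "admissible_subcategory (lobj) intertwiners (larr)"
  unfolding admissible_subcategory_def
proof (intro conjI ballI full_category sub_dr_category)
  fix \<phi> \<psi> assume obj: "\<phi> \<in> lobj" "\<psi> \<in> lobj"
  then show "larr \<phi> \<psi> \<subseteq> intertwiners \<phi> \<psi>"
    by (rule tensor_cstar_category.arr_intertwiners[OF sub_category])
  obtain \<sigma> \<tau> where *: "\<sigma> \<in> Obj" "\<tau> \<in> Obj" "\<phi> = lift \<sigma>" "\<psi> = lift \<tau>"
    using obj by (metis T_objE)
  show "intertwiners \<phi> \<psi> = cspan {X * \<phi> Z | X Z. X \<in> larr \<phi> \<psi> \<and> Z \<in> center}"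
    unfolding *(3,4) TC_arr_lift[OF *(1,2)] by (rule lift_intertwiners[OF *(1,2)])
qed

end

section \<open>Complex matrices\<close>

lemma mult_mat_index:
  "A \<in> carrier_mat n m \<Longrightarrow> B \<in> carrier_mat m p \<Longrightarrow> i < n \<Longrightarrow> j < p \<Longrightarrow>
    (A * B) $$ (i, j) = (\<Sum>k<m. A $$ (i, k) * B $$ (k, j))"
  by (simp add: scalar_prod_def atLeast0LessThan)

lemma mult_mat_vec_index:
  "A \<in> carrier_mat n m \<Longrightarrow> v \<in> carrier_vec m \<Longrightarrow> i < n \<Longrightarrow>
    (A *\<^sub>v v) $ i = (\<Sum>k<m. A $$ (i, k) * v $ k)"
  by (simp add: scalar_prod_def atLeast0LessThan)

lemma mat_adjoint_dim [simp]:
  "dim_row (mat_adjoint A) = dim_col A" "dim_col (mat_adjoint A) = dim_row A"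
  by (simp_all add: mat_adjoint_def)

lemma mat_adjoint_carrier: "A \<in> carrier_mat n m \<Longrightarrow> mat_adjoint A \<in> carrier_mat m n"
  by (rule carrier_matI) simp_all

lemma mat_adjoint_index [simp]:
  "i < dim_col A \<Longrightarrow> j < dim_row A \<Longrightarrow> mat_adjoint (A :: complex mat) $$ (i, j) = cnj (A $$ (j, i))"
  by (simp add: mat_adjoint_def mat_of_rows_def)

lemma mat_adjoint_adjoint [simp]: "mat_adjoint (mat_adjoint A) = (A :: complex mat)"
  by (rule eq_matI) simp_all

lemma mat_adjoint_one [simp]: "mat_adjoint (1\<^sub>m n) = (1\<^sub>m n :: complex mat)"
  by (rule eq_matI) auto

lemma mat_adjoint_mult:
  assumes "A \<in> carrier_mat n m" "B \<in> carrier_mat m p"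
  shows "mat_adjoint (A * B) = mat_adjoint B * mat_adjoint (A :: complex mat)"
proof (rule eq_matI)
  fix i j assume "i < dim_row (mat_adjoint B * mat_adjoint A)" "j < dim_col (mat_adjoint B * mat_adjoint A)"
  then have ij: "i < p" "j < n" using assms by auto
  have "mat_adjoint (A * B) $$ (i, j) = cnj (\<Sum>k<m. A $$ (j, k) * B $$ (k, i))"
    using assms ij by (simp add: mult_mat_index[OF assms ij(2,1)] del: index_mult_mat(1))
  also have "\<dots> = (\<Sum>k<m. mat_adjoint B $$ (i, k) * mat_adjoint A $$ (k, j))"
    using assms ij by (simp add: mult.commute)
  also have "\<dots> = (mat_adjoint B * mat_adjoint A) $$ (i, j)"
    by (rule mult_mat_index[symmetric]) (use assms ij in \<open>auto intro: mat_adjoint_carrier\<close>)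
  finally show "mat_adjoint (A * B) $$ (i, j) = (mat_adjoint B * mat_adjoint A) $$ (i, j)" .
qed (use assms in auto)

definition tr :: "complex mat \<Rightarrow> complex" where
  "tr A = (\<Sum>i<dim_row A. A $$ (i, i))"

lemma tr_mult_commute:
  assumes "A \<in> carrier_mat n m" "B \<in> carrier_mat m n"
  shows "tr (A * B) = tr (B * A)"
proof -
  have "tr (A * B) = (\<Sum>i<n. \<Sum>k<m. A $$ (i, k) * B $$ (k, i))"
    using assms by (simp add: tr_def mult_mat_index[OF assms] del: index_mult_mat(1))
  also have "\<dots> = (\<Sum>k<m. \<Sum>i<n. B $$ (k, i) * A $$ (i, k))"
    by (subst sum.swap) (simp add: mult.commute)
  also have "\<dots> = tr (B * A)"
    using assms by (simp add: tr_def mult_mat_index[OF assms(2,1)] del: index_mult_mat(1))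
  finally show ?thesis .
qed

lemma tr_one: "tr (1\<^sub>m n) = of_nat n"
  by (simp add: tr_def)

lemma tr_add: "A \<in> carrier_mat n n \<Longrightarrow> B \<in> carrier_mat n n \<Longrightarrow> tr (A + B) = tr A + tr B"
  by (simp add: tr_def sum.distrib)

text \<open>The diagonal entries of a projection satisfy \<open>p\<^sub>i\<^sub>i = \<Sum>\<^sub>j |p\<^sub>i\<^sub>j|\<^sup>2 \<ge> |p\<^sub>i\<^sub>i|\<^sup>2\<close>.\<close>

lemma tr_projection_le:
  assumes P: "P \<in> carrier_mat n n" "mat_adjoint P = P" "P * P = P"
  shows "Re (tr P) \<le> n"
proof -
  have "Re (P $$ (i, i)) \<le> 1" if i: "i < n" for i
  proof -
    have h: "P $$ (k, i) = cnj (P $$ (i, k))" if "k < n" for k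
      using mat_adjoint_index[of k P i] P(1,2) i that by auto
    have "P $$ (i, i) = (\<Sum>k<n. P $$ (i, k) * P $$ (k, i))"
      using mult_mat_index[OF P(1) P(1) i i] P(3) by simp
    also have "\<dots> = (\<Sum>k<n. complex_of_real ((cmod (P $$ (i, k)))\<^sup>2))"
      by (intro sum.cong refl) (simp add: h complex_norm_square[symmetric] del: of_real_power)
    finally have "Re (P $$ (i, i)) = (\<Sum>k<n. (cmod (P $$ (i, k)))\<^sup>2)" by simp
    moreover have "(cmod (P $$ (i, i)))\<^sup>2 \<le> (\<Sum>k<n. (cmod (P $$ (i, k)))\<^sup>2)"
      using i by (intro member_le_sum) auto
    moreover have "(Re (P $$ (i, i)))\<^sup>2 \<le> (cmod (P $$ (i, i)))\<^sup>2"
      by (simp add: cmod_power2)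
    ultimately have "(Re (P $$ (i, i)))\<^sup>2 \<le> Re (P $$ (i, i))" by simp
    then show ?thesis
      using mult_strict_left_mono[of 1 "Re (P $$ (i, i))" "Re (P $$ (i, i))"]
      by (cases "Re (P $$ (i, i)) \<le> 1") (auto simp: power2_eq_square)
  qed
  then have "(\<Sum>i<n. Re (P $$ (i, i))) \<le> (\<Sum>i<n. 1)" by (intro sum_mono) auto
  then show ?thesis using P(1) by (simp add: tr_def)
qed

lemma vec_diff_eq_0:
  assumes "(q :: complex vec) \<in> carrier_vec n" "v \<in> carrier_vec n"
  shows "q + (- 1) \<cdot>\<^sub>v q = 0\<^sub>v n" "v + (- 1) \<cdot>\<^sub>v q = 0\<^sub>v n \<Longrightarrow> q = v"
proof -
  show "q + (- 1) \<cdot>\<^sub>v q = 0\<^sub>v n" using assms by (intro eq_vecI) auto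
  assume *: "v + (- 1) \<cdot>\<^sub>v q = 0\<^sub>v n"
  show "q = v"
  proof (rule eq_vecI)
    fix i assume "i < dim_vec v"
    then show "q $ i = v $ i"
      using assms arg_cong[OF *, of "\<lambda>w. w $ i"] by simp
  qed (use assms in auto)
qed

definition vec_subspace :: "nat \<Rightarrow> complex vec set \<Rightarrow> bool" where
  "vec_subspace n W \<longleftrightarrow> W \<subseteq> carrier_vec n \<and> 0\<^sub>v n \<in> W \<and> (\<forall>v\<in>W. \<forall>w\<in>W. v + w \<in> W) \<and> (\<forall>c. \<forall>v\<in>W. c \<cdot>\<^sub>v v \<in> W)"

text \<open>A projection onto a subspace of \<open>W\<close> of maximal trace is the projection onto \<open>W\<close>.\<close>

lemma orthogonal_projection_exists:
  assumes W: "vec_subspace n W"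
  obtains P where "P \<in> carrier_mat n n" "mat_adjoint P = P" "P * P = P"
    "\<And>v. v \<in> carrier_vec n \<Longrightarrow> P *\<^sub>v v \<in> W" "\<And>v. v \<in> W \<Longrightarrow> P *\<^sub>v v = v"
proof -
  have Wc: "v \<in> carrier_vec n" if "v \<in> W" for v using W that unfolding vec_subspace_def by blast
  have Wadd: "v + w \<in> W" if "v \<in> W" "w \<in> W" for v w
    using W that unfolding vec_subspace_def by blast
  have Wsc: "c \<cdot>\<^sub>v v \<in> W" if "v \<in> W" for v c
    using W that unfolding vec_subspace_def by blast
  have W0: "0\<^sub>v n \<in> W" using W unfolding vec_subspace_def by blast
  \<comment> \<open>Recording the trace as a natural number allows a maximal value to be chosen; the
    traces are bounded by \<open>tr_projection_le\<close>.\<close>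
  define S where "S k P \<longleftrightarrow> P \<in> carrier_mat n n \<and> mat_adjoint P = P \<and> P * P = P \<and>
    (\<forall>v\<in>carrier_vec n. P *\<^sub>v v \<in> W) \<and> tr P = of_nat k" for k P
  have "S 0 (0\<^sub>m n n)"
    unfolding S_def
  proof (intro conjI ballI)
    show "mat_adjoint (0\<^sub>m n n) = (0\<^sub>m n n :: complex mat)" by (rule eq_matI) auto
    show "0\<^sub>m n n *\<^sub>v v \<in> W" if "v \<in> carrier_vec n" for v
    proof -
      have "0\<^sub>m n n *\<^sub>v v = 0\<^sub>v n" using that by (intro eq_vecI) auto
      then show ?thesis using W0 by simp
    qed
  qed (simp_all add: tr_def)
  moreover have "k \<le> n" if ex: "\<exists>P. S k P" for k
  proof -
    obtain P where "P \<in> carrier_mat n n" "mat_adjoint P = P" "P * P = P" "tr P = of_nat k"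
      using ex unfolding S_def by blast
    then show ?thesis using tr_projection_le[of P n] by simp
  qed
  ultimately obtain k where k: "\<exists>P. S k P" "\<And>j. \<exists>P. S j P \<Longrightarrow> j \<le> k"
    using GreatestI_nat[of "\<lambda>k. \<exists>P. S k P" 0 n] Greatest_le_nat[of "\<lambda>k. \<exists>P. S k P" _ n] by blast
  then obtain P where P: "P \<in> carrier_mat n n" "mat_adjoint P = P" "P * P = P"
    "\<And>v. v \<in> carrier_vec n \<Longrightarrow> P *\<^sub>v v \<in> W" "tr P = of_nat k" unfolding S_def by blast
  have "P *\<^sub>v v = v" if v: "v \<in> W" for v
  proof (rule ccontr)
    assume neq: "P *\<^sub>v v \<noteq> v"
    note vc = Wc[OF v]
    \<comment> \<open>The part of \<open>v\<close> that \<open>P\<close> misses: it lies in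
      \<open>W\<close>, is annihilated by \<open>P\<close> and is nonzero.\<close>
    define w where "w = v + (- 1) \<cdot>\<^sub>v (P *\<^sub>v v)"
    have wW: "w \<in> W" unfolding w_def using v P(4)[OF vc] by (intro Wadd Wsc)
    then have wc: "w \<in> carrier_vec n" by (rule Wc)
    have Pv: "P *\<^sub>v v \<in> carrier_vec n" using P(1) vc by simp
    have "P *\<^sub>v w = P *\<^sub>v v + (- 1) \<cdot>\<^sub>v (P *\<^sub>v (P *\<^sub>v v))"
      unfolding w_def using P(1) vc Pv by (simp add: mult_add_distrib_mat_vec[of _ n n] mult_mat_vec[of _ n n])
    also have "P *\<^sub>v (P *\<^sub>v v) = P *\<^sub>v v"
      using P(1,3) vc by (metis assoc_mult_mat_vec)
    finally have Pw: "P *\<^sub>v w = 0\<^sub>v n" using vec_diff_eq_0(1)[OF Pv vc] by (rule trans)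
    have "w \<noteq> 0\<^sub>v n" using vec_diff_eq_0(2)[OF Pv vc] neq unfolding w_def by blast
    then obtain i0 where "i0 < n" "w $ i0 \<noteq> 0" using wc by (metis eq_vecI carrier_vecD index_zero_vec(1,2))
    define r where "r = (\<Sum>i<n. (cmod (w $ i))\<^sup>2)"
    have "(cmod (w $ i0))\<^sup>2 \<le> r" unfolding r_def using \<open>i0 < n\<close> by (intro member_le_sum) auto
    then have r: "r > 0" using \<open>w $ i0 \<noteq> 0\<close> by (smt (verit) zero_less_norm_iff zero_less_power)
    have rsum: "(\<Sum>i<n. w $ i * cnj (w $ i)) = complex_of_real r"
      unfolding r_def by (simp add: complex_norm_square[symmetric] del: of_real_power)
    \<comment> \<open>The projection onto the line through \<open>w\<close>. As \<open>P\<close>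
      annihilates \<open>w\<close>, the sum \<open>P + R\<close> is again a projection into
      \<open>W\<close>, with trace \<open>k + 1\<close>.\<close>
    define R where "R = mat n n (\<lambda>(i, j). w $ i * cnj (w $ j) / complex_of_real r)"
    have R: "R \<in> carrier_mat n n" unfolding R_def by simp
    have Ri: "R $$ (i, j) = w $ i * cnj (w $ j) / complex_of_real r" if "i < n" "j < n" for i j
      unfolding R_def using that by simp
    have Ra: "mat_adjoint R = R"
      by (rule eq_matI) (use R in \<open>auto simp: Ri mult.commute\<close>)
    have RR: "R * R = R"
    proof (rule eq_matI)
      fix i j assume "i < dim_row R" "j < dim_col R"
      then have ij: "i < n" "j < n" using R by auto
      have "(R * R) $$ (i, j) = (\<Sum>k<n. w $ i * cnj (w $ j) / (complex_of_real r)\<^sup>2 * (w $ k * cnj (w $ k)))"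
        unfolding mult_mat_index[OF R R ij] using ij by (intro sum.cong refl) (simp add: Ri power2_eq_square)
      also have "\<dots> = w $ i * cnj (w $ j) / (complex_of_real r)\<^sup>2 * complex_of_real r"
        unfolding sum_distrib_left[symmetric] rsum ..
      also have "\<dots> = R $$ (i, j)" using r ij by (simp add: Ri power2_eq_square)
      finally show "(R * R) $$ (i, j) = R $$ (i, j)" .
    qed (use R in auto)
    have PR: "P * R = 0\<^sub>m n n"
    proof (rule eq_matI)
      fix i j assume "i < dim_row (0\<^sub>m n n)" "j < dim_col (0\<^sub>m n n)"
      then have ij: "i < n" "j < n" by auto
      have "(P * R) $$ (i, j) = (\<Sum>k<n. P $$ (i, k) * w $ k) * (cnj (w $ j) / complex_of_real r)"
        unfolding mult_mat_index[OF P(1) R ij] sum_distrib_right using ij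
        by (intro sum.cong refl) (simp add: Ri)
      also have "(\<Sum>k<n. P $$ (i, k) * w $ k) = 0"
        using mult_mat_vec_index[OF P(1) wc ij(1)] Pw ij by simp
      finally show "(P * R) $$ (i, j) = (0\<^sub>m n n) $$ (i, j)" using ij by simp
    qed (use P(1) R in auto)
    have RP: "R * P = 0\<^sub>m n n"
    proof -
      have "mat_adjoint (P * R) = R * P" using mat_adjoint_mult[OF P(1) R] by (simp add: P(2) Ra)
      moreover have "mat_adjoint (0\<^sub>m n n) = (0\<^sub>m n n :: complex mat)" by (rule eq_matI) auto
      ultimately show ?thesis using PR by simp
    qed
    have "S (Suc k) (P + R)"
      unfolding S_def
    proof (intro conjI ballI)
      show "P + R \<in> carrier_mat n n" using P(1) R by simp
      show "mat_adjoint (P + R) = P + R"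
      proof (rule eq_matI)
        fix i j assume "i < dim_row (P + R)" "j < dim_col (P + R)"
        then have ij: "i < n" "j < n" using R by auto
        have "cnj (P $$ (j, i)) = P $$ (i, j)" "cnj (R $$ (j, i)) = R $$ (i, j)"
          using mat_adjoint_index[of i P j] mat_adjoint_index[of i R j] P(1,2) R Ra ij by auto
        then show "mat_adjoint (P + R) $$ (i, j) = (P + R) $$ (i, j)"
          using ij P(1) R by simp
      qed (use P(1) R in auto)
      have "(P + R) * (P + R) = (P * P + P * R) + (R * P + R * R)"
        using P(1) R by (simp add: add_mult_distrib_mat[of P n n R "P + R" n]
            mult_add_distrib_mat[of P n n P n R] mult_add_distrib_mat[of R n n P n R])
      also have "\<dots> = P + R" unfolding PR RP RR P(3) using P(1) R by simp
      finally show "(P + R) * (P + R) = P + R" .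
      show "tr (P + R) = of_nat (Suc k)"
      proof -
        have "tr R = 1"
          using R r by (simp add: tr_def Ri rsum flip: sum_divide_distrib)
        then show ?thesis using tr_add[OF P(1) R] P(5) by simp
      qed
      fix u :: "complex vec" assume u: "u \<in> carrier_vec n"
      have "R *\<^sub>v u = ((\<Sum>j<n. cnj (w $ j) * u $ j) / complex_of_real r) \<cdot>\<^sub>v w"
      proof (rule eq_vecI)
        fix i assume "i < dim_vec (((\<Sum>j<n. cnj (w $ j) * u $ j) / complex_of_real r) \<cdot>\<^sub>v w)"
        then have i: "i < n" using wc by simp
        have "(R *\<^sub>v u) $ i = (\<Sum>j<n. (cnj (w $ j) * u $ j) * (w $ i / complex_of_real r))"
          unfolding mult_mat_vec_index[OF R u i] using i by (intro sum.cong refl) (simp add: Ri)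
        then show "(R *\<^sub>v u) $ i = (((\<Sum>j<n. cnj (w $ j) * u $ j) / complex_of_real r) \<cdot>\<^sub>v w) $ i"
          using i wc by (simp add: sum_distrib_right sum_divide_distrib)
      qed (use R wc in auto)
      then have "(P + R) *\<^sub>v u = P *\<^sub>v u + ((\<Sum>j<n. cnj (w $ j) * u $ j) / complex_of_real r) \<cdot>\<^sub>v w"
        using P(1) R u by (simp add: add_mult_distrib_mat_vec[of _ n n])
      then show "(P + R) *\<^sub>v u \<in> W" using P(4)[OF u] wW by (simp add: Wadd Wsc)
    qed
    then have "Suc k \<le> k" using k(2) by blast
    then show False by simp
  qed
  with P show thesis using that by blast
qed

lemma mat_eq_by_vec:
  fixes A B :: "complex mat"
  assumes "A \<in> carrier_mat n m" "B \<in> carrier_mat n m" "\<And>v. v \<in> carrier_vec m \<Longrightarrow> A *\<^sub>v v = B *\<^sub>v v"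
  shows "A = B"
proof (rule eq_matI)
  fix i j assume "i < dim_row B" "j < dim_col B"
  then have ij: "i < n" "j < m" using assms(2) by auto
  have "(C *\<^sub>v unit_vec m j) $ i = C $$ (i, j)" if "C \<in> carrier_mat n m" for C :: "complex mat"
    unfolding mult_mat_vec_index[OF that unit_vec_carrier ij(1)] using ij(2)
    by (simp add: if_distrib[of "\<lambda>x. _ * x"] cong: if_cong)
  then show "A $$ (i, j) = B $$ (i, j)"
    using assms by (metis unit_vec_carrier)
qed (use assms in auto)

lemma eigenvector_exists:
  assumes "A \<in> carrier_mat n n" "n > 0"
  obtains v and c :: complex where "v \<in> carrier_vec n" "v \<noteq> 0\<^sub>v n" "A *\<^sub>v v = c \<cdot>\<^sub>v v"
proof -
  obtain c where "eigenvalue A c" using spectrum_non_empty[OF assms(1)] assms(2) unfolding spectrum_def by blast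
  then show thesis using that assms(1) unfolding eigenvalue_def eigenvector_def by auto
qed

section \<open>Objects and representations\<close>

lemma unitary_mat_one: "unitary_mat (1\<^sub>m n)"
  unfolding unitary_mat_def by simp

lemma unitary_matD:
  assumes "unitary_mat M" "M \<in> carrier_mat n m"
  shows "m = n" "mat_adjoint M * M = 1\<^sub>m n" "M * mat_adjoint M = 1\<^sub>m n"
  using assms unfolding unitary_mat_def by auto

lemma rep_intertwinersD:
  assumes "M \<in> rep_intertwiners G U V"
  shows "M \<in> carrier_mat (rep_dim G V) (rep_dim G U)" "g \<in> carrier G \<Longrightarrow> M * U g = V g * M"
  using assms unfolding rep_intertwiners_def by blast+

lemma unitary_repD:
  assumes "unitary_rep G T U"
  shows "rep_dim G U > 0" "g \<in> carrier G \<Longrightarrow> U g \<in> carrier_mat (rep_dim G U) (rep_dim G U)"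
    "g \<in> carrier G \<Longrightarrow> unitary_mat (U g)"
    "g \<in> carrier G \<Longrightarrow> h \<in> carrier G \<Longrightarrow> U (g \<otimes>\<^bsub>G\<^esub> h) = U g * U h"
  using assms unfolding unitary_rep_def by blast+

lemma rep_intertwiners_one:
  assumes "unitary_rep G T U"
  shows "1\<^sub>m (rep_dim G U) \<in> rep_intertwiners G U U"
  unfolding rep_intertwiners_def
  using left_mult_one_mat[OF unitary_repD(2)[OF assms]] right_mult_one_mat[OF unitary_repD(2)[OF assms]] by simp

lemma rep_intertwiners_mult:
  assumes "unitary_rep G T U" "unitary_rep G T V" "unitary_rep G T W"
    and "M \<in> rep_intertwiners G U V" "N \<in> rep_intertwiners G V W"
  shows "N * M \<in> rep_intertwiners G U W"
proof -
  note M = rep_intertwinersD[OF assms(4)] and N = rep_intertwinersD[OF assms(5)]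
  have "N * M * U g = W g * (N * M)" if g: "g \<in> carrier G" for g
  proof -
    note c = unitary_repD(2)[OF assms(1) g] unitary_repD(2)[OF assms(2) g] unitary_repD(2)[OF assms(3) g]
    have "N * M * U g = N * (V g * M)"
      using assoc_mult_mat[OF N(1) M(1) c(1)] M(2)[OF g] by simp
    also have "\<dots> = W g * N * M"
      using assoc_mult_mat[OF N(1) c(2) M(1)] N(2)[OF g] by simp
    also have "\<dots> = W g * (N * M)" by (rule assoc_mult_mat[OF c(3) N(1) M(1)])
    finally show ?thesis .
  qed
  then show ?thesis using M(1) N(1) unfolding rep_intertwiners_def by auto
qed

context group
begin

lemma unitary_rep_one:
  assumes "unitary_rep G T U"
  shows "U \<one> = 1\<^sub>m (rep_dim G U)"
proof -
  note U = unitary_repD(2)[OF assms one_closed]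
  note u = unitary_matD(2)[OF unitary_repD(3)[OF assms one_closed] U]
  have "U \<one> * U \<one> = U \<one>" using unitary_repD(4)[OF assms one_closed one_closed] by simp
  then have "mat_adjoint (U \<one>) * U \<one> * U \<one> = mat_adjoint (U \<one>) * U \<one>"
    using assoc_mult_mat[OF mat_adjoint_carrier[OF U] U U] by simp
  then show ?thesis unfolding u using U by simp
qed

lemma unitary_rep_inv:
  assumes "unitary_rep G T U" and g: "g \<in> carrier G"
  shows "U (inv g) = mat_adjoint (U g)"
proof -
  note U = unitary_repD(2)[OF assms] and i = unitary_repD(2)[OF assms(1) inv_closed[OF g]]
  have "U g * U (inv g) = 1\<^sub>m (rep_dim G U)"
    using unitary_repD(4)[OF assms inv_closed[OF g]] g unitary_rep_one[OF assms(1)] by simp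
  then have "mat_adjoint (U g) = mat_adjoint (U g) * U g * U (inv g)"
    using assoc_mult_mat[OF mat_adjoint_carrier[OF U] U i] right_mult_one_mat[OF mat_adjoint_carrier[OF U]] by simp
  then show ?thesis
    unfolding unitary_matD(2)[OF unitary_repD(3)[OF assms] U] using i by simp
qed

lemma rep_intertwiners_adjoint:
  assumes U: "unitary_rep G T U" and V: "unitary_rep G T V" and M: "M \<in> rep_intertwiners G U V"
  shows "mat_adjoint M \<in> rep_intertwiners G V U"
proof -
  note c = rep_intertwinersD(1)[OF M]
  have "mat_adjoint M * V g = U g * mat_adjoint M" if g: "g \<in> carrier G" for g
  proof -
    note Ug = unitary_repD(2)[OF U inv_closed[OF g]] and Vg = unitary_repD(2)[OF V inv_closed[OF g]]
    have "mat_adjoint (M * U (inv g)) = mat_adjoint (V (inv g) * M)"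
      using rep_intertwinersD(2)[OF M inv_closed[OF g]] by simp
    then show ?thesis
      unfolding mat_adjoint_mult[OF c Ug] mat_adjoint_mult[OF Vg c]
      by (simp add: unitary_rep_inv[OF U g] unitary_rep_inv[OF V g])
  qed
  then show ?thesis using mat_adjoint_carrier[OF c] unfolding rep_intertwiners_def by blast
qed

text \<open>Invariance of the range gives only \<open>P * (U g * P) = U g * P\<close>. The adjoint
  of this equation at the inverse of \<open>g\<close> gives \<open>P * U g * P = P * U g\<close>,
  and the two together give commutation.\<close>

lemma projection_intertwiner:
  assumes U: "unitary_rep G T U" and W: "invariant_subspace G U W"
    and P: "P \<in> carrier_mat (rep_dim G U) (rep_dim G U)" "mat_adjoint P = P"
    and PW: "\<And>v. v \<in> carrier_vec (rep_dim G U) \<Longrightarrow> P *\<^sub>v v \<in> W" "\<And>v. v \<in> W \<Longrightarrow> P *\<^sub>v v = v"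
  shows "P \<in> rep_intertwiners G U U"
proof -
  have PUP: "P * (U g * P) = U g * P" if g: "g \<in> carrier G" for g
  proof (rule mat_eq_by_vec)
    note c = unitary_repD(2)[OF U g]
    show "P * (U g * P) \<in> carrier_mat (rep_dim G U) (rep_dim G U)" "U g * P \<in> carrier_mat (rep_dim G U) (rep_dim G U)"
      using P(1) c by simp_all
    fix v :: "complex vec" assume v: "v \<in> carrier_vec (rep_dim G U)"
    have "U g *\<^sub>v (P *\<^sub>v v) \<in> W" using W PW(1)[OF v] g unfolding invariant_subspace_def by blast
    then have "P *\<^sub>v (U g *\<^sub>v (P *\<^sub>v v)) = U g *\<^sub>v (P *\<^sub>v v)" by (rule PW(2))
    moreover have "(U g * P) *\<^sub>v v = U g *\<^sub>v (P *\<^sub>v v)" by (rule assoc_mult_mat_vec[OF c P(1) v])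
    moreover have "(P * (U g * P)) *\<^sub>v v = P *\<^sub>v ((U g * P) *\<^sub>v v)"
      using c by (intro assoc_mult_mat_vec[OF P(1) _ v]) (use P(1) in simp)
    ultimately show "(P * (U g * P)) *\<^sub>v v = (U g * P) *\<^sub>v v" by simp
  qed
  have "P * U g = U g * P" if g: "g \<in> carrier G" for g
  proof -
    note c = unitary_repD(2)[OF U g]
    note i = unitary_repD(2)[OF U inv_closed[OF g]]
    have "mat_adjoint (P * (U (inv g) * P)) = mat_adjoint (U (inv g) * P)"
      using PUP[OF inv_closed[OF g]] by simp
    moreover have "mat_adjoint (U (inv g) * P) = P * U g"
      unfolding mat_adjoint_mult[OF i P(1)] by (simp add: P(2) unitary_rep_inv[OF U g])
    moreover have "mat_adjoint (P * (U (inv g) * P)) = mat_adjoint (U (inv g) * P) * mat_adjoint P"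
      by (rule mat_adjoint_mult[OF P(1) mult_carrier_mat[OF i P(1)]])
    ultimately have "P * U g * P = P * U g" by (simp add: P(2))
    then show ?thesis using PUP[OF g] assoc_mult_mat[OF P(1) c P(1)] by simp
  qed
  then show ?thesis using P(1) unfolding rep_intertwiners_def by blast
qed

end

lemma eigenspace_invariant:
  assumes U: "unitary_rep G T U" and M: "M \<in> rep_intertwiners G U U"
  shows "invariant_subspace G U {v \<in> carrier_vec (rep_dim G U). M *\<^sub>v v = c \<cdot>\<^sub>v v}"
proof -
  note c = rep_intertwinersD(1)[OF M]
  show ?thesis
    unfolding invariant_subspace_def
  proof (intro conjI ballI allI)
    show "0\<^sub>v (rep_dim G U) \<in> {v \<in> carrier_vec (rep_dim G U). M *\<^sub>v v = c \<cdot>\<^sub>v v}"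
      using c by (auto intro!: eq_vecI)
    fix v assume v: "v \<in> {v \<in> carrier_vec (rep_dim G U). M *\<^sub>v v = c \<cdot>\<^sub>v v}"
    then have v': "v \<in> carrier_vec (rep_dim G U)" "M *\<^sub>v v = c \<cdot>\<^sub>v v" by auto
    show "v + w \<in> {v \<in> carrier_vec (rep_dim G U). M *\<^sub>v v = c \<cdot>\<^sub>v v}"
      if "w \<in> {v \<in> carrier_vec (rep_dim G U). M *\<^sub>v v = c \<cdot>\<^sub>v v}" for w
      using that v' by (auto simp: mult_add_distrib_mat_vec[OF c] smult_add_distrib_vec)
    show "d \<cdot>\<^sub>v v \<in> {v \<in> carrier_vec (rep_dim G U). M *\<^sub>v v = c \<cdot>\<^sub>v v}" for d
      using v' by (auto simp: mult_mat_vec[OF c] smult_smult_assoc mult.commute)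
    fix g assume g: "g \<in> carrier G"
    note Ug = unitary_repD(2)[OF U g]
    have "M *\<^sub>v (U g *\<^sub>v v) = U g *\<^sub>v (M *\<^sub>v v)"
      using rep_intertwinersD(2)[OF M g] assoc_mult_mat_vec[OF c Ug v'(1)] assoc_mult_mat_vec[OF Ug c v'(1)] by simp
    then show "U g *\<^sub>v v \<in> {v \<in> carrier_vec (rep_dim G U). M *\<^sub>v v = c \<cdot>\<^sub>v v}"
      using v' Ug by (simp add: mult_mat_vec[OF Ug])
  qed auto
qed

text \<open>A complex matrix of positive size has an eigenvalue. The eigenspace is invariant because
  the matrix commutes with the representation, and it is proper because the matrix is not
  scalar.\<close>

lemma nonscalar_eigenspace:
  assumes U: "unitary_rep G T U" and M: "M \<in> rep_intertwiners G U U" "\<And>c. M \<noteq> c \<cdot>\<^sub>m 1\<^sub>m (rep_dim G U)"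
  obtains W where "invariant_subspace G U W" "W \<noteq> {0\<^sub>v (rep_dim G U)}" "W \<noteq> carrier_vec (rep_dim G U)"
proof -
  let ?n = "rep_dim G U"
  note Mc = rep_intertwinersD(1)[OF M(1)]
  obtain v c where v: "v \<in> carrier_vec ?n" "v \<noteq> 0\<^sub>v ?n" "M *\<^sub>v v = c \<cdot>\<^sub>v v"
    using eigenvector_exists[OF Mc] unitary_repD(1)[OF U] by metis
  let ?W = "{v \<in> carrier_vec ?n. M *\<^sub>v v = c \<cdot>\<^sub>v v}"
  have "?W \<noteq> {0\<^sub>v ?n}" using v by blast
  moreover have "?W \<noteq> carrier_vec ?n"
  proof
    assume all: "?W = carrier_vec ?n"
    have "M = c \<cdot>\<^sub>m 1\<^sub>m ?n"
    proof (rule mat_eq_by_vec[OF Mc])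
      fix u :: "complex vec" assume u: "u \<in> carrier_vec ?n"
      then have "M *\<^sub>v u = c \<cdot>\<^sub>v u" using all by blast
      moreover have "(c \<cdot>\<^sub>m 1\<^sub>m ?n) *\<^sub>v u = c \<cdot>\<^sub>v u" using u by (intro eq_vecI) auto
      ultimately show "M *\<^sub>v u = (c \<cdot>\<^sub>m 1\<^sub>m ?n) *\<^sub>v u" by simp
    qed simp
    then show False using M(2) by blast
  qed
  ultimately show thesis using that[OF eigenspace_invariant[OF U M(1)]] by blast
qed

lemma schur_rep:
  assumes U: "irreducible_rep G T U" and M: "M \<in> rep_intertwiners G U U"
  obtains c where "M = c \<cdot>\<^sub>m 1\<^sub>m (rep_dim G U)"
  using nonscalar_eigenspace[OF _ M] U unfolding irreducible_rep_def by metis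

lemma invariant_subspace_vec_subspace: "invariant_subspace G U W \<Longrightarrow> vec_subspace (rep_dim G U) W"
  unfolding invariant_subspace_def vec_subspace_def by blast

section \<open>Transport of irreducibility and decompositions through the duality\<close>

locale dr_system = dr_category_with Obj intertwiners \<epsilon> + dr_duality G T Obj \<epsilon> Fo Fm J J\<^sub>0
  for Obj :: "('a::cstar_algebra \<Rightarrow> 'a) set" and \<epsilon> and G :: "('g, 'm) monoid_scheme" (structure)
    and T Fo Fm J J\<^sub>0
begin

abbreviation dm :: "('a \<Rightarrow> 'a) \<Rightarrow> nat" where "dm \<sigma> \<equiv> rep_dim G (Fo \<sigma>)"

lemma Fm_in: "\<sigma> \<in> Obj \<Longrightarrow> \<tau> \<in> Obj \<Longrightarrow> X \<in> intertwiners \<sigma> \<tau> \<Longrightarrow> Fm \<sigma> \<tau> X \<in> rep_intertwiners G (Fo \<sigma>) (Fo \<tau>)"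
  using bij_betwE[OF Fm_bij] by blast

lemma Fm_carrier: "\<sigma> \<in> Obj \<Longrightarrow> \<tau> \<in> Obj \<Longrightarrow> X \<in> intertwiners \<sigma> \<tau> \<Longrightarrow> Fm \<sigma> \<tau> X \<in> carrier_mat (dm \<tau>) (dm \<sigma>)"
  by (rule rep_intertwinersD(1)[OF Fm_in])

lemma Fm_inject:
  "\<sigma> \<in> Obj \<Longrightarrow> \<tau> \<in> Obj \<Longrightarrow> X \<in> intertwiners \<sigma> \<tau> \<Longrightarrow> Y \<in> intertwiners \<sigma> \<tau> \<Longrightarrow>
    Fm \<sigma> \<tau> X = Fm \<sigma> \<tau> Y \<longleftrightarrow> X = Y"
  using bij_betw_imp_inj_on[OF Fm_bij] by (meson inj_on_eq_iff)

lemma Fm_surj: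
  assumes "\<sigma> \<in> Obj" "\<tau> \<in> Obj" "M \<in> rep_intertwiners G (Fo \<sigma>) (Fo \<tau>)"
  obtains X where "X \<in> intertwiners \<sigma> \<tau>" "Fm \<sigma> \<tau> X = M"
proof -
  have "M \<in> Fm \<sigma> \<tau> ` intertwiners \<sigma> \<tau>"
    using bij_betw_imp_surj_on[OF Fm_bij[OF assms(1,2)]] assms(3) by simp
  then show thesis using that by blast
qed

lemma Fm_scalar: "\<sigma> \<in> Obj \<Longrightarrow> Fm \<sigma> \<sigma> (c *\<^sub>C 1) = c \<cdot>\<^sub>m 1\<^sub>m (dm \<sigma>)"
  by (simp add: Fm_scaleC intertwiners_one Fm_one)

text \<open>The orthogonal projection onto an invariant subspace is an intertwiner. Fullness of the
  functor gives a preimage, and faithfulness carries the projection equations over to it.\<close>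

lemma invariant_subspace_projection:
  assumes \<sigma>: "\<sigma> \<in> Obj" and W: "invariant_subspace G (Fo \<sigma>) W"
  obtains E where "E \<in> intertwiners \<sigma> \<sigma>" "projection E"
    "\<And>v. v \<in> carrier_vec (dm \<sigma>) \<Longrightarrow> Fm \<sigma> \<sigma> E *\<^sub>v v \<in> W" "\<And>v. v \<in> W \<Longrightarrow> Fm \<sigma> \<sigma> E *\<^sub>v v = v"
proof -
  obtain P where P: "P \<in> carrier_mat (dm \<sigma>) (dm \<sigma>)" "mat_adjoint P = P" "P * P = P"
    "\<And>v. v \<in> carrier_vec (dm \<sigma>) \<Longrightarrow> P *\<^sub>v v \<in> W" "\<And>v. v \<in> W \<Longrightarrow> P *\<^sub>v v = v"
    using orthogonal_projection_exists[OF invariant_subspace_vec_subspace[OF W]] by metis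
  obtain E where E: "E \<in> intertwiners \<sigma> \<sigma>" "Fm \<sigma> \<sigma> E = P"
    using Fm_surj[OF \<sigma> \<sigma> projection_intertwiner[OF Fo_rep[OF \<sigma>] W P(1,2,4,5)]] by metis
  have EE: "E * E \<in> intertwiners \<sigma> \<sigma>" "E\<^sup>\<star> \<in> intertwiners \<sigma> \<sigma>"
    by (rule intertwiners_mult[OF E(1) E(1)], rule arr_star[OF \<sigma> \<sigma> E(1)])
  have "E * E = E"
    using Fm_inject[OF \<sigma> \<sigma> EE(1) E(1)] Fm_comp[OF \<sigma> \<sigma> \<sigma> E(1) E(1)] E(2) P(3) by simp
  moreover have "E\<^sup>\<star> = E"
    using Fm_inject[OF \<sigma> \<sigma> EE(2) E(1)] Fm_star[OF \<sigma> \<sigma> E(1)] E(2) P(2) by simp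
  ultimately show thesis
    using that[of E] E P(4,5) unfolding projection_def by simp
qed

text \<open>An invariant subspace yields a projection of the irreducible object, hence a scalar
  \<open>c\<close> with \<open>c * c = c\<close>; the values 0 and 1 give the two trivial
  subspaces.\<close>

lemma irreducible_rep_Fo:
  assumes \<rho>: "\<rho> \<in> Obj" "irreducible_endo \<rho>"
  shows "irreducible_rep G T (Fo \<rho>)"
  unfolding irreducible_rep_def
proof (intro conjI allI impI Fo_rep[OF \<rho>(1)])
  fix W assume W: "invariant_subspace G (Fo \<rho>) W"
  obtain E where E: "E \<in> intertwiners \<rho> \<rho>" "projection E"
    "\<And>v. v \<in> carrier_vec (dm \<rho>) \<Longrightarrow> Fm \<rho> \<rho> E *\<^sub>v v \<in> W" "\<And>v. v \<in> W \<Longrightarrow> Fm \<rho> \<rho> E *\<^sub>v v = v"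
    using invariant_subspace_projection[OF \<rho>(1) W] by metis
  have Wc: "W \<subseteq> carrier_vec (dm \<rho>)" "0\<^sub>v (dm \<rho>) \<in> W" using W unfolding invariant_subspace_def by blast+
  obtain c where c: "E = c *\<^sub>C 1" using irreducible_endoD[OF \<rho>(2) E(1)] by (rule scalarsE)
  have "(c * c - c) *\<^sub>C (1 :: 'a) = 0"
    using E(2) unfolding c projection_def by (simp add: scaleC_one_mult scaleC_scaleC scaleC_diff_left)
  then have "c = 0 \<or> c = 1" using scaleC_eq_0_iff[of "c * c - c" "1 :: 'a"] by auto
  then have "Fm \<rho> \<rho> E = 0 \<cdot>\<^sub>m 1\<^sub>m (dm \<rho>) \<or> Fm \<rho> \<rho> E = 1 \<cdot>\<^sub>m 1\<^sub>m (dm \<rho>)"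
    unfolding c using Fm_scalar[OF \<rho>(1)] by blast
  then show "W = {0\<^sub>v (dm \<rho>)} \<or> W = carrier_vec (dm \<rho>)"
  proof
    assume 0: "Fm \<rho> \<rho> E = 0 \<cdot>\<^sub>m 1\<^sub>m (dm \<rho>)"
    have "v = 0\<^sub>v (dm \<rho>)" if v: "v \<in> W" for v
    proof -
      have "v \<in> carrier_vec (dm \<rho>)" using v Wc by blast
      then have "(0 \<cdot>\<^sub>m 1\<^sub>m (dm \<rho>)) *\<^sub>v v = 0\<^sub>v (dm \<rho>)" by (intro eq_vecI) auto
      then show ?thesis using E(4)[OF v] unfolding 0 by simp
    qed
    then show ?thesis using Wc by blast
  next
    assume 1: "Fm \<rho> \<rho> E = 1 \<cdot>\<^sub>m 1\<^sub>m (dm \<rho>)"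
    have "v \<in> W" if v: "v \<in> carrier_vec (dm \<rho>)" for v
    proof -
      have "1 \<cdot>\<^sub>m 1\<^sub>m (dm \<rho>) = (1\<^sub>m (dm \<rho>) :: complex mat)" by (rule eq_matI) auto
      then show ?thesis using E(3)[OF v] v unfolding 1 by simp
    qed
    then show ?thesis using Wc by blast
  qed
qed

lemma Fm_nonscalar:
  assumes \<sigma>: "\<sigma> \<in> Obj" and X: "X \<in> intertwiners \<sigma> \<sigma>" "X \<notin> scalars"
  shows "Fm \<sigma> \<sigma> X \<noteq> c \<cdot>\<^sub>m 1\<^sub>m (dm \<sigma>)"
proof
  assume "Fm \<sigma> \<sigma> X = c \<cdot>\<^sub>m 1\<^sub>m (dm \<sigma>)"
  then have "X = c *\<^sub>C 1"
    by (intro iffD1[OF Fm_inject[OF \<sigma> \<sigma> X(1) intertwiners_scaleC[OF intertwiners_one]]])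
      (simp add: Fm_scalar[OF \<sigma>])
  then show False using X(2) scalarsI by blast
qed

lemma scalars_subset_intertwiners: "scalars \<subseteq> intertwiners \<sigma> \<sigma>"
  unfolding scalars_def using intertwiners_scaleC[OF intertwiners_one] by blast

text \<open>A non-scalar self-intertwiner of \<sigma> would become, after conjugation by the unitary
  equivalence, a non-scalar self-intertwiner of \<open>U\<close>. This lets every class in the dual
  be represented by an irreducible object.\<close>

lemma irreducible_endo_if_rep:
  assumes \<sigma>: "\<sigma> \<in> Obj" and U: "irreducible_rep G T U" and eq: "equivalent_rep G (Fo \<sigma>) U"
  shows "irreducible_endo \<sigma>"
proof (rule ccontr)
  assume "\<not> irreducible_endo \<sigma>"
  then obtain X where X: "X \<in> intertwiners \<sigma> \<sigma>" "X \<notin> scalars"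
    unfolding irreducible_endo_def using scalars_subset_intertwiners by blast
  let ?M = "Fm \<sigma> \<sigma> X"
  have rU: "unitary_rep G T U" using U unfolding irreducible_rep_def by blast
  note rF = Fo_rep[OF \<sigma>] and M = Fm_in[OF \<sigma> \<sigma> X(1)]
  obtain K where K: "K \<in> rep_intertwiners G (Fo \<sigma>) U" "unitary_mat K"
    using eq unfolding equivalent_rep_def by blast
  note Kc = rep_intertwinersD(1)[OF K(1)] and Mc = rep_intertwinersD(1)[OF M]
  note Ka = mat_adjoint_carrier[OF Kc]
  note Ku = unitary_matD[OF K(2) Kc]
  have "K * ?M * mat_adjoint K \<in> rep_intertwiners G U U"
    by (rule rep_intertwiners_mult[OF rU rF rU rep_intertwiners_adjoint[OF rF rU K(1)]
        rep_intertwiners_mult[OF rF rF rU M K(1)]])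
  then obtain c where c: "K * ?M * mat_adjoint K = c \<cdot>\<^sub>m 1\<^sub>m (rep_dim G U)" by (rule schur_rep[OF U])
  have "?M = mat_adjoint K * (K * ?M * mat_adjoint K) * K"
    using Kc Ka Mc Ku by (simp add: assoc_mult_mat[of _ "dm \<sigma>" "dm \<sigma>" _ "dm \<sigma>" _ "dm \<sigma>"] flip:
      assoc_mult_mat[of "mat_adjoint K" "dm \<sigma>" "dm \<sigma>" K "dm \<sigma>" _ "dm \<sigma>"])
  also have "\<dots> = c \<cdot>\<^sub>m 1\<^sub>m (dm \<sigma>)"
    unfolding c using Kc Ka Ku by (simp add: mult_smult_distrib[of _ "dm \<sigma>" "dm \<sigma>" _ "dm \<sigma>"]
      mult_smult_assoc_mat[of _ "dm \<sigma>" "dm \<sigma>" _ "dm \<sigma>"])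
  finally show False using Fm_nonscalar[OF \<sigma> X] by blast
qed

text \<open>Cyclicity of the trace exchanges the range projection of \<open>V\<close> with the unit
  of \<tau>. This is how dimensions of subobjects are added up in
  \<open>reducible_split\<close>.\<close>

lemma dm_isometry:
  assumes "\<tau> \<in> Obj" "\<sigma> \<in> Obj" "V \<in> intertwiners \<tau> \<sigma>" "isometry V"
  shows "tr (Fm \<sigma> \<sigma> (V * V\<^sup>\<star>)) = of_nat (dm \<tau>)"
proof -
  note V = Fm_carrier[OF assms(1-3)] and Vs = arr_star[OF assms(1-3)]
  note Vs' = Fm_carrier[OF assms(2,1) Vs]
  have "tr (Fm \<sigma> \<sigma> (V * V\<^sup>\<star>)) = tr (Fm \<tau> \<sigma> V * Fm \<sigma> \<tau> (V\<^sup>\<star>))"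
    using Fm_comp[OF assms(2,1,2) Vs assms(3)] by simp
  also have "\<dots> = tr (Fm \<sigma> \<tau> (V\<^sup>\<star>) * Fm \<tau> \<sigma> V)" by (rule tr_mult_commute[OF V Vs'])
  also have "\<dots> = tr (Fm \<tau> \<tau> (V\<^sup>\<star> * V))" using Fm_comp[OF assms(1,2,1) assms(3) Vs] by simp
  finally show ?thesis using assms(4) Fm_one[OF assms(1)] by (simp add: isometry_def tr_one)
qed

text \<open>A proper eigenspace gives a projection \<open>E\<close> other than 0 and 1, and
  \<open>E\<close> and \<open>1 - E\<close> are realised by subobjects. Their dimensions add up to
  that of \<sigma>, and both are positive since the zero representation is excluded; so both are
  smaller.\<close>

lemma reducible_split:
  assumes \<sigma>: "\<sigma> \<in> Obj" and red: "\<not> irreducible_endo \<sigma>"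
  obtains \<tau>\<^sub>1 \<tau>\<^sub>2 V\<^sub>1 V\<^sub>2 where "\<tau>\<^sub>1 \<in> Obj" "\<tau>\<^sub>2 \<in> Obj" "V\<^sub>1 \<in> intertwiners \<tau>\<^sub>1 \<sigma>" "V\<^sub>2 \<in> intertwiners \<tau>\<^sub>2 \<sigma>"
    "isometry V\<^sub>1" "isometry V\<^sub>2" "V\<^sub>1 * V\<^sub>1\<^sup>\<star> + V\<^sub>2 * V\<^sub>2\<^sup>\<star> = 1" "dm \<tau>\<^sub>1 < dm \<sigma>" "dm \<tau>\<^sub>2 < dm \<sigma>"
proof -
  obtain X where "X \<in> intertwiners \<sigma> \<sigma>" "X \<notin> scalars"
    using red unfolding irreducible_endo_def using scalars_subset_intertwiners by blast
  then obtain W where W: "invariant_subspace G (Fo \<sigma>) W" "W \<noteq> {0\<^sub>v (dm \<sigma>)}" "W \<noteq> carrier_vec (dm \<sigma>)"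
    using nonscalar_eigenspace[OF Fo_rep[OF \<sigma>] Fm_in[OF \<sigma> \<sigma>]] Fm_nonscalar[OF \<sigma>] by metis
  have Wc: "W \<subseteq> carrier_vec (dm \<sigma>)" "0\<^sub>v (dm \<sigma>) \<in> W" using W unfolding invariant_subspace_def by blast+
  obtain E where E: "E \<in> intertwiners \<sigma> \<sigma>" "projection E"
    "\<And>v. v \<in> carrier_vec (dm \<sigma>) \<Longrightarrow> Fm \<sigma> \<sigma> E *\<^sub>v v \<in> W" "\<And>v. v \<in> W \<Longrightarrow> Fm \<sigma> \<sigma> E *\<^sub>v v = v"
    using invariant_subspace_projection[OF \<sigma> W(1)] by metis
  have "E \<noteq> 0"
  proof
    assume "E = 0"
    then have 0: "Fm \<sigma> \<sigma> E = 0 \<cdot>\<^sub>m 1\<^sub>m (dm \<sigma>)" using Fm_scalar[OF \<sigma>, of 0] by simp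
    have "v = 0\<^sub>v (dm \<sigma>)" if v: "v \<in> W" for v
    proof -
      have "v \<in> carrier_vec (dm \<sigma>)" using v Wc by blast
      then have "(0 \<cdot>\<^sub>m 1\<^sub>m (dm \<sigma>)) *\<^sub>v v = 0\<^sub>v (dm \<sigma>)" by (intro eq_vecI) auto
      then show ?thesis using E(4)[OF v] unfolding 0 by simp
    qed
    then show False using Wc W(2) by blast
  qed
  have "E \<noteq> 1"
  proof
    assume "E = 1"
    then have "v \<in> W" if "v \<in> carrier_vec (dm \<sigma>)" for v using E(3)[OF that] that Fm_one[OF \<sigma>] by simp
    then show False using Wc(1) W(3) by blast
  qed
  have E': "1 - E \<in> intertwiners \<sigma> \<sigma>" "projection (1 - E)" "1 - E \<noteq> 0"
    using module.subspace_diff[OF module_scaleC csubspace_intertwiners intertwiners_one E(1)] E(2) \<open>E \<noteq> 1\<close>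
    by (auto simp: projection_def star_diff algebra_simps)
  obtain \<tau>\<^sub>1 V\<^sub>1 where 1: "\<tau>\<^sub>1 \<in> Obj" "V\<^sub>1 \<in> intertwiners \<tau>\<^sub>1 \<sigma>" "isometry V\<^sub>1" "V\<^sub>1 * V\<^sub>1\<^sup>\<star> = E"
    using subobjects[OF \<sigma> E(1,2) \<open>E \<noteq> 0\<close>] by blast
  obtain \<tau>\<^sub>2 V\<^sub>2 where 2: "\<tau>\<^sub>2 \<in> Obj" "V\<^sub>2 \<in> intertwiners \<tau>\<^sub>2 \<sigma>" "isometry V\<^sub>2" "V\<^sub>2 * V\<^sub>2\<^sup>\<star> = 1 - E"
    using subobjects[OF \<sigma> E'] by blast
  have "Fm \<sigma> \<sigma> (E + (1 - E)) = Fm \<sigma> \<sigma> E + Fm \<sigma> \<sigma> (1 - E)" by (rule Fm_add[OF \<sigma> \<sigma> E(1) E'(1)])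
  then have "tr (Fm \<sigma> \<sigma> 1) = tr (Fm \<sigma> \<sigma> E) + tr (Fm \<sigma> \<sigma> (1 - E))"
    using tr_add[OF Fm_carrier[OF \<sigma> \<sigma> E(1)] Fm_carrier[OF \<sigma> \<sigma> E'(1)]] by simp
  then have "(of_nat (dm \<sigma>) :: complex) = of_nat (dm \<tau>\<^sub>1) + of_nat (dm \<tau>\<^sub>2)"
    using dm_isometry[OF 1(1) \<sigma> 1(2,3)] dm_isometry[OF 2(1) \<sigma> 2(2,3)] Fm_one[OF \<sigma>]
    unfolding 1(4) 2(4) by (simp add: tr_one)
  then have "dm \<sigma> = dm \<tau>\<^sub>1 + dm \<tau>\<^sub>2" by (metis of_nat_add of_nat_eq_iff)
  moreover have "dm \<tau>\<^sub>1 > 0" "dm \<tau>\<^sub>2 > 0" using unitary_repD(1)[OF Fo_rep] 1(1) 2(1) by auto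
  ultimately have "dm \<tau>\<^sub>1 < dm \<sigma>" "dm \<tau>\<^sub>2 < dm \<sigma>" by simp_all
  then show thesis using that[OF 1(1) 2(1) 1(2) 2(2) 1(3) 2(3)] 1(4) 2(4) by simp
qed

text \<open>Induction on the dimension of the representation: the frames of the two smaller summands
  are pushed into \<sigma> along the isometries that embed them.\<close>

lemma frame_exists:
  assumes "\<sigma> \<in> Obj"
  shows "\<exists>Q. frame Obj \<sigma> Q"
  using assms
proof (induction "dm \<sigma>" arbitrary: \<sigma> rule: less_induct)
  case less
  show ?case
  proof (cases "irreducible_endo \<sigma>")
    case True
    have c: "component \<sigma> 1 = \<sigma>" unfolding component_def by simp
    have "frame Obj \<sigma> {1}"
      unfolding frame_def orthonormal_def by (auto simp: c less.prems True intertwiners_one)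
    then show ?thesis by blast
  next
    case False
    then obtain \<tau>\<^sub>1 \<tau>\<^sub>2 V\<^sub>1 V\<^sub>2 where s: "\<tau>\<^sub>1 \<in> Obj" "\<tau>\<^sub>2 \<in> Obj" "V\<^sub>1 \<in> intertwiners \<tau>\<^sub>1 \<sigma>" "V\<^sub>2 \<in> intertwiners \<tau>\<^sub>2 \<sigma>"
      "isometry V\<^sub>1" "isometry V\<^sub>2" "V\<^sub>1 * V\<^sub>1\<^sup>\<star> + V\<^sub>2 * V\<^sub>2\<^sup>\<star> = 1" "dm \<tau>\<^sub>1 < dm \<sigma>" "dm \<tau>\<^sub>2 < dm \<sigma>"
      by (rule reducible_split[OF less.prems])
    obtain Q1 Q2 where Q1: "frame Obj \<tau>\<^sub>1 Q1" and Q2: "frame Obj \<tau>\<^sub>2 Q2"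
      using less.hyps[OF s(8) s(1)] less.hyps[OF s(9) s(2)] by blast
    have i: "V\<^sub>1\<^sup>\<star> * V\<^sub>1 = 1" "V\<^sub>2\<^sup>\<star> * V\<^sub>2 = 1" using s(5,6) unfolding isometry_def by auto
    \<comment> \<open>Multiplying the completeness relation from both sides gives
      \<open>x = x + x\<close> for \<open>x = V\<^sub>1\<^sup>\<star> * V\<^sub>2\<close>, so the
      two ranges are orthogonal.\<close>
    have "V\<^sub>1\<^sup>\<star> * (V\<^sub>1 * V\<^sub>1\<^sup>\<star> + V\<^sub>2 * V\<^sub>2\<^sup>\<star>) * V\<^sub>2 = V\<^sub>1\<^sup>\<star> * V\<^sub>2 + V\<^sub>1\<^sup>\<star> * V\<^sub>2"
      using i by (simp add: distrib_left distrib_right mult.assoc) (simp add: mult.assoc[symmetric] i)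
    then have V12: "V\<^sub>1\<^sup>\<star> * V\<^sub>2 = 0" unfolding s(7) by simp
    then have V21: "V\<^sub>2\<^sup>\<star> * V\<^sub>1 = 0" using star_mult[of "V\<^sub>1\<^sup>\<star>" V\<^sub>2] by (simp add: star_star)
    have comp: "component \<sigma> (V * W) = component \<tau> W" "(V * W)\<^sup>\<star> * (V * W') = W\<^sup>\<star> * W'"
      if "V\<^sup>\<star> * V = 1" "V \<in> intertwiners \<tau> \<sigma>" for V W W' \<tau>
    proof
      have *: "V\<^sup>\<star> * (V * y) = y" for y using that(1) by (simp flip: mult.assoc)
      show "component \<sigma> (V * W) x = component \<tau> W x" for x
      proof -
        have "component \<sigma> (V * W) x = W\<^sup>\<star> * (V\<^sup>\<star> * ((\<sigma> x * V) * W))"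
          by (simp only: component_def star_mult mult.assoc)
        also have "\<sigma> x * V = V * \<tau> x" using intertwinersD[OF that(2)] by simp
        finally show ?thesis by (simp only: component_def * mult.assoc)
      qed
      show "(V * W)\<^sup>\<star> * (V * W') = W\<^sup>\<star> * W'" by (simp add: star_mult mult.assoc *)
    qed
    have cross: "(V\<^sub>1 * W)\<^sup>\<star> * (V\<^sub>2 * W') = 0" "(V\<^sub>2 * W')\<^sup>\<star> * (V\<^sub>1 * W) = 0" for W W'
      by (simp_all add: star_mult mult.assoc) (simp_all add: mult.assoc[symmetric] V12 V21)
    let ?Q = "(*) V\<^sub>1 ` Q1 \<union> (*) V\<^sub>2 ` Q2"
    note o1 = orthonormalD[OF frameD(1)[OF Q1]] and o2 = orthonormalD[OF frameD(1)[OF Q2]]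
    have inj': "inj ((*) V)" if "V\<^sup>\<star> * V = 1" for V :: 'a
    proof (rule injI)
      fix x y assume "V * x = V * y"
      then have "V\<^sup>\<star> * V * x = V\<^sup>\<star> * V * y" by (simp add: mult.assoc)
      then show "x = y" unfolding that by simp
    qed
    note inj = inj'[OF i(1)] inj'[OF i(2)]
    have disj: "(*) V\<^sub>1 ` Q1 \<inter> (*) V\<^sub>2 ` Q2 = {}"
    proof (rule equals0I)
      fix y assume "y \<in> (*) V\<^sub>1 ` Q1 \<inter> (*) V\<^sub>2 ` Q2"
      then obtain W W' where W: "W \<in> Q1" "y = V\<^sub>1 * W" "y = V\<^sub>2 * W'" by blast
      have "1 = W\<^sup>\<star> * W" using o1(2)[OF W(1) W(1)] by simp
      also have "\<dots> = (V\<^sub>1 * W)\<^sup>\<star> * (V\<^sub>1 * W)" using comp(2)[OF i(1) s(3)] by simp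
      also have "\<dots> = (V\<^sub>1 * W)\<^sup>\<star> * (V\<^sub>2 * W')" using W by simp
      finally show False using cross(1)[of W W'] by simp
    qed
    have "orthonormal ?Q"
      unfolding orthonormal_def
    proof (intro conjI ballI)
      show "finite ?Q" using o1(1) o2(1) by simp
      have part: "(\<Sum>W\<in>(*) V ` P. W * W\<^sup>\<star>) = V * V\<^sup>\<star>" if "inj ((*) V)" "(\<Sum>W\<in>P. W * W\<^sup>\<star>) = 1" for V and P :: "'a set"
      proof -
        have "(\<Sum>W\<in>(*) V ` P. W * W\<^sup>\<star>) = (\<Sum>W\<in>P. V * (W * W\<^sup>\<star>) * V\<^sup>\<star>)"
          using that(1) by (subst sum.reindex) (auto simp: star_mult mult.assoc intro: inj_on_subset)
        then show ?thesis using that(2) by (simp flip: sum_distrib_left sum_distrib_right)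
      qed
      have "(\<Sum>V\<in>?Q. V * V\<^sup>\<star>) = V\<^sub>1 * V\<^sub>1\<^sup>\<star> + V\<^sub>2 * V\<^sub>2\<^sup>\<star>"
        using part[OF inj(1) o1(3)] part[OF inj(2) o2(3)] o1(1) o2(1) disj by (subst sum.union_disjoint) auto
      then show "(\<Sum>V\<in>?Q. V * V\<^sup>\<star>) = 1" using s(7) by simp
      fix V W assume "V \<in> ?Q" "W \<in> ?Q"
      then consider A B where "V = V\<^sub>1 * A" "W = V\<^sub>1 * B" "A \<in> Q1" "B \<in> Q1"
        | A B where "V = V\<^sub>2 * A" "W = V\<^sub>2 * B" "A \<in> Q2" "B \<in> Q2"
        | A B where "V = V\<^sub>1 * A" "W = V\<^sub>2 * B" "V \<noteq> W"
        | A B where "V = V\<^sub>2 * A" "W = V\<^sub>1 * B" "V \<noteq> W"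
        using disj by blast
      then show "V\<^sup>\<star> * W = (if V = W then 1 else 0)"
      proof cases
        case 1
        then show ?thesis using o1(2) by (simp add: comp(2)[OF i(1) s(3)] inj_eq[OF inj(1)])
      next
        case 2
        then show ?thesis using o2(2) by (simp add: comp(2)[OF i(2) s(4)] inj_eq[OF inj(2)])
      next
        case 3
        then show ?thesis using cross(1) by simp
      next
        case 4
        then show ?thesis using cross(2) by simp
      qed
    qed
    moreover have "component \<sigma> V \<in> Obj \<and> irreducible_endo (component \<sigma> V) \<and> V \<in> intertwiners (component \<sigma> V) \<sigma>"
      if "V \<in> ?Q" for V
      using that frameD(2-4)[OF Q1] frameD(2-4)[OF Q2] intertwiners_mult[OF _ s(3)] intertwiners_mult[OF _ s(4)]
      by (auto simp: comp(1)[OF i(1) s(3)] comp(1)[OF i(2) s(4)])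
    ultimately have "frame Obj \<sigma> ?Q" unfolding frame_def by blast
    then show ?thesis by blast
  qed
qed

end

section \<open>Kronecker products\<close>

text \<open>In a Kronecker product the pair \<open>(i, j)\<close> has the index
  \<open>i * n + j\<close>; the sum is split into blocks of length \<open>n\<close>.\<close>

lemma sum_div_mod:
  fixes f :: "nat \<Rightarrow> nat \<Rightarrow> 'b::comm_monoid_add"
  shows "(\<Sum>k<m * n. f (k div n) (k mod n)) = (\<Sum>i<m. \<Sum>j<n. f i j)"
proof -
  have "(\<Sum>k\<in>{i * n..<i * n + n}. f (k div n) (k mod n)) = (\<Sum>j<n. f i j)" for i
  proof (rule sum.reindex_bij_witness[of _ "\<lambda>j. i * n + j" "\<lambda>k. k - i * n"])
    fix k assume k: "k \<in> {i * n..<i * n + n}"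
    then have "k div n = i" by (intro div_nat_eqI) (auto simp: mult.commute)
    moreover from this have "k mod n = k - i * n" by (simp add: mult.commute flip: minus_mult_div_eq_mod)
    ultimately show "f i (k - i * n) = f (k div n) (k mod n)" by simp
  qed auto
  then show ?thesis using sum.nat_group[of "\<lambda>k. f (k div n) (k mod n)" n m] by simp
qed

lemma kronecker_carrier:
  "A \<in> carrier_mat r c \<Longrightarrow> B \<in> carrier_mat r' c' \<Longrightarrow> kronecker A B \<in> carrier_mat (r * r') (c * c')"
  unfolding kronecker_def by auto

lemma kronecker_index:
  assumes "A \<in> carrier_mat r c" "B \<in> carrier_mat r' c'" "i < r * r'" "j < c * c'"
  shows "kronecker A B $$ (i, j) = A $$ (i div r', j div c') * B $$ (i mod r', j mod c')"
  using assms unfolding kronecker_def by auto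

lemma div_mod_less:
  assumes "(i :: nat) < r * r'"
  shows "i div r' < r" "i mod r' < r'"
  using assms less_mult_imp_div_less by (blast, cases "r' = 0", simp_all)

lemma kronecker_mult:
  assumes A: "A \<in> carrier_mat r m" and B: "B \<in> carrier_mat r' m'"
    and C: "C \<in> carrier_mat m c" and D: "D \<in> carrier_mat m' c'"
  shows "kronecker A B * kronecker C D = kronecker (A * C) (B * D)"
proof (rule eq_matI)
  note AB = kronecker_carrier[OF A B] and CD = kronecker_carrier[OF C D]
  have AC: "A * C \<in> carrier_mat r c" and BD: "B * D \<in> carrier_mat r' c'" using assms by simp_all
  fix i j assume "i < dim_row (kronecker (A * C) (B * D))" "j < dim_col (kronecker (A * C) (B * D))"
  then have ij: "i < r * r'" "j < c * c'" using kronecker_carrier[OF AC BD] by auto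
  note i = div_mod_less[OF ij(1)] and j = div_mod_less[OF ij(2)]
  have "(kronecker A B * kronecker C D) $$ (i, j) = (\<Sum>k<m * m'. A $$ (i div r', k div m') * B $$ (i mod r', k mod m') *
      (C $$ (k div m', j div c') * D $$ (k mod m', j mod c')))"
    unfolding mult_mat_index[OF AB CD ij]
    by (intro sum.cong refl) (simp add: kronecker_index[OF A B ij(1)] kronecker_index[OF C D _ ij(2)])
  also have "\<dots> = (\<Sum>p<m. \<Sum>q<m'. A $$ (i div r', p) * B $$ (i mod r', q) * (C $$ (p, j div c') * D $$ (q, j mod c')))"
    by (rule sum_div_mod)
  also have "\<dots> = (\<Sum>p<m. A $$ (i div r', p) * C $$ (p, j div c')) * (\<Sum>q<m'. B $$ (i mod r', q) * D $$ (q, j mod c'))"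
    by (simp add: sum_product mult_ac)
  also have "\<dots> = kronecker (A * C) (B * D) $$ (i, j)"
    unfolding kronecker_index[OF AC BD ij] mult_mat_index[OF A C i(1) j(1)] mult_mat_index[OF B D i(2) j(2)] ..
  finally show "(kronecker A B * kronecker C D) $$ (i, j) = kronecker (A * C) (B * D) $$ (i, j)" .
qed (use assms in \<open>auto simp: kronecker_def\<close>)

lemma kronecker_adjoint: "mat_adjoint (kronecker A B) = kronecker (mat_adjoint A) (mat_adjoint B)"
  by (rule eq_matI) (auto simp: kronecker_def div_mod_less)

lemma kronecker_one: "kronecker (1\<^sub>m m) (1\<^sub>m n) = 1\<^sub>m (m * n)"
proof (rule eq_matI)
  fix i j assume "i < dim_row (1\<^sub>m (m * n))" "j < dim_col (1\<^sub>m (m * n))"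
  then have ij: "i < m * n" "j < m * n" by auto
  have "i = j" if "i div n = j div n" "i mod n = j mod n" using that by (metis div_mult_mod_eq)
  then show "kronecker (1\<^sub>m m) (1\<^sub>m n) $$ (i, j) = (1\<^sub>m (m * n) :: complex mat) $$ (i, j)"
    using ij div_mod_less[OF ij(1)] div_mod_less[OF ij(2)] by (auto simp: kronecker_def)
qed (auto simp: kronecker_def)

lemma unitary_mat_kronecker:
  assumes "unitary_mat A" "unitary_mat B"
  shows "unitary_mat (kronecker A B)"
proof -
  define n n' where "n = dim_row A" and "n' = dim_row B"
  have A: "A \<in> carrier_mat n n" and B: "B \<in> carrier_mat n' n'"
    using assms unfolding unitary_mat_def n_def n'_def by auto
  note uA = unitary_matD[OF assms(1) A] and uB = unitary_matD[OF assms(2) B]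
  note aA = mat_adjoint_carrier[OF A] and aB = mat_adjoint_carrier[OF B]
  show ?thesis
    unfolding unitary_mat_def kronecker_adjoint kronecker_mult[OF A B aA aB] kronecker_mult[OF aA aB A B] uA(2,3) uB(2,3)
      kronecker_one using kronecker_carrier[OF A B] by auto
qed

lemma rep_dim_tensor [simp]: "rep_dim G (tensor_rep U V) = rep_dim G U * rep_dim G V"
  unfolding rep_dim_def tensor_rep_def kronecker_def by simp

lemma continuous_map_complex_mult:
  fixes f g :: "'g \<Rightarrow> complex"
  shows "continuous_map T euclidean f \<Longrightarrow> continuous_map T euclidean g \<Longrightarrow> continuous_map T euclidean (\<lambda>x. f x * g x)"
  by (simp add: continuous_map_atin tendsto_mult)

lemma (in compact_group) unitary_rep_tensor:
  assumes U: "unitary_rep G T U" and V: "unitary_rep G T V"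
  shows "unitary_rep G T (tensor_rep U V)"
  unfolding unitary_rep_def
proof (intro conjI ballI allI impI)
  note uU = unitary_repD[OF U] and uV = unitary_repD[OF V]
  show "0 < rep_dim G (tensor_rep U V)" using uU(1) uV(1) by simp
  fix g assume g: "g \<in> carrier G"
  show "tensor_rep U V g \<in> carrier_mat (rep_dim G (tensor_rep U V)) (rep_dim G (tensor_rep U V))"
    unfolding rep_dim_tensor unfolding tensor_rep_def by (rule kronecker_carrier[OF uU(2)[OF g] uV(2)[OF g]])
  show "unitary_mat (tensor_rep U V g)"
    unfolding tensor_rep_def by (rule unitary_mat_kronecker[OF uU(3)[OF g] uV(3)[OF g]])
  fix h assume h: "h \<in> carrier G"
  show "tensor_rep U V (g \<otimes> h) = tensor_rep U V g * tensor_rep U V h"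
    unfolding tensor_rep_def uU(4)[OF g h] uV(4)[OF g h]
    by (rule kronecker_mult[OF uU(2)[OF g] uV(2)[OF g] uU(2)[OF h] uV(2)[OF h], symmetric])
next
  fix i j assume "i < rep_dim G (tensor_rep U V)" "j < rep_dim G (tensor_rep U V)"
  then have ij: "i < rep_dim G U * rep_dim G V" "j < rep_dim G U * rep_dim G V" by simp_all
  note i = div_mod_less[OF ij(1)] and j = div_mod_less[OF ij(2)]
  have "continuous_map T euclidean (\<lambda>g. U g $$ (i div rep_dim G V, j div rep_dim G V) * V g $$ (i mod rep_dim G V, j mod rep_dim G V))"
    using U V i j unfolding unitary_rep_def by (intro continuous_map_complex_mult) blast+
  then show "continuous_map T euclidean (\<lambda>g. tensor_rep U V g $$ (i, j))"
    by (rule continuous_map_eq)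
      (simp add: topspace_eq tensor_rep_def kronecker_index[OF unitary_repD(2)[OF U] unitary_repD(2)[OF V] ij])
qed

lemma (in compact_group) rep_intertwiners_kronecker:
  assumes "unitary_rep G T U" "unitary_rep G T U'" "unitary_rep G T V" "unitary_rep G T V'"
    and "M \<in> rep_intertwiners G U U'" "N \<in> rep_intertwiners G V V'"
  shows "kronecker M N \<in> rep_intertwiners G (tensor_rep U V) (tensor_rep U' V')"
proof -
  note M = rep_intertwinersD[OF assms(5)] and N = rep_intertwinersD[OF assms(6)]
  note c = unitary_repD(2)[OF assms(1)] unitary_repD(2)[OF assms(2)] unitary_repD(2)[OF assms(3)] unitary_repD(2)[OF assms(4)]
  have "kronecker M N * kronecker (U g) (V g) = kronecker (U' g) (V' g) * kronecker M N" if g: "g \<in> carrier G" for g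
    unfolding kronecker_mult[OF M(1) N(1) c(1)[OF g] c(3)[OF g]] kronecker_mult[OF c(2)[OF g] c(4)[OF g] M(1) N(1)]
    by (simp add: M(2) N(2) g)
  then show ?thesis
    using kronecker_carrier[OF M(1) N(1)]
    unfolding rep_intertwiners_def rep_dim_tensor unfolding tensor_rep_def by simp
qed

section \<open>Equivalence of representations\<close>

lemma equivalent_rep_refl: "unitary_rep G T U \<Longrightarrow> equivalent_rep G U U"
  unfolding equivalent_rep_def using rep_intertwiners_one unitary_mat_one by blast

lemma (in group) equivalent_rep_sym:
  assumes "unitary_rep G T U" "unitary_rep G T V" "equivalent_rep G U V"
  shows "equivalent_rep G V U"
proof -
  obtain K where K: "K \<in> rep_intertwiners G U V" "unitary_mat K"
    using assms(3) unfolding equivalent_rep_def by blast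
  note Kc = rep_intertwinersD(1)[OF K(1)]
  note u = unitary_matD[OF K(2) Kc]
  have "unitary_mat (mat_adjoint K)"
    unfolding unitary_mat_def using u Kc by auto
  then show ?thesis
    unfolding equivalent_rep_def using rep_intertwiners_adjoint[OF assms(1,2) K(1)] by blast
qed

lemma unitary_mat_mult:
  assumes "unitary_mat A" "unitary_mat B" "A \<in> carrier_mat n n" "B \<in> carrier_mat n n"
  shows "unitary_mat (A * B)"
proof -
  note A = unitary_matD(2,3)[OF assms(1,3)] and B = unitary_matD(2,3)[OF assms(2,4)]
  note aA = mat_adjoint_carrier[OF assms(3)] and aB = mat_adjoint_carrier[OF assms(4)]
  have "mat_adjoint (A * B) * (A * B) = mat_adjoint B * (mat_adjoint A * A) * B"
    unfolding mat_adjoint_mult[OF assms(3,4)] using assms(3,4) aA aB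
    by (simp add: assoc_mult_mat[of _ n n _ n _ n])
  moreover have "(A * B) * mat_adjoint (A * B) = A * (B * mat_adjoint B) * mat_adjoint A"
    unfolding mat_adjoint_mult[OF assms(3,4)] using assms(3,4) aA aB
    by (simp add: assoc_mult_mat[of _ n n _ n _ n])
  ultimately show ?thesis
    unfolding unitary_mat_def using A B assms(3,4) aA aB by (auto simp: right_mult_one_mat[OF assms(3)] right_mult_one_mat[OF aB])
qed

lemma equivalent_rep_trans:
  assumes "unitary_rep G T U" "unitary_rep G T V" "unitary_rep G T W" "equivalent_rep G U V" "equivalent_rep G V W"
  shows "equivalent_rep G U W"
proof -
  obtain K where K: "K \<in> rep_intertwiners G U V" "unitary_mat K"
    using assms(4) unfolding equivalent_rep_def by blast
  obtain L where L: "L \<in> rep_intertwiners G V W" "unitary_mat L"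
    using assms(5) unfolding equivalent_rep_def by blast
  note Kc = rep_intertwinersD(1)[OF K(1)] and Lc = rep_intertwinersD(1)[OF L(1)]
  have "unitary_mat (L * K)"
    using unitary_mat_mult[OF L(2) K(2)] Kc Lc unitary_matD(1)[OF K(2) Kc] unitary_matD(1)[OF L(2) Lc] by simp
  then show ?thesis
    unfolding equivalent_rep_def using rep_intertwiners_mult[OF assms(1-3) K(1) L(1)] by blast
qed

lemma isometry_mat_mult:
  fixes A B :: "complex mat"
  assumes A: "A \<in> carrier_mat n m" "mat_adjoint A * A = 1\<^sub>m m"
    and B: "B \<in> carrier_mat p n" "mat_adjoint B * B = 1\<^sub>m n"
  shows "mat_adjoint (B * A) * (B * A) = 1\<^sub>m m"
proof -
  note aA = mat_adjoint_carrier[OF A(1)] and aB = mat_adjoint_carrier[OF B(1)]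
  have "mat_adjoint (B * A) * (B * A) = mat_adjoint A * (mat_adjoint B * (B * A))"
    unfolding mat_adjoint_mult[OF B(1) A(1)] by (rule assoc_mult_mat[OF aA aB mult_carrier_mat[OF B(1) A(1)]])
  also have "mat_adjoint B * (B * A) = A"
    using assoc_mult_mat[OF aB B(1) A(1)] B(2) left_mult_one_mat[OF A(1)] by simp
  finally show ?thesis using A(2) by simp
qed

section \<open>Chain classes of irreducible objects\<close>

context dr_system
begin

definition irr :: "('a \<Rightarrow> 'a) set" where
  "irr = {\<rho> \<in> Obj. irreducible_endo \<rho>}"

text \<open>The subobject relation. It is the counterpart, for objects, of a class occurring in a
  product of classes.\<close>

definition emb :: "('a \<Rightarrow> 'a) \<Rightarrow> ('a \<Rightarrow> 'a) \<Rightarrow> bool" where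
  "emb \<sigma> \<tau> \<longleftrightarrow> (\<exists>X\<in>intertwiners \<sigma> \<tau>. isometry X)"

definition cls :: "('a \<Rightarrow> 'a) \<Rightarrow> 'g rep set" where
  "cls \<rho> = rep_class G T (Fo \<rho>)"

lemma irrD: "\<rho> \<in> irr \<Longrightarrow> \<rho> \<in> Obj" "\<rho> \<in> irr \<Longrightarrow> irreducible_endo \<rho>" "\<rho> \<in> irr \<Longrightarrow> unital_star_hom \<rho>"
  unfolding irr_def using obj_hom by auto

lemma id_irr: "id \<in> irr"
  unfolding irr_def irreducible_endo_def using obj_id unit_irreducible by simp

lemma emb_trans:
  assumes "emb \<sigma> \<tau>" "emb \<tau> \<upsilon>"
  shows "emb \<sigma> \<upsilon>"
proof -
  obtain X Y where XY: "X \<in> intertwiners \<sigma> \<tau>" "isometry X" "Y \<in> intertwiners \<tau> \<upsilon>" "isometry Y"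
    using assms unfolding emb_def by blast
  have "(Y * X)\<^sup>\<star> * (Y * X) = X\<^sup>\<star> * (Y\<^sup>\<star> * Y) * X" by (simp add: star_mult mult.assoc)
  then have "isometry (Y * X)" using XY unfolding isometry_def by simp
  then show ?thesis unfolding emb_def using intertwiners_mult[OF XY(1,3)] by blast
qed

lemma emb_tensor:
  assumes "unital_star_hom \<sigma>" "emb \<sigma> \<sigma>'" "emb \<tau> \<tau>'"
  shows "emb (\<sigma> \<circ> \<tau>) (\<sigma>' \<circ> \<tau>')"
proof -
  obtain X Y where XY: "X \<in> intertwiners \<sigma> \<sigma>'" "isometry X" "Y \<in> intertwiners \<tau> \<tau>'" "isometry Y"
    using assms unfolding emb_def by blast
  note h = unital_star_homD[OF assms(1)]
  have "(X * \<sigma> Y)\<^sup>\<star> * (X * \<sigma> Y) = \<sigma> (Y\<^sup>\<star>) * (X\<^sup>\<star> * X) * \<sigma> Y" by (simp add: h star_mult mult.assoc)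
  also have "\<dots> = \<sigma> (Y\<^sup>\<star> * Y)" using XY(2) by (simp add: h isometry_def)
  also have "\<dots> = 1" using XY(4) h(4) unfolding isometry_def by (simp only:)
  finally have "isometry (X * \<sigma> Y)" unfolding isometry_def .
  then show ?thesis unfolding emb_def using intertwiners_tensor[OF assms(1) XY(1,3)] by blast
qed

lemma emb_refl: "emb \<sigma> \<sigma>"
  unfolding emb_def isometry_def using intertwiners_one by (intro bexI[of _ 1]) auto

lemma emb_nonzero:
  assumes "emb \<sigma> \<tau>" obtains X where "X \<in> intertwiners \<sigma> \<tau>" "X \<noteq> 0"
proof -
  obtain X where "X \<in> intertwiners \<sigma> \<tau>" "isometry X" using assms unfolding emb_def by blast
  moreover have "X \<noteq> 0" using \<open>isometry X\<close> unfolding isometry_def by auto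
  ultimately show thesis using that by blast
qed

lemma embI: "\<rho> \<in> irr \<Longrightarrow> \<tau> \<in> Obj \<Longrightarrow> X \<in> intertwiners \<rho> \<tau> \<Longrightarrow> X \<noteq> 0 \<Longrightarrow> emb \<rho> \<tau>"
  unfolding emb_def
  using schur_isometry[OF irrD(3) obj_hom irrD(2)] intertwiners_scaleR by blast

lemma emb_frame:
  assumes "\<sigma> \<in> Obj" "frame Obj \<sigma> Q" "W \<in> Q"
  shows "component \<sigma> W \<in> irr" "emb (component \<sigma> W) \<sigma>"
  using frameD(2-4)[OF assms(2,3)] orthonormalD(2)[OF frameD(1)[OF assms(2)] assms(3,3)]
  unfolding irr_def emb_def isometry_def by auto

text \<open>The projections \<open>\<sigma> (W * W\<^sup>\<star>)\<close> add up to 1, so a nonzero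
  \<open>X\<close> survives compression by one of them. Between an irreducible object and any other,
  a nonzero intertwiner is already a multiple of an isometry.\<close>

lemma emb_tensor_component:
  assumes \<rho>: "\<rho> \<in> irr" and \<sigma>: "\<sigma> \<in> Obj" and \<tau>: "\<tau> \<in> Obj" and e: "emb \<rho> (\<sigma> \<circ> \<tau>)"
  obtains \<kappa> where "\<kappa> \<in> irr" "emb \<kappa> \<tau>" "emb \<rho> (\<sigma> \<circ> \<kappa>)"
proof -
  obtain X where X: "X \<in> intertwiners \<rho> (\<sigma> \<circ> \<tau>)" "X \<noteq> 0" using e by (rule emb_nonzero)
  obtain Q where Q: "frame Obj \<tau> Q" using frame_exists[OF \<tau>] by blast
  note h = unital_star_homD[OF obj_hom[OF \<sigma>]]
  have "\<exists>W\<in>Q. \<sigma> (W\<^sup>\<star>) * X \<noteq> 0"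
  proof (rule ccontr)
    assume "\<not> (\<exists>W\<in>Q. \<sigma> (W\<^sup>\<star>) * X \<noteq> 0)"
    then have "\<sigma> (W * W\<^sup>\<star>) * X = 0" if "W \<in> Q" for W using that by (simp add: h mult.assoc)
    then have "(\<Sum>W\<in>Q. \<sigma> (W * W\<^sup>\<star>) * X) = 0" by simp
    moreover have "(\<Sum>W\<in>Q. \<sigma> (W * W\<^sup>\<star>) * X) = \<sigma> (\<Sum>W\<in>Q. W * W\<^sup>\<star>) * X"
      unfolding unital_star_hom_sum[OF obj_hom[OF \<sigma>]] sum_distrib_right ..
    ultimately show False using X(2) orthonormalD(3)[OF frameD(1)[OF Q]] by (simp add: h)
  qed
  then obtain W where W: "W \<in> Q" "\<sigma> (W\<^sup>\<star>) * X \<noteq> 0" by blast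
  note c = emb_frame[OF \<tau> Q W(1)]
  have "W\<^sup>\<star> \<in> intertwiners \<tau> (component \<tau> W)"
    using frameD(4)[OF Q W(1)] by (rule intertwiners_star[OF irrD(3)[OF c(1)] obj_hom[OF \<tau>]])
  from intertwiners_tensor[OF obj_hom[OF \<sigma>] intertwiners_one this]
  have "\<sigma> (W\<^sup>\<star>) * X \<in> intertwiners \<rho> (\<sigma> \<circ> component \<tau> W)"
    using intertwiners_mult[OF X(1)] by simp
  then have "emb \<rho> (\<sigma> \<circ> component \<tau> W)"
    using embI[OF \<rho> obj_comp[OF \<sigma> irrD(1)[OF c(1)]] _ W(2)] by blast
  with c show thesis by (rule that)
qed

text \<open>The conjugate given by the category is not assumed irreducible. The conjugate equation
  makes \<open>?S\<close> nonzero, so \<open>id\<close> embeds into the product of \<rho> and the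
  conjugate and hence into the product with one irreducible component. The permutation unitary then
  exchanges the factors.\<close>

lemma irr_conjugate:
  assumes \<rho>: "\<rho> \<in> irr"
  obtains \<kappa> where "\<kappa> \<in> irr" "emb id (\<rho> \<circ> \<kappa>)" "emb id (\<kappa> \<circ> \<rho>)"
proof -
  note \<rho>O = irrD(1)[OF \<rho>]
  obtain \<rho>c R where *: "\<rho>c \<in> Obj" "R \<in> intertwiners id (\<rho>c \<circ> \<rho>)" "R\<^sup>\<star> * \<rho>c (\<epsilon> \<rho>c \<rho> * R) = 1"
    using conjugates[OF \<rho>O] unfolding Let_def by blast
  let ?S = "\<epsilon> \<rho>c \<rho> * R"
  have "?S \<in> intertwiners id (\<rho> \<circ> \<rho>c)"
    by (rule intertwiners_mult[OF *(2) perm_arr[OF *(1) \<rho>O]])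
  moreover have "?S \<noteq> 0"
  proof
    assume "?S = 0"
    then show False using *(3) unital_star_hom_zero[OF obj_hom[OF *(1)]] by simp
  qed
  ultimately have "emb id (\<rho> \<circ> \<rho>c)" by (intro embI[OF id_irr obj_comp[OF \<rho>O *(1)]])
  then obtain \<kappa> where \<kappa>: "\<kappa> \<in> irr" "emb \<kappa> \<rho>c" "emb id (\<rho> \<circ> \<kappa>)"
    by (rule emb_tensor_component[OF id_irr \<rho>O *(1)])
  have "emb (\<rho> \<circ> \<kappa>) (\<kappa> \<circ> \<rho>)"
    unfolding emb_def
    using perm_arr[OF \<rho>O irrD(1)[OF \<kappa>(1)]] perm_unitary[OF \<rho>O irrD(1)[OF \<kappa>(1)]]
    by (auto simp: unitary_def isometry_def)
  with \<kappa> show thesis using that emb_trans by blast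
qed

section \<open>Chains of irreducible objects\<close>

definition comp_list :: "('a \<Rightarrow> 'a) list \<Rightarrow> 'a \<Rightarrow> 'a" where
  "comp_list \<rho>s = foldr (\<circ>) \<rho>s id"

lemma comp_list_simps [simp]: "comp_list [] = id" "comp_list (\<rho> # \<rho>s) = \<rho> \<circ> comp_list \<rho>s"
  unfolding comp_list_def by simp_all

lemma comp_list_append: "comp_list (\<rho>s @ \<tau>s) = comp_list \<rho>s \<circ> comp_list \<tau>s"
  by (induction \<rho>s) (simp_all add: comp_assoc)

lemma comp_list_obj: "set \<rho>s \<subseteq> irr \<Longrightarrow> comp_list \<rho>s \<in> Obj"
  by (induction \<rho>s) (auto simp del: comp_apply intro: obj_id obj_comp irrD(1))

text \<open>The chain relation, transported from representations to objects.\<close>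

definition linked :: "('a \<Rightarrow> 'a) \<Rightarrow> ('a \<Rightarrow> 'a) \<Rightarrow> bool" where
  "linked \<rho> \<rho>' \<longleftrightarrow> (\<exists>\<rho>s. \<rho>s \<noteq> [] \<and> set \<rho>s \<subseteq> irr \<and> emb \<rho> (comp_list \<rho>s) \<and> emb \<rho>' (comp_list \<rho>s))"

lemma linked_refl: "\<rho> \<in> irr \<Longrightarrow> linked \<rho> \<rho>"
  unfolding linked_def by (intro exI[of _ "[\<rho>]"]) (auto intro: emb_refl)

lemma linked_sym: "linked \<rho> \<rho>' \<Longrightarrow> linked \<rho>' \<rho>"
  unfolding linked_def by blast

text \<open>
  With \<open>\<kappa>\<close> conjugate to the middle object \<open>\<rho>'\<close>, \<open>\<rho>\<close> embeds into \<open>\<rho> \<kappa> \<rho>'\<close> and \<open>\<rho>''\<close> into \<open>\<rho>' \<kappa> \<rho>''\<close>.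
\<close>

lemma linked_trans:
  assumes \<rho>: "\<rho> \<in> irr" "\<rho>' \<in> irr" "\<rho>'' \<in> irr" and l: "linked \<rho> \<rho>'" "linked \<rho>' \<rho>''"
  shows "linked \<rho> \<rho>''"
proof -
  obtain ps where ps: "ps \<noteq> []" "set ps \<subseteq> irr" "emb \<rho> (comp_list ps)" "emb \<rho>' (comp_list ps)"
    using l(1) unfolding linked_def by blast
  obtain qs where qs: "qs \<noteq> []" "set qs \<subseteq> irr" "emb \<rho>' (comp_list qs)" "emb \<rho>'' (comp_list qs)"
    using l(2) unfolding linked_def by blast
  obtain \<kappa> where \<kappa>: "\<kappa> \<in> irr" "emb id (\<rho>' \<circ> \<kappa>)" "emb id (\<kappa> \<circ> \<rho>')" by (rule irr_conjugate[OF \<rho>(2)])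
  have c: "comp_list (ps @ \<kappa> # qs) = comp_list ps \<circ> (\<kappa> \<circ> comp_list qs)" by (simp add: comp_list_append)
  have "emb (\<rho> \<circ> id) (comp_list ps \<circ> (\<kappa> \<circ> comp_list qs))"
    by (rule emb_tensor[OF irrD(3)[OF \<rho>(1)] ps(3) emb_trans[OF \<kappa>(3) emb_tensor[OF irrD(3)[OF \<kappa>(1)] emb_refl qs(3)]]])
  moreover have "emb (id \<circ> \<rho>'') ((comp_list ps \<circ> \<kappa>) \<circ> comp_list qs)"
    by (rule emb_tensor[OF unital_star_hom_id emb_trans[OF \<kappa>(2) emb_tensor[OF irrD(3)[OF \<rho>(2)] ps(4) emb_refl]] qs(4)])
  ultimately have "emb \<rho> (comp_list (ps @ \<kappa> # qs))" "emb \<rho>'' (comp_list (ps @ \<kappa> # qs))"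
    unfolding c by (simp_all add: comp_assoc)
  then show ?thesis
    unfolding linked_def using ps(2) qs(2) \<kappa>(1) by (intro exI[of _ "ps @ \<kappa> # qs"]) auto
qed

text \<open>Concatenating the two lists links the products. This is why multiplication of chain
  classes does not depend on the representatives.\<close>

lemma linked_comp:
  assumes "\<rho>\<^sub>0 \<in> irr" "\<rho>\<^sub>0' \<in> irr" "linked \<rho>\<^sub>0 \<rho>\<^sub>0'" "linked \<rho>\<^sub>1 \<rho>\<^sub>1'" "emb \<rho> (\<rho>\<^sub>0 \<circ> \<rho>\<^sub>1)" "emb \<rho>' (\<rho>\<^sub>0' \<circ> \<rho>\<^sub>1')"
  shows "linked \<rho> \<rho>'"
proof -
  obtain ps where ps: "ps \<noteq> []" "set ps \<subseteq> irr" "emb \<rho>\<^sub>0 (comp_list ps)" "emb \<rho>\<^sub>0' (comp_list ps)"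
    using assms(3) unfolding linked_def by blast
  obtain qs where qs: "set qs \<subseteq> irr" "emb \<rho>\<^sub>1 (comp_list qs)" "emb \<rho>\<^sub>1' (comp_list qs)"
    using assms(4) unfolding linked_def by blast
  have "emb \<rho> (comp_list (ps @ qs))" "emb \<rho>' (comp_list (ps @ qs))"
    unfolding comp_list_append
    using emb_trans[OF assms(5) emb_tensor[OF irrD(3)[OF assms(1)] ps(3) qs(2)]]
      emb_trans[OF assms(6) emb_tensor[OF irrD(3)[OF assms(2)] ps(4) qs(3)]] by blast+
  then show ?thesis
    unfolding linked_def using ps(1,2) qs(1) by (intro exI[of _ "ps @ qs"]) auto
qed

section \<open>Translation into classes of representations\<close>

lemma irreducible_rep_unitary: "irreducible_rep G T U \<Longrightarrow> unitary_rep G T U"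
  unfolding irreducible_rep_def by blast

lemma rep_class_eq:
  assumes "unitary_rep G T U" "unitary_rep G T V" "equivalent_rep G U V"
  shows "rep_class G T U = rep_class G T V"
  unfolding rep_class_def
  using equivalent_rep_trans[OF assms(2,1) _ equivalent_rep_sym[OF assms]]
    equivalent_rep_trans[OF assms(1,2) _ assms(3)] irreducible_rep_unitary by blast

lemma cls_dual: "\<rho> \<in> irr \<Longrightarrow> cls \<rho> \<in> dual G T"
  unfolding cls_def dual_def using irreducible_rep_Fo irrD by blast

lemma dual_cls:
  assumes "D \<in> dual G T"
  obtains \<rho> where "\<rho> \<in> irr" "D = cls \<rho>"
proof -
  obtain U where U: "irreducible_rep G T U" "D = rep_class G T U" using assms unfolding dual_def by blast
  obtain \<rho> where \<rho>: "\<rho> \<in> Obj" "equivalent_rep G (Fo \<rho>) U"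
    using Fo_ess_surj[OF irreducible_rep_unitary[OF U(1)]] by blast
  have "\<rho> \<in> irr" unfolding irr_def using irreducible_endo_if_rep[OF \<rho>(1) U(1) \<rho>(2)] \<rho>(1) by simp
  moreover have "D = cls \<rho>"
    unfolding U(2) cls_def using rep_class_eq[OF Fo_rep[OF \<rho>(1)] irreducible_rep_unitary[OF U(1)] \<rho>(2)] by simp
  ultimately show thesis by (rule that)
qed

lemma cls_mem: "U \<in> cls \<rho> \<longleftrightarrow> irreducible_rep G T U \<and> equivalent_rep G (Fo \<rho>) U"
  unfolding cls_def rep_class_def by blast

lemma Fo_cls: "\<rho> \<in> irr \<Longrightarrow> Fo \<rho> \<in> cls \<rho>"
  unfolding cls_mem using irreducible_rep_Fo irrD Fo_rep equivalent_rep_refl by blast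

text \<open>The functor is full and faithful and respects star and composition, so it both preserves
  and reflects isometries.\<close>

lemma emb_rep:
  assumes \<sigma>: "\<sigma> \<in> Obj" and \<tau>: "\<tau> \<in> Obj"
  shows "emb \<sigma> \<tau> \<longleftrightarrow> (\<exists>M\<in>rep_intertwiners G (Fo \<sigma>) (Fo \<tau>). mat_adjoint M * M = 1\<^sub>m (dm \<sigma>))"
proof -
  have iso: "isometry X \<longleftrightarrow> mat_adjoint (Fm \<sigma> \<tau> X) * Fm \<sigma> \<tau> X = 1\<^sub>m (dm \<sigma>)" if X: "X \<in> intertwiners \<sigma> \<tau>" for X
  proof -
    note Xs = arr_star[OF \<sigma> \<tau> X]
    have "mat_adjoint (Fm \<sigma> \<tau> X) * Fm \<sigma> \<tau> X = Fm \<sigma> \<sigma> (X\<^sup>\<star> * X)"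
      using Fm_comp[OF \<sigma> \<tau> \<sigma> X Xs] Fm_star[OF \<sigma> \<tau> X] by simp
    then show ?thesis
      using Fm_inject[OF \<sigma> \<sigma> intertwiners_mult[OF X Xs] intertwiners_one] Fm_one[OF \<sigma>]
      by (simp add: isometry_def)
  qed
  show ?thesis
  proof
    assume "emb \<sigma> \<tau>"
    then show "\<exists>M\<in>rep_intertwiners G (Fo \<sigma>) (Fo \<tau>). mat_adjoint M * M = 1\<^sub>m (dm \<sigma>)"
      unfolding emb_def using iso Fm_in[OF \<sigma> \<tau>] by blast
  next
    assume "\<exists>M\<in>rep_intertwiners G (Fo \<sigma>) (Fo \<tau>). mat_adjoint M * M = 1\<^sub>m (dm \<sigma>)"
    then obtain M where M: "M \<in> rep_intertwiners G (Fo \<sigma>) (Fo \<tau>)" "mat_adjoint M * M = 1\<^sub>m (dm \<sigma>)" by blast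
    obtain X where "X \<in> intertwiners \<sigma> \<tau>" "Fm \<sigma> \<tau> X = M" by (rule Fm_surj[OF \<sigma> \<tau> M(1)])
    then show "emb \<sigma> \<tau>" unfolding emb_def using iso M(2) by blast
  qed
qed

text \<open>Between irreducible objects an embedding is nonzero, hence by Schur's lemma there is a
  unitary, which the functor takes to an equivalence of representations.\<close>

lemma cls_eq_iff:
  assumes \<rho>: "\<rho> \<in> irr" "\<rho>' \<in> irr"
  shows "cls \<rho> = cls \<rho>' \<longleftrightarrow> emb \<rho> \<rho>'"
proof
  assume "cls \<rho> = cls \<rho>'"
  then have "equivalent_rep G (Fo \<rho>) (Fo \<rho>')" using Fo_cls[OF \<rho>(2)] cls_mem by blast
  then obtain K where K: "K \<in> rep_intertwiners G (Fo \<rho>) (Fo \<rho>')" "unitary_mat K"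
    unfolding equivalent_rep_def by blast
  note u = unitary_matD[OF K(2) rep_intertwinersD(1)[OF K(1)]]
  show "emb \<rho> \<rho>'" unfolding emb_rep[OF irrD(1)[OF \<rho>(1)] irrD(1)[OF \<rho>(2)]] using K(1) u by auto
next
  assume "emb \<rho> \<rho>'"
  then obtain X where X: "X \<in> intertwiners \<rho> \<rho>'" "X \<noteq> 0" by (rule emb_nonzero)
  note O = irrD(1)[OF \<rho>(1)] irrD(1)[OF \<rho>(2)]
  obtain U where U: "U \<in> intertwiners \<rho> \<rho>'" "unitary U"
    using schur_unitary(2)[OF irrD(3)[OF \<rho>(1)] irrD(3)[OF \<rho>(2)] irrD(2)[OF \<rho>(1)] irrD(2)[OF \<rho>(2)] X]
    unfolding equivalent_endo_def by blast
  note Us = arr_star[OF O U(1)] and M = Fm_carrier[OF O U(1)]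
  have 1: "mat_adjoint (Fm \<rho> \<rho>' U) * Fm \<rho> \<rho>' U = 1\<^sub>m (dm \<rho>)"
    using Fm_comp[OF O(1) O(2) O(1) U(1) Us] Fm_star[OF O U(1)] Fm_one[OF O(1)] U(2) by (simp add: unitary_def)
  have 2: "Fm \<rho> \<rho>' U * mat_adjoint (Fm \<rho> \<rho>' U) = 1\<^sub>m (dm \<rho>')"
    using Fm_comp[OF O(2) O(1) O(2) Us U(1)] Fm_star[OF O U(1)] Fm_one[OF O(2)] U(2) by (simp add: unitary_def)
  \<comment> \<open>A \<open>unitary_mat\<close> is square by definition; the equality of the
    dimensions is obtained by taking traces of the two products.\<close>
  have "of_nat (dm \<rho>) = (of_nat (dm \<rho>') :: complex)"
    using tr_mult_commute[OF M mat_adjoint_carrier[OF M]] unfolding 1 2 by (simp add: tr_one)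
  then have "unitary_mat (Fm \<rho> \<rho>' U)" using 1 2 M unfolding unitary_mat_def by auto
  then have "equivalent_rep G (Fo \<rho>) (Fo \<rho>')" unfolding equivalent_rep_def using Fm_in[OF O U(1)] by blast
  then show "cls \<rho> = cls \<rho>'" unfolding cls_def by (rule rep_class_eq[OF Fo_rep[OF O(1)] Fo_rep[OF O(2)]])
qed

text \<open>Membership in \<open>class_times\<close> is witnessed by arbitrary representatives
  \<open>U\<close>, \<open>U1\<close>, \<open>U2\<close>. Unitary equivalences move them to the
  images of the objects, and the tensor structure \<open>J\<close> identifies the product of the
  images with the image of the composition. All these maps preserve isometries.\<close>

lemma cls_class_times:
  assumes \<rho>: "\<rho> \<in> irr" "\<rho>\<^sub>1 \<in> irr" "\<rho>\<^sub>2 \<in> irr"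
  shows "cls \<rho> \<in> class_times G T (cls \<rho>\<^sub>1) (cls \<rho>\<^sub>2) \<longleftrightarrow> emb \<rho> (\<rho>\<^sub>1 \<circ> \<rho>\<^sub>2)"
proof -
  note O = irrD(1)[OF \<rho>(1)] irrD(1)[OF \<rho>(2)] irrD(1)[OF \<rho>(3)]
  note O12 = obj_comp[OF O(2,3)]
  note F = Fo_rep[OF O(1)] Fo_rep[OF O(2)] Fo_rep[OF O(3)] Fo_rep[OF O12]
  note FF = unitary_rep_tensor[OF F(2,3)]
  note J = J_arr[OF O(2,3)]
  note Jc = rep_intertwinersD(1)[OF J]
  note Ju = unitary_matD[OF J_unitary[OF O(2,3)] Jc]
  note Ja = mat_adjoint_carrier[OF Jc]
  show ?thesis
  proof
    assume "cls \<rho> \<in> class_times G T (cls \<rho>\<^sub>1) (cls \<rho>\<^sub>2)"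
    then obtain U U1 U2 M where *: "U \<in> cls \<rho>" "U1 \<in> cls \<rho>\<^sub>1" "U2 \<in> cls \<rho>\<^sub>2"
      "M \<in> rep_intertwiners G U (tensor_rep U1 U2)" "mat_adjoint M * M = 1\<^sub>m (rep_dim G U)"
      unfolding class_times_def by blast
    have r: "unitary_rep G T U" "unitary_rep G T U1" "unitary_rep G T U2"
      and eq: "equivalent_rep G (Fo \<rho>) U" "equivalent_rep G (Fo \<rho>\<^sub>1) U1" "equivalent_rep G (Fo \<rho>\<^sub>2) U2"
      using *(1-3) irreducible_rep_unitary unfolding cls_mem by blast+
    note rr = unitary_rep_tensor[OF r(2,3)]
    obtain K where K: "K \<in> rep_intertwiners G (Fo \<rho>) U" "unitary_mat K"
      using eq(1) unfolding equivalent_rep_def by blast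
    obtain K1 where K1: "K1 \<in> rep_intertwiners G U1 (Fo \<rho>\<^sub>1)" "unitary_mat K1"
      using equivalent_rep_sym[OF F(2) r(2) eq(2)] unfolding equivalent_rep_def by blast
    obtain K2 where K2: "K2 \<in> rep_intertwiners G U2 (Fo \<rho>\<^sub>2)" "unitary_mat K2"
      using equivalent_rep_sym[OF F(3) r(3) eq(3)] unfolding equivalent_rep_def by blast
    let ?K = "kronecker K1 K2"
    have KK: "?K \<in> rep_intertwiners G (tensor_rep U1 U2) (tensor_rep (Fo \<rho>\<^sub>1) (Fo \<rho>\<^sub>2))"
      by (rule rep_intertwiners_kronecker[OF r(2) F(2) r(3) F(3) K1(1) K2(1)])
    note c = rep_intertwinersD(1)[OF K(1)] rep_intertwinersD(1)[OF *(4)] rep_intertwinersD(1)[OF KK]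
    note u = unitary_matD[OF K(2) c(1)] unitary_matD[OF unitary_mat_kronecker[OF K1(2) K2(2)] c(3)]
    have "J \<rho>\<^sub>1 \<rho>\<^sub>2 * (?K * (M * K)) \<in> rep_intertwiners G (Fo \<rho>) (Fo (\<rho>\<^sub>1 \<circ> \<rho>\<^sub>2))"
      by (rule rep_intertwiners_mult[OF F(1) FF F(4) rep_intertwiners_mult[OF F(1) rr FF
          rep_intertwiners_mult[OF F(1) r(1) rr K(1) *(4)] KK] J])
    moreover have "mat_adjoint (J \<rho>\<^sub>1 \<rho>\<^sub>2 * (?K * (M * K))) * (J \<rho>\<^sub>1 \<rho>\<^sub>2 * (?K * (M * K))) = 1\<^sub>m (dm \<rho>)"
    proof (rule isometry_mat_mult[OF _ _ Jc])
      show "?K * (M * K) \<in> carrier_mat (rep_dim G (tensor_rep (Fo \<rho>\<^sub>1) (Fo \<rho>\<^sub>2))) (dm \<rho>)"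
        using c by (metis mult_carrier_mat)
      have "mat_adjoint K * K = 1\<^sub>m (dm \<rho>)" using u(1,2) by simp
      then have "mat_adjoint (M * K) * (M * K) = 1\<^sub>m (dm \<rho>)"
        by (rule isometry_mat_mult[OF c(1) _ c(2) *(5)])
      then show "mat_adjoint (?K * (M * K)) * (?K * (M * K)) = 1\<^sub>m (dm \<rho>)"
        by (rule isometry_mat_mult[OF mult_carrier_mat[OF c(2,1)] _ c(3)]) (use u(4,5) in simp)
      show "mat_adjoint (J \<rho>\<^sub>1 \<rho>\<^sub>2) * J \<rho>\<^sub>1 \<rho>\<^sub>2 = 1\<^sub>m (rep_dim G (tensor_rep (Fo \<rho>\<^sub>1) (Fo \<rho>\<^sub>2)))"
        using Ju(1,2) by simp
    qed
    ultimately show "emb \<rho> (\<rho>\<^sub>1 \<circ> \<rho>\<^sub>2)" unfolding emb_rep[OF O(1) O12] by blast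
  next
    assume "emb \<rho> (\<rho>\<^sub>1 \<circ> \<rho>\<^sub>2)"
    then obtain M where M: "M \<in> rep_intertwiners G (Fo \<rho>) (Fo (\<rho>\<^sub>1 \<circ> \<rho>\<^sub>2))" "mat_adjoint M * M = 1\<^sub>m (dm \<rho>)"
      unfolding emb_rep[OF O(1) O12] by blast
    let ?N = "mat_adjoint (J \<rho>\<^sub>1 \<rho>\<^sub>2) * M"
    have "?N \<in> rep_intertwiners G (Fo \<rho>) (tensor_rep (Fo \<rho>\<^sub>1) (Fo \<rho>\<^sub>2))"
      by (rule rep_intertwiners_mult[OF F(1) F(4) FF M(1) rep_intertwiners_adjoint[OF FF F(4) J]])
    moreover have "mat_adjoint ?N * ?N = 1\<^sub>m (dm \<rho>)"
      by (rule isometry_mat_mult[OF rep_intertwinersD(1)[OF M(1)] M(2) Ja]) (simp add: Ju(3))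
    ultimately show "cls \<rho> \<in> class_times G T (cls \<rho>\<^sub>1) (cls \<rho>\<^sub>2)"
      unfolding class_times_def using cls_dual[OF \<rho>(1)] Fo_cls \<rho> by blast
  qed
qed

text \<open>Induction on the list. An embedding into the composition of the whole list passes
  through an irreducible component of the tail by \<open>emb_tensor_component\<close>, and the class
  of that component is the \<open>E\<close> in the recursion of
  \<open>class_times_list\<close>.\<close>

lemma cls_class_times_list:
  assumes "\<rho> \<in> irr" "set \<rho>s \<subseteq> irr" "\<rho>s \<noteq> []"
  shows "cls \<rho> \<in> class_times_list G T (map cls \<rho>s) \<longleftrightarrow> emb \<rho> (comp_list \<rho>s)"
  using assms
proof (induction \<rho>s arbitrary: \<rho> rule: induct_list012)
  case (2 \<rho>\<^sub>1)
  then show ?case using cls_eq_iff[of \<rho> \<rho>\<^sub>1] by simp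
next
  case (3 \<rho>\<^sub>1 \<rho>\<^sub>2 \<rho>s)
  let ?l = "\<rho>\<^sub>2 # \<rho>s"
  have IH: "cls \<kappa> \<in> class_times_list G T (map cls ?l) \<longleftrightarrow> emb \<kappa> (comp_list ?l)" if "\<kappa> \<in> irr" for \<kappa>
    by (rule "3.IH"(2)[OF that]) (use "3.prems" in simp_all)
  have \<rho>\<^sub>1: "\<rho>\<^sub>1 \<in> irr" and l: "set ?l \<subseteq> irr" using 3 by auto
  \<comment> \<open>Needed to write every intermediate class \<open>E\<close> as the class of an
    irreducible object.\<close>
  have sub: "class_times_list G T (map cls ?l) \<subseteq> dual G T"
  proof (cases \<rho>s)
    case Nil
    then show ?thesis using cls_dual l by simp
  next
    case (Cons a list)
    then show ?thesis by (auto simp: class_times_def)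
  qed
  have "cls \<rho> \<in> class_times_list G T (map cls (\<rho>\<^sub>1 # ?l)) \<longleftrightarrow>
      (\<exists>E\<in>class_times_list G T (map cls ?l). cls \<rho> \<in> class_times G T (cls \<rho>\<^sub>1) E)"
    by simp
  also have "\<dots> \<longleftrightarrow> (\<exists>\<kappa>\<in>irr. emb \<kappa> (comp_list ?l) \<and> emb \<rho> (\<rho>\<^sub>1 \<circ> \<kappa>))"
  proof
    assume "\<exists>E\<in>class_times_list G T (map cls ?l). cls \<rho> \<in> class_times G T (cls \<rho>\<^sub>1) E"
    then obtain E where E: "E \<in> class_times_list G T (map cls ?l)" "cls \<rho> \<in> class_times G T (cls \<rho>\<^sub>1) E" by blast
    obtain \<kappa> where \<kappa>: "\<kappa> \<in> irr" "E = cls \<kappa>" using dual_cls E(1) sub by blast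
    show "\<exists>\<kappa>\<in>irr. emb \<kappa> (comp_list ?l) \<and> emb \<rho> (\<rho>\<^sub>1 \<circ> \<kappa>)"
      using E IH[OF \<kappa>(1)] cls_class_times[OF 3(3) \<rho>\<^sub>1 \<kappa>(1)] \<kappa> by blast
  next
    assume "\<exists>\<kappa>\<in>irr. emb \<kappa> (comp_list ?l) \<and> emb \<rho> (\<rho>\<^sub>1 \<circ> \<kappa>)"
    then show "\<exists>E\<in>class_times_list G T (map cls ?l). cls \<rho> \<in> class_times G T (cls \<rho>\<^sub>1) E"
      using IH cls_class_times[OF 3(3) \<rho>\<^sub>1] by blast
  qed
  also have "\<dots> \<longleftrightarrow> emb \<rho> (\<rho>\<^sub>1 \<circ> comp_list ?l)"
  proof
    assume "\<exists>\<kappa>\<in>irr. emb \<kappa> (comp_list ?l) \<and> emb \<rho> (\<rho>\<^sub>1 \<circ> \<kappa>)"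
    then obtain \<kappa> where "emb \<kappa> (comp_list ?l)" "emb \<rho> (\<rho>\<^sub>1 \<circ> \<kappa>)" by blast
    then show "emb \<rho> (\<rho>\<^sub>1 \<circ> comp_list ?l)"
      using emb_trans emb_tensor[OF irrD(3)[OF \<rho>\<^sub>1] emb_refl] by blast
  next
    assume "emb \<rho> (\<rho>\<^sub>1 \<circ> comp_list ?l)"
    then show "\<exists>\<kappa>\<in>irr. emb \<kappa> (comp_list ?l) \<and> emb \<rho> (\<rho>\<^sub>1 \<circ> \<kappa>)"
      using emb_tensor_component[OF 3(3) irrD(1)[OF \<rho>\<^sub>1] comp_list_obj[OF l]] by metis
  qed
  finally show ?case by (simp only: comp_list_simps)
qed simp

lemma chain_equiv_cls:
  assumes "\<rho> \<in> irr" "\<rho>' \<in> irr"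
  shows "chain_equiv G T (cls \<rho>) (cls \<rho>') \<longleftrightarrow> linked \<rho> \<rho>'"
proof
  assume "chain_equiv G T (cls \<rho>) (cls \<rho>')"
  then obtain Ds where Ds: "set Ds \<subseteq> dual G T" "cls \<rho> \<in> class_times_list G T Ds" "cls \<rho>' \<in> class_times_list G T Ds"
    unfolding chain_equiv_def by blast
  have "\<forall>D\<in>dual G T. \<exists>\<kappa>. \<kappa> \<in> irr \<and> cls \<kappa> = D" using dual_cls by metis
  then obtain f where f: "\<forall>D\<in>dual G T. f D \<in> irr \<and> cls (f D) = D" by metis
  define \<rho>s where "\<rho>s = map f Ds"
  have \<rho>s: "set \<rho>s \<subseteq> irr" "Ds = map cls \<rho>s"
    unfolding \<rho>s_def using f Ds(1) by (auto simp: map_idI subset_iff)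
  \<comment> \<open>The value of \<open>class_times_list\<close> at the empty list is the empty set,
    so a list with a member in its product is nonempty.\<close>
  moreover have "\<rho>s \<noteq> []" using Ds(2) \<rho>s(2) by auto
  ultimately show "linked \<rho> \<rho>'"
    unfolding linked_def using Ds(2,3) cls_class_times_list[OF assms(1)] cls_class_times_list[OF assms(2)] by blast
next
  assume "linked \<rho> \<rho>'"
  then obtain \<rho>s where \<rho>s: "\<rho>s \<noteq> []" "set \<rho>s \<subseteq> irr" "emb \<rho> (comp_list \<rho>s)" "emb \<rho>' (comp_list \<rho>s)"
    unfolding linked_def by blast
  have "set (map cls \<rho>s) \<subseteq> dual G T" using \<rho>s(2) cls_dual by auto
  then show "chain_equiv G T (cls \<rho>) (cls \<rho>')"
    unfolding chain_equiv_def
    using cls_class_times_list[OF assms(1) \<rho>s(2,1)] cls_class_times_list[OF assms(2) \<rho>s(2,1)] \<rho>s(3,4) by blast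
qed

lemma chain_class_cls:
  assumes "\<rho> \<in> irr"
  shows "chain_class G T (cls \<rho>) = cls ` {\<rho>' \<in> irr. linked \<rho> \<rho>'}"
proof
  show "chain_class G T (cls \<rho>) \<subseteq> cls ` {\<rho>' \<in> irr. linked \<rho> \<rho>'}"
  proof
    fix D assume D: "D \<in> chain_class G T (cls \<rho>)"
    then have "D \<in> dual G T" unfolding chain_class_def by blast
    then obtain \<rho>' where "\<rho>' \<in> irr" "D = cls \<rho>'" by (rule dual_cls)
    with D show "D \<in> cls ` {\<rho>' \<in> irr. linked \<rho> \<rho>'}"
      unfolding chain_class_def using chain_equiv_cls[OF assms] by blast
  qed
  show "cls ` {\<rho>' \<in> irr. linked \<rho> \<rho>'} \<subseteq> chain_class G T (cls \<rho>)"
    unfolding chain_class_def using chain_equiv_cls[OF assms] cls_dual by blast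
qed

lemma chain_class_eq:
  assumes "\<rho> \<in> irr" "\<rho>' \<in> irr" "linked \<rho> \<rho>'"
  shows "chain_class G T (cls \<rho>) = chain_class G T (cls \<rho>')"
proof -
  have "linked \<rho> \<kappa> \<longleftrightarrow> linked \<rho>' \<kappa>" if "\<kappa> \<in> irr" for \<kappa>
    using linked_trans[OF assms(1,2) that assms(3)] linked_trans[OF assms(2,1) that linked_sym[OF assms(3)]] by blast
  then show ?thesis unfolding chain_class_cls[OF assms(1)] chain_class_cls[OF assms(2)] by (metis (no_types, lifting) Collect_cong)
qed

text \<open>The group product is a definite description, so its value has to be unique: by
  \<open>linked_comp\<close>, any other choice of representatives and of a class in their product
  leads to an object linked to \<rho>, hence to the same chain class.\<close>

lemma chain_group_mult:
  assumes \<rho>: "\<rho> \<in> irr" "\<rho>\<^sub>1 \<in> irr" "\<rho>\<^sub>2 \<in> irr" and e: "emb \<rho> (\<rho>\<^sub>1 \<circ> \<rho>\<^sub>2)"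
  shows "chain_class G T (cls \<rho>\<^sub>1) \<otimes>\<^bsub>chain_group G T\<^esub> chain_class G T (cls \<rho>\<^sub>2) = chain_class G T (cls \<rho>)"
  unfolding chain_group_def monoid.simps
proof (rule the_equality)
  have "cls \<rho>\<^sub>1 \<in> chain_class G T (cls \<rho>\<^sub>1)" "cls \<rho>\<^sub>2 \<in> chain_class G T (cls \<rho>\<^sub>2)"
    unfolding chain_class_cls[OF \<rho>(2)] chain_class_cls[OF \<rho>(3)] using \<rho> linked_refl by blast+
  moreover have "cls \<rho> \<in> class_times G T (cls \<rho>\<^sub>1) (cls \<rho>\<^sub>2)" using e cls_class_times[OF \<rho>] by blast
  ultimately show "\<exists>D\<^sub>0\<in>chain_class G T (cls \<rho>\<^sub>1). \<exists>D\<^sub>1\<in>chain_class G T (cls \<rho>\<^sub>2).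
      \<exists>D\<in>class_times G T D\<^sub>0 D\<^sub>1. chain_class G T (cls \<rho>) = chain_class G T D" by blast
next
  fix c
  assume "\<exists>D\<^sub>0\<in>chain_class G T (cls \<rho>\<^sub>1). \<exists>D\<^sub>1\<in>chain_class G T (cls \<rho>\<^sub>2).
      \<exists>D\<in>class_times G T D\<^sub>0 D\<^sub>1. c = chain_class G T D"
  then obtain D0 D1 D where D: "D0 \<in> chain_class G T (cls \<rho>\<^sub>1)" "D1 \<in> chain_class G T (cls \<rho>\<^sub>2)"
    "D \<in> class_times G T D0 D1" "c = chain_class G T D" by blast
  obtain \<sigma>\<^sub>1 where \<sigma>\<^sub>1: "\<sigma>\<^sub>1 \<in> irr" "linked \<rho>\<^sub>1 \<sigma>\<^sub>1" "D0 = cls \<sigma>\<^sub>1" using D(1) unfolding chain_class_cls[OF \<rho>(2)] by blast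
  obtain \<sigma>\<^sub>2 where \<sigma>\<^sub>2: "\<sigma>\<^sub>2 \<in> irr" "linked \<rho>\<^sub>2 \<sigma>\<^sub>2" "D1 = cls \<sigma>\<^sub>2" using D(2) unfolding chain_class_cls[OF \<rho>(3)] by blast
  have "D \<in> dual G T" using D(3) unfolding class_times_def by blast
  then obtain \<sigma> where \<sigma>: "\<sigma> \<in> irr" "D = cls \<sigma>" by (rule dual_cls)
  have "emb \<sigma> (\<sigma>\<^sub>1 \<circ> \<sigma>\<^sub>2)" using D(3) cls_class_times[OF \<sigma>(1) \<sigma>\<^sub>1(1) \<sigma>\<^sub>2(1)] unfolding \<sigma> \<sigma>\<^sub>1(3) \<sigma>\<^sub>2(3) by blast
  then have "linked \<rho> \<sigma>" by (rule linked_comp[OF \<rho>(2) \<sigma>\<^sub>1(1) \<sigma>\<^sub>1(2) \<sigma>\<^sub>2(2) e])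
  then show "c = chain_class G T (cls \<rho>)" unfolding D(4) \<sigma>(2) using chain_class_eq[OF \<rho>(1) \<sigma>(1)] by simp
qed

end

theorem theorem6p2:
  fixes tens :: "'a::cstar_algebra \<Rightarrow> 'z::{cstar_algebra,comm_ring_1} \<Rightarrow> 't::cstar_algebra"
    and Obj :: "('a \<Rightarrow> 'a) set"
    and \<epsilon> :: "('a \<Rightarrow> 'a) \<Rightarrow> ('a \<Rightarrow> 'a) \<Rightarrow> 'a"
    and G :: "('g, 'm) monoid_scheme"
    and T :: "'g topology"
    and Fo :: "('a \<Rightarrow> 'a) \<Rightarrow> 'g rep"
    and Fm :: "('a \<Rightarrow> 'a) \<Rightarrow> ('a \<Rightarrow> 'a) \<Rightarrow> 'a \<Rightarrow> complex mat"
    and J :: "('a \<Rightarrow> 'a) \<Rightarrow> ('a \<Rightarrow> 'a) \<Rightarrow> complex mat"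
    and J\<^sub>0 :: "complex mat"
    and \<alpha> :: "'g rep set set \<Rightarrow> 'z \<Rightarrow> 'z"
  assumes trivial_center: "(center :: 'a set) = scalars"
    and property_B: "property_B TYPE('a)"
    and tensor_product: "cstar_tensor_product tens"
    and dr: "dr_category_with Obj intertwiners \<epsilon>"
    and duality: "dr_duality G T Obj \<epsilon> Fo Fm J J\<^sub>0"
    and alpha_hom: "\<alpha> \<in> hom (chain_group G T) aut_group"
  shows "(center :: 't set) = range (tens 1) \<and>
    admissible_subcategory (T_obj tens Obj (chain_aut G T Fo \<alpha>)) intertwiners
      (TC_arr tens Obj (chain_aut G T Fo \<alpha>))"
proof -
  interpret S: dr_system Obj \<epsilon> G T Fo Fm J J\<^sub>0
    using dr duality by (rule dr_system.intro)
  have aut: "chain_aut G T Fo \<alpha> \<rho> = \<alpha> (chain_class G T (S.cls \<rho>))" for \<rho>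
    unfolding chain_aut_def S.cls_def ..
  have carr: "chain_class G T (S.cls \<rho>) \<in> carrier (chain_group G T)" if "\<rho> \<in> S.irr" for \<rho>
    unfolding chain_group_def using S.cls_dual[OF that] by simp
  \<comment> \<open>The automorphism properties hold because \<alpha> takes values in the
    automorphism group. The multiplicativity is the homomorphism property of \<alpha>: a nonzero
    arrow from \<rho> to a composition makes the chain class of \<rho> the product of the chain
    classes of the factors.\<close>
  interpret chain_data tens Obj \<epsilon> "chain_aut G T Fo \<alpha>"
  proof (rule chain_data.intro[OF tensor_product dr], unfold_locales)
    fix \<rho> assume "\<rho> \<in> Obj" "irreducible_endo \<rho>"
    then have "\<rho> \<in> S.irr" unfolding S.irr_def by simp
    have "chain_aut G T Fo \<alpha> \<rho> \<in> carrier aut_group"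
      unfolding aut by (rule hom_in_carrier[OF alpha_hom carr[OF \<open>\<rho> \<in> S.irr\<close>]])
    then show "unital_star_hom (chain_aut G T Fo \<alpha> \<rho>)" "bij (chain_aut G T Fo \<alpha> \<rho>)"
      unfolding aut_group_def by simp_all
  next
    fix \<rho> \<rho>\<^sub>1 \<rho>\<^sub>2 M
    assume "\<rho> \<in> Obj" "\<rho>\<^sub>1 \<in> Obj" "\<rho>\<^sub>2 \<in> Obj" "irreducible_endo \<rho>" "irreducible_endo \<rho>\<^sub>1" "irreducible_endo \<rho>\<^sub>2"
      and M: "M \<in> intertwiners \<rho> (\<rho>\<^sub>1 \<circ> \<rho>\<^sub>2)" "M \<noteq> 0"
    then have \<rho>: "\<rho> \<in> S.irr" "\<rho>\<^sub>1 \<in> S.irr" "\<rho>\<^sub>2 \<in> S.irr" unfolding S.irr_def by simp_all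
    have e: "S.emb \<rho> (\<rho>\<^sub>1 \<circ> \<rho>\<^sub>2)"
      by (rule S.embI[OF \<rho>(1) S.obj_comp[OF S.irrD(1)[OF \<rho>(2)] S.irrD(1)[OF \<rho>(3)]] M])
    show "chain_aut G T Fo \<alpha> \<rho> = chain_aut G T Fo \<alpha> \<rho>\<^sub>1 \<circ> chain_aut G T Fo \<alpha> \<rho>\<^sub>2"
      unfolding aut S.chain_group_mult[OF \<rho> e, symmetric] hom_mult[OF alpha_hom carr[OF \<rho>(2)] carr[OF \<rho>(3)]]
      by (simp add: aut_group_def)
  qed (use trivial_center S.frame_exists in auto)
  show ?thesis
    using tp.center_tensor[OF trivial_center] admissible by blast
qed

end
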